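(* Let $1<p<N$, let $\Omega$ be a domain in $\mathbb{R}^N$ and let $K$ be a piecewise smooth surface of codimension $k\le N$ (with the conventions for $k=1$ and $k=N$ given in the context). Put $d(x)=\mathrm{dist}(x,K)$, assume $\sup_{x\in\Omega}d(x)<\infty$ and let $D>\sup_{x\in\Omega}d(x)$. Suppose moreover that $p\neq k$ and $\Delta_p d^{\frac{p-k}{p-1}}\le 0$ in $\Omega\setminus K$ in the weak sense, i.e. $(p-k)A[\phi]\le 0$ for all non-negative $\phi\in C^1_c(\Omega\setminus K)$, where $A[\phi]=-\int_\Omega d\,\nabla d\cdot\nabla\phi\,dx-k\int_\Omega\phi\,dx$. Then for any $p<q\le Np/(N-p)$ there exists $c=c(p,q,D,\Omega,K)>0$ such that $$\int_\Omega|\nabla u|^p\,dx-\left|\frac{k-p}{p}\right|^p\int_\Omega\frac{|u|^p}{d^p}\,dx\ \ge\ c\left(\int_\Omega|u|^q\,d^{-q-N+Nq/p}X^{2q/p}(d/D)\,dx\right)^{p/q}$$ for all $u\in W^{1,p}_0(\Omega\setminus K)$.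
   Context: $X(t)=-1/\log t$ for $t\in(0,1)$. Conventions on $K$: for $2\le k\le N-1$, $K$ is a piecewise smooth, closed and connected surface of codimension $k$ in $\mathbb{R}^N$; for $k=N$, $K$ is a single point, say the origin, so $d(x)=|x|$; for $k=1$, $K=\partial\Omega$, so $d$ is the distance from the boundary. The function $d$ is Lipschitz with $|\nabla d|=1$ a.e. $\Delta_p w=\mathrm{div}(|\nabla w|^{p-2}\nabla w)$ is the $p$-Laplacian. Formally, $A[\phi]=\int_\Omega(d\Delta d+1-k)\phi\,dx$. *)

theory Defs
  imports "HOL-Analysis.Analysis"
begin

subsection \<open>Differentiable functions and test functions\<close>

text \<open>Classical gradient. At points where \<open>f\<close> is not differentiable the value is
  unspecified; below it is only used under Lebesgue integrals, for functions that are
  differentiable almost everywhere (smooth functions and distance functions).\<close>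

definition grad :: "('a::euclidean_space \<Rightarrow> real) \<Rightarrow> 'a \<Rightarrow> 'a" where
  "grad f x = (\<Sum>b\<in>Basis. frechet_derivative f (at x) b *\<^sub>R b)"

text \<open>\<open>Ck_on n f U\<close>: \<open>f\<close> is n times continuously differentiable on the open set \<open>U\<close>
  (all iterated directional derivatives up to order \<open>n\<close> exist and are continuous).\<close>

primrec Ck_on ::
  "nat \<Rightarrow> ('a::euclidean_space \<Rightarrow> 'b::real_normed_vector) \<Rightarrow> 'a set \<Rightarrow> bool" where
  "Ck_on 0 = (\<lambda>f U. continuous_on U f)"
| "Ck_on (Suc n) = (\<lambda>f U. f differentiable_on U \<and>
     (\<forall>v. Ck_on n (\<lambda>x. frechet_derivative f (at x) v) U))"

definition smooth_on :: "('a::euclidean_space \<Rightarrow> 'b::real_normed_vector) \<Rightarrow> 'a set \<Rightarrow> bool" where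
  "smooth_on f U \<longleftrightarrow> (\<forall>n. Ck_on n f U)"

text \<open>Functions on the whole space whose support is a compact subset of \<open>U\<close>.\<close>

definition Ck_c :: "nat \<Rightarrow> 'a::euclidean_space set \<Rightarrow> ('a \<Rightarrow> real) set" where
  "Ck_c n U = {\<phi>. Ck_on n \<phi> UNIV \<and> compact (closure {x. \<phi> x \<noteq> 0}) \<and> closure {x. \<phi> x \<noteq> 0} \<subseteq> U}"

definition Cinf_c :: "'a::euclidean_space set \<Rightarrow> ('a \<Rightarrow> real) set" where
  "Cinf_c U = (\<Inter>n. Ck_c n U)"


subsection \<open>Sobolev spaces\<close>

text \<open>Elements are functions rather than classes modulo null sets, and only their values on
  \<open>U\<close> matter.\<close>

definition is_weak_grad ::
  "'a::euclidean_space set \<Rightarrow> ('a \<Rightarrow> real) \<Rightarrow> ('a \<Rightarrow> 'a) \<Rightarrow> bool" where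
  "is_weak_grad U u g \<longleftrightarrow>
     (\<forall>C. compact C \<and> C \<subseteq> U \<longrightarrow> set_integrable lebesgue C u \<and> set_integrable lebesgue C g) \<and>
     (\<forall>\<phi>\<in>Cinf_c U. (LINT x:U|lebesgue. u x *\<^sub>R grad \<phi> x) = - (LINT x:U|lebesgue. \<phi> x *\<^sub>R g x))"

definition wgrad :: "'a::euclidean_space set \<Rightarrow> ('a \<Rightarrow> real) \<Rightarrow> 'a \<Rightarrow> 'a" where
  "wgrad U u = (SOME g. is_weak_grad U u g)"

definition Lp_on ::
  "real \<Rightarrow> 'a::euclidean_space set \<Rightarrow> ('a \<Rightarrow> 'b::{banach, second_countable_topology}) \<Rightarrow> bool" where
  "Lp_on p U f \<longleftrightarrow> set_borel_measurable lebesgue U f \<and>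
     set_integrable lebesgue U (\<lambda>x. norm (f x) powr p)"

definition W1p :: "real \<Rightarrow> 'a::euclidean_space set \<Rightarrow> ('a \<Rightarrow> real) set" where
  "W1p p U = {u. Lp_on p U u \<and> (\<exists>g. is_weak_grad U u g) \<and> Lp_on p U (wgrad U u)}"

definition W1p_norm :: "real \<Rightarrow> 'a::euclidean_space set \<Rightarrow> ('a \<Rightarrow> real) \<Rightarrow> real" where
  "W1p_norm p U u =
     ((LINT x:U|lebesgue. \<bar>u x\<bar> powr p) + (LINT x:U|lebesgue. norm (wgrad U u x) powr p)) powr (1 / p)"

text \<open>The closure of the smooth compactly supported functions in \<open>W1p p U\<close>.\<close>

definition W1p0 :: "real \<Rightarrow> 'a::euclidean_space set \<Rightarrow> ('a \<Rightarrow> real) set" where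
  "W1p0 p U = {u \<in> W1p p U. \<exists>\<phi>. (\<forall>n. \<phi> n \<in> Cinf_c U) \<and>
     (\<lambda>n. W1p_norm p U (\<lambda>x. u x - \<phi> n x)) \<longlonglongrightarrow> 0}"


subsection \<open>Surfaces\<close>

text \<open>A piecewise smooth surface of dimension \<open>m\<close> is a nonempty, locally finite union of
  smooth pieces \<open>\<phi> i ` P i\<close>. Each \<open>P i\<close> is an \<open>m\<close>-dimensional compact convex polytope,
  which, to avoid a separate type for \<open>\<real>\<^sup>m\<close>, sits in an \<open>m\<close>-dimensional affine
  subspace of the ambient space; \<open>\<phi> i\<close> is smooth up to the boundary of \<open>P i\<close> and regular
  (an injective immersion) in its relative interior. Different pieces meet only along the images
  of the boundaries, where edges, corners and conical points are allowed.\<close>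

definition piecewise_smooth_surface :: "nat \<Rightarrow> 'a::euclidean_space set \<Rightarrow> bool" where
  "piecewise_smooth_surface m K \<longleftrightarrow> K \<noteq> {} \<and>
     (\<exists>(I :: nat set) (P :: nat \<Rightarrow> 'a set) (\<phi> :: nat \<Rightarrow> 'a \<Rightarrow> 'a).
        K = (\<Union>i\<in>I. \<phi> i ` P i) \<and>
        (\<forall>x. \<exists>e>0. finite {i\<in>I. \<phi> i ` P i \<inter> ball x e \<noteq> {}}) \<and>
        (\<forall>i\<in>I. polytope (P i) \<and> aff_dim (P i) = int m \<and>
           (\<exists>U. open U \<and> P i \<subseteq> U \<and> smooth_on (\<phi> i) U) \<and>
           (\<forall>x\<in>rel_interior (P i).
              inj_on (frechet_derivative (\<phi> i) (at x)) (span ((\<lambda>y. y - x) ` P i)))) \<and>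
        (\<forall>i\<in>I. \<forall>j\<in>I. \<forall>x\<in>rel_interior (P i). \<forall>y\<in>P j.
           \<phi> i x = \<phi> j y \<longrightarrow> i = j \<and> x = y))"

text \<open>The admissible pairs of a domain \<open>\<Omega>\<close> and a surface \<open>K\<close> of codimension \<open>k\<close>: for
  \<open>k = 1\<close> the surface is the boundary of \<open>\<Omega>\<close>, for \<open>k\<close> equal to the dimension of the space
  it is a point.\<close>

definition hardy_surface :: "'a::euclidean_space set \<Rightarrow> nat \<Rightarrow> 'a set \<Rightarrow> bool" where
  "hardy_surface \<Omega> k K \<longleftrightarrow> 1 \<le> k \<and> k \<le> DIM('a) \<and>
     (if k = DIM('a) then \<exists>a. K = {a}
      else if k = 1 then K = frontier \<Omega> \<and> piecewise_smooth_surface (DIM('a) - 1) K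
      else piecewise_smooth_surface (DIM('a) - k) K \<and> closed K \<and> connected K)"


subsection \<open>The functional \<open>A\<close> and the logarithmic weight\<close>

text \<open>\<open>A\<close> is the distributional form of \<open>d \<Delta>d + 1 - k\<close>, using \<open>\<bar>\<nabla>d\<bar> = 1\<close> almost everywhere,
  where \<open>d\<close> is the distance to \<open>K\<close>.\<close>

definition A_fun :: "'a::euclidean_space set \<Rightarrow> nat \<Rightarrow> 'a set \<Rightarrow> ('a \<Rightarrow> real) \<Rightarrow> real" where
  "A_fun \<Omega> k K \<phi> =
     - (LINT x:\<Omega>|lebesgue. infdist x K * (grad (\<lambda>y. infdist y K) x \<bullet> grad \<phi> x))
     - real k * (LINT x:\<Omega>|lebesgue. \<phi> x)"

definition X :: "real \<Rightarrow> real" where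
  "X t = - 1 / ln t"

end

theory Submission
  imports Defs
begin

text \<open>The proof works for \<open>u\<close> smooth with compact support in \<open>U = \<Omega> - K\<close> and passes to the
  limit by Fatou's lemma; \<open>K\<close> is a null set. Put \<open>H = (k - p)/p\<close> and \<open>X = X(d/D)\<close>.

  Testing the superharmonicity of \<open>d\<close> with \<open>\<phi> = d\<^sup>-\<^sup>p (1 + H\<delta>X) |u|\<^sup>p\<close> and applying Young's
  inequality with the weight \<open>1 - \<epsilon>X\<^sup>2\<close> on the gradient gives, for small \<open>\<delta>\<close> and \<open>\<epsilon>\<close> and
  for all \<open>p > 1\<close> at once, the improved Hardy inequality whose remainder controls both
  \<open>\<integral> X\<^sup>2 |\<nabla>u|\<^sup>p\<close> and \<open>\<integral> X\<^sup>2 |u|\<^sup>p / d\<^sup>p\<close>. These two integrals bound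
  \<open>\<integral> |\<nabla>(X\<^sup>2\<^sup>/\<^sup>p u)|\<^sup>p\<close>, so Sobolev's inequality gives the critical exponent
  \<open>q = Np/(N - p)\<close>, and Hoelder's inequality interpolates for smaller \<open>q\<close>.

  The functions tested are only Lipschitz. They are differentiable almost everywhere because
  \<open>|x|\<^sup>2 - d\<^sup>2\<close> is convex, and the gradients of their mollifications converge at every point of
  differentiability, so dominated convergence transfers the \<open>C\<^sup>1\<close> statements to them.\<close>

text \<open>Put g = 1 + H delta X. Superharmonicity tested with the function above, multiplied by p
  - k = -p H and scaled by |H|^(p-2) / p, has the main term -|H|^p (p g + delta X^2) |u|^p / d^p.
  The X^2 stems from s X' = X^2 for X = X(s/D), and the factor H next to delta gives it the same
  sign for k < p and for k > p. Young's inequality costs (p - 1) g^(p/(p-1)) |H|^p |u|^p / d^p. This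
  coefficient and p g have the same linear term in X, so p g - (p - 1) g^(p/(p-1)) equals 1 up to
  O(delta^2 X^2), and the 1 is the Hardy term. For small delta the surplus delta X^2 beats that
  error and also pays for giving up epsilon X^2 of the gradient. One delta has to work for all
  values of X, so X must be bounded, which D > sup d provides. The part of the gradient saved in
  this way is what makes X^(2/p) u accessible to Sobolev's inequality: its gradient consists of
  X^(2/p) grad u and (2/p) X^(1+2/p) (u/d) grad d.\<close>

subsection \<open>The Gagliardo-Nirenberg-Sobolev inequality\<close>

text \<open>A root rather than a power, so that the products below have a fixed
  number of factors and no exponent \<open>0\<close> occurs.\<close>
definition eroot :: "nat \<Rightarrow> ennreal \<Rightarrow> ennreal" where
  "eroot m x = (if x = top then top else ennreal (root m (enn2real x)))"

lemma eroot_measurable [measurable]: "eroot m \<in> borel_measurable borel"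
proof -
  have [measurable]: "root m \<in> borel_measurable borel"
    by (intro borel_measurable_continuous_onI continuous_on_real_root continuous_intros)
  show ?thesis unfolding eroot_def by measurable
qed

lemma eroot_ennreal: "0 \<le> r \<Longrightarrow> eroot m (ennreal r) = ennreal (root m r)"
  by (simp add: eroot_def)

lemma eroot_mono:
  assumes "m > 0" "x \<le> y" shows "eroot m x \<le> eroot m y"
proof (cases "y = top")
  case True then show ?thesis by (simp add: eroot_def)
next
  case False
  with assms have "x \<noteq> top" by (auto simp: top_unique)
  then show ?thesis using assms False
    by (auto simp: eroot_def intro!: ennreal_leI enn2real_mono simp: less_top)
qed

lemma eroot_0 [simp]: "eroot m 0 = 0" by (simp add: eroot_def)

lemma eroot_eq_0:
  assumes "m > 0" shows "eroot m x = 0 \<longleftrightarrow> x = 0"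
proof (cases x)
  case (real r)
  then show ?thesis using assms by (auto simp: eroot_ennreal)
next
  case top then show ?thesis by (simp add: eroot_def)
qed

text \<open>Weighted arithmetic-geometric mean for the normalised factors \<open>h i / A i\<close>.
  With \<open>A i\<close> the integral of \<open>h i\<close>, the sum on the right integrates to 1,
  which yields Hoelder's inequality for m equal exponents without an induction on m.\<close>

lemma prod_root_le:
  fixes h A :: "'i \<Rightarrow> real"
  assumes I: "finite I" "card I = m" "m > 0" and h: "\<And>i. i \<in> I \<Longrightarrow> 0 \<le> h i"
    and A: "\<And>i. i \<in> I \<Longrightarrow> 0 < A i"
  shows "(\<Prod>i\<in>I. root m (h i)) \<le> (\<Prod>i\<in>I. root m (A i)) * (\<Sum>i\<in>I. h i / A i / m)"
proof -
  have "(\<Prod>i\<in>I. root m (h i)) = (\<Prod>i\<in>I. root m (A i) * root m (h i / A i))"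
  proof (rule prod.cong)
    fix i assume "i \<in> I"
    then show "root m (h i) = root m (A i) * root m (h i / A i)"
      using A[of i] by (simp add: real_root_mult[symmetric])
  qed simp
  also have "\<dots> = (\<Prod>i\<in>I. root m (A i)) * (\<Prod>i\<in>I. root m (h i / A i))"
    by (simp add: prod.distrib)
  also have "(\<Prod>i\<in>I. root m (h i / A i)) = root m (\<Prod>i\<in>I. h i / A i)"
    using I(1) by (induction I rule: finite_induct) (auto simp: real_root_mult[symmetric] I(3))
  also have "\<dots> = (\<Prod>i\<in>I. h i / A i) powr (1 / m)"
    using I h A by (intro root_powr_inverse) (auto intro!: prod_nonneg divide_nonneg_pos)
  also have "\<dots> \<le> (\<Sum>i\<in>I. h i / A i / m)"
    using arith_geom_mean[of I "\<lambda>i. h i / A i"] I(2,3) divide_nonneg_pos[OF h A]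
    by (auto simp: card_gt_0_iff)
  finally show ?thesis
    using A I by (simp add: mult_left_mono prod_nonneg less_imp_le)
qed

lemma nn_integral_prod_eroot_le:
  fixes h :: "'i \<Rightarrow> 'b \<Rightarrow> ennreal"
  assumes I: "finite I" "card I = m" "m > 0"
    and [measurable]: "\<And>i. i \<in> I \<Longrightarrow> h i \<in> borel_measurable M"
  shows "(\<integral>\<^sup>+x. (\<Prod>i\<in>I. eroot m (h i x)) \<partial>M) \<le> (\<Prod>i\<in>I. eroot m (\<integral>\<^sup>+x. h i x \<partial>M))"
proof -
  define A where "A i = (\<integral>\<^sup>+x. h i x \<partial>M)" for i
  \<comment> \<open>Normalising needs integrals strictly between 0 and \<open>top\<close>. The
    vanishing case comes first because it also settles products of 0 and \<open>top\<close>; once no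
    integral vanishes, an infinite one makes the right side infinite.\<close>
  consider (z) i where "i \<in> I" "A i = 0" | (t) "\<And>i. i \<in> I \<Longrightarrow> A i \<noteq> 0" "\<exists>i\<in>I. A i = top"
    | (f) "\<And>i. i \<in> I \<Longrightarrow> A i \<noteq> 0" "\<And>i. i \<in> I \<Longrightarrow> A i \<noteq> top" by blast
  then show ?thesis
  proof cases
    case z
    have "AE x in M. h i x = 0" using z by (simp add: A_def nn_integral_0_iff_AE)
    then have "AE x in M. (\<Prod>i\<in>I. eroot m (h i x)) = 0"
      by eventually_elim (use z I in \<open>auto intro!: prod_zero bexI[of _ i]\<close>)
    then have "(\<integral>\<^sup>+x. (\<Prod>i\<in>I. eroot m (h i x)) \<partial>M) = 0"
      by (subst nn_integral_0_iff_AE) auto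
    then show ?thesis by simp
  next
    case t
    then obtain j where j: "j \<in> I" "A j = top" by blast
    have "(\<Prod>i\<in>I. eroot m (A i)) = eroot m (A j) * (\<Prod>i\<in>I - {j}. eroot m (A i))"
      using I j by (subst prod.remove[of _ j]) auto
    moreover have "(\<Prod>i\<in>I - {j}. eroot m (A i)) \<noteq> 0"
      using t I by (auto simp: eroot_eq_0)
    ultimately have "(\<Prod>i\<in>I. eroot m (A i)) = top"
      using j by (simp add: eroot_def ennreal_top_mult)
    then show ?thesis by (simp add: A_def)
  next
    case f
    define a where "a i = enn2real (A i)" for i
    have a: "0 < a i" "A i = ennreal (a i)" if "i \<in> I" for i
      using f[OF that] by (auto simp: a_def enn2real_positive_iff less_top zero_less_iff_neq_zero)
    have fin: "AE x in M. \<forall>i\<in>I. h i x \<noteq> top"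
    proof (subst AE_finite_all[OF I(1)], intro ballI)
      fix i assume "i \<in> I"
      then show "AE x in M. h i x \<noteq> top"
        using f(2)[of i] nn_integral_PInf_AE[of "h i" M] by (auto simp: A_def)
    qed
    define P where "P = (\<Prod>i\<in>I. root m (a i))"
    have P: "0 \<le> P" using a I by (auto simp: P_def less_imp_le intro!: prod_nonneg)
    have "AE x in M. (\<Prod>i\<in>I. eroot m (h i x)) \<le> ennreal P * (\<Sum>i\<in>I. ennreal (1 / (a i * m)) * h i x)"
      using fin
    proof eventually_elim
      fix x assume fx: "\<forall>i\<in>I. h i x \<noteq> top"
      define r where "r i = enn2real (h i x)" for i
      have hr: "h i x = ennreal (r i)" if "i \<in> I" for i using fx that by (simp add: r_def less_top)
      have r0: "0 \<le> r i" for i by (simp add: r_def)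
      have "(\<Prod>i\<in>I. eroot m (h i x)) = (\<Prod>i\<in>I. ennreal (root m (r i)))"
        by (intro prod.cong) (auto simp: hr eroot_ennreal r0)
      also have "\<dots> = ennreal (\<Prod>i\<in>I. root m (r i))"
        by (simp add: prod_ennreal r0 I(3))
      also have "\<dots> \<le> ennreal (P * (\<Sum>i\<in>I. r i / a i / m))"
        unfolding P_def by (intro ennreal_leI prod_root_le I r0 a)
      also have "\<dots> = ennreal P * (\<Sum>i\<in>I. ennreal (r i / a i / m))"
        using P a r0 by (subst ennreal_mult'') (auto simp: sum_ennreal less_imp_le intro!: sum_nonneg)
      also have "(\<Sum>i\<in>I. ennreal (r i / a i / m)) = (\<Sum>i\<in>I. ennreal (1 / (a i * m)) * h i x)"
        by (intro sum.cong) (auto simp: hr ennreal_mult[symmetric] r0 a less_imp_le)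
      finally show "(\<Prod>i\<in>I. eroot m (h i x)) \<le> ennreal P * (\<Sum>i\<in>I. ennreal (1 / (a i * m)) * h i x)" .
    qed
    then have "(\<integral>\<^sup>+x. (\<Prod>i\<in>I. eroot m (h i x)) \<partial>M)
      \<le> (\<integral>\<^sup>+x. ennreal P * (\<Sum>i\<in>I. ennreal (1 / (a i * m)) * h i x) \<partial>M)"
      by (rule nn_integral_mono_AE)
    also have "\<dots> = ennreal P * (\<Sum>i\<in>I. ennreal (1 / (a i * m)) * A i)"
      by (simp add: nn_integral_cmult nn_integral_sum A_def)
    also have "(\<Sum>i\<in>I. ennreal (1 / (a i * m)) * A i) = (\<Sum>i\<in>I. ennreal (1 / m))"
      by (intro sum.cong) (use a in \<open>auto simp: ennreal_mult[symmetric] less_imp_le\<close>, metis less_irrefl)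
    also have "\<dots> = ennreal 1"
      using I by (simp add: ennreal_of_nat_eq_real_of_nat ennreal_mult[symmetric])
    also have "ennreal P * ennreal 1 = (\<Prod>i\<in>I. eroot m (A i))"
      using a I by (simp add: P_def prod_ennreal[symmetric] less_imp_le eroot_ennreal)
    finally show ?thesis by (simp add: A_def)
  qed
qed

text \<open>The result is again a function on the whole space, constant in direction
  \<open>b\<close>, so that integrations over several coordinates can be iterated with
  \<open>foldr\<close> without changing the type.\<close>

definition line_int :: "'a::euclidean_space \<Rightarrow> ('a \<Rightarrow> ennreal) \<Rightarrow> 'a \<Rightarrow> ennreal" where
  "line_int b F x = (\<integral>\<^sup>+t. F (x + t *\<^sub>R b) \<partial>lborel)"

lemma line_int_measurable [measurable]:
  assumes [measurable]: "F \<in> borel_measurable borel"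
  shows "line_int b F \<in> borel_measurable borel"
  unfolding line_int_def by measurable

lemma line_int_mono: "(\<And>x. F x \<le> G x) \<Longrightarrow> line_int b F x \<le> line_int b G x"
  unfolding line_int_def by (intro nn_integral_mono)

lemma nn_integral_lborel_translate_real:
  fixes c :: real
  assumes [measurable]: "f \<in> borel_measurable borel"
  shows "(\<integral>\<^sup>+t. f (c + t) \<partial>lborel) = (\<integral>\<^sup>+t. f t \<partial>lborel)"
  by (subst (2) lborel_distr_plus[of c, symmetric]) (simp add: nn_integral_distr)

lemma line_int_shift:
  assumes [measurable]: "F \<in> borel_measurable borel"
  shows "line_int b F (x + s *\<^sub>R b) = line_int b F x"
  using nn_integral_lborel_translate_real[of "\<lambda>t. F (x + t *\<^sub>R b)" s]
  by (simp add: line_int_def algebra_simps)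

lemma line_int_commute:
  assumes [measurable]: "F \<in> borel_measurable borel"
  shows "line_int b (line_int c F) x = line_int c (line_int b F) x"
proof -
  have "line_int b (line_int c F) x = (\<integral>\<^sup>+t. \<integral>\<^sup>+s. F (x + t *\<^sub>R b + s *\<^sub>R c) \<partial>lborel \<partial>lborel)"
    by (simp add: line_int_def)
  also have "\<dots> = (\<integral>\<^sup>+s. \<integral>\<^sup>+t. F (x + t *\<^sub>R b + s *\<^sub>R c) \<partial>lborel \<partial>lborel)"
    by (rule lborel_pair.Fubini') simp
  also have "\<dots> = line_int c (line_int b F) x"
    by (simp add: line_int_def algebra_simps)
  finally show ?thesis .
qed

lemma foldr_line_int_measurable [measurable]:
  "F \<in> borel_measurable borel \<Longrightarrow> foldr line_int xs F \<in> borel_measurable borel"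
  by (induction xs) auto

text \<open>Integrating along one coordinate at a time: the factor of the new coordinate \<open>j\<close> is constant
  along \<open>j\<close>, the other \<open>m\<close> factors are handled by Hoelder's inequality.\<close>
lemma gagliardo_step:
  fixes F W :: "'a::euclidean_space \<Rightarrow> ennreal"
  assumes dim: "DIM('a) = Suc m" "m > 0"
    and [measurable]: "F \<in> borel_measurable borel" "W \<in> borel_measurable borel"
    and W: "\<And>x. W x \<le> (\<Prod>b\<in>Basis. eroot m (line_int b F x))"
    and xs: "distinct xs" "set xs \<subseteq> Basis"
  shows "foldr line_int xs W x \<le>
    (\<Prod>b\<in>Basis. eroot m (if b \<in> set xs then foldr line_int xs F x else line_int b (foldr line_int xs F) x))"
  using xs
proof (induction xs arbitrary: x)
  case Nil
  then show ?case using W by simp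
next
  case (Cons j xs)
  \<comment> \<open>A coordinate already integrated must not be integrated again: the function is
    constant along it, and a second integral would be infinite wherever the function is
    nonzero.\<close>
  define G where "G b = (if b \<in> set xs then foldr line_int xs F else line_int b (foldr line_int xs F))" for b
  have [measurable]: "G b \<in> borel_measurable borel" for b unfolding G_def by auto
  have j: "j \<in> Basis" "j \<notin> set xs" using Cons.prems by auto
  have IH: "foldr line_int xs W y \<le> (\<Prod>b\<in>Basis. eroot m (G b y))" for y
    using Cons.IH[of y] Cons.prems by (simp add: G_def if_distrib[of "\<lambda>f. f y"])
  have Gj: "G j (x + t *\<^sub>R j) = G j x" for t
    using j by (simp add: G_def line_int_shift)
  have "foldr line_int (j # xs) W x \<le> line_int j (\<lambda>y. \<Prod>b\<in>Basis. eroot m (G b y)) x"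
    using IH by (auto intro!: line_int_mono)
  also have "\<dots> = (\<integral>\<^sup>+t. eroot m (G j x) * (\<Prod>b\<in>Basis - {j}. eroot m (G b (x + t *\<^sub>R j))) \<partial>lborel)"
    unfolding line_int_def by (subst prod.remove[of _ j]) (auto simp: j Gj)
  also have "\<dots> = eroot m (G j x) * (\<integral>\<^sup>+t. (\<Prod>b\<in>Basis - {j}. eroot m (G b (x + t *\<^sub>R j))) \<partial>lborel)"
    by (rule nn_integral_cmult) measurable
  also have "\<dots> \<le> eroot m (G j x) * (\<Prod>b\<in>Basis - {j}. eroot m (\<integral>\<^sup>+t. G b (x + t *\<^sub>R j) \<partial>lborel))"
    using dim j by (intro mult_left_mono nn_integral_prod_eroot_le) auto
  also have "\<dots> = (\<Prod>b\<in>Basis. eroot m (if b \<in> set (j # xs) then foldr line_int (j # xs) F x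
      else line_int b (foldr line_int (j # xs) F) x))"
  proof (subst (2) prod.remove[of _ j], goal_cases)
    case 3
    have "(\<integral>\<^sup>+t. G b (x + t *\<^sub>R j) \<partial>lborel) = (if b \<in> set (j # xs) then foldr line_int (j # xs) F x
      else line_int b (foldr line_int (j # xs) F) x)" if "b \<noteq> j" for b
      using that line_int_commute[of "foldr line_int xs F" b j x] by (auto simp: G_def line_int_def)
    then show ?case using j by (auto simp: G_def intro!: arg_cong2[where f="(*)"] prod.cong)
  qed (auto simp: j)
  finally show ?case .
qed

text \<open>Needed to recognise iterated line integrals as an integral over the space, since
  \<open>lborel\<close> is the image of the product measure over \<open>Basis\<close>.\<close>

lemma foldr_line_int_PiM:
  assumes [measurable]: "F \<in> borel_measurable (borel::'a::euclidean_space measure)"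
    and xs: "distinct xs" "set xs \<subseteq> Basis"
  shows "foldr line_int xs F x = (\<integral>\<^sup>+f. F (x + (\<Sum>b\<in>set xs. f b *\<^sub>R b)) \<partial>Pi\<^sub>M (set xs) (\<lambda>_. lborel))"
  using xs
proof (induction xs arbitrary: x)
  case Nil
  interpret product_sigma_finite "\<lambda>_::'a. lborel :: real measure" ..
  show ?case by (simp add: PiM_empty)
next
  interpret product_sigma_finite "\<lambda>_::'a. lborel :: real measure" ..
  case (Cons j xs)
  have "foldr line_int (j # xs) F x = (\<integral>\<^sup>+t. \<integral>\<^sup>+f. F (x + t *\<^sub>R j + (\<Sum>b\<in>set xs. f b *\<^sub>R b)) \<partial>Pi\<^sub>M (set xs) (\<lambda>_. lborel) \<partial>lborel)"
    using Cons by (simp add: line_int_def[of j])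
  also have "\<dots> = (\<integral>\<^sup>+t. \<integral>\<^sup>+f. F (x + (\<Sum>b\<in>insert j (set xs). (f(j := t)) b *\<^sub>R b)) \<partial>Pi\<^sub>M (set xs) (\<lambda>_. lborel) \<partial>lborel)"
  proof (intro nn_integral_cong)
    fix t f
    have "(\<Sum>b\<in>insert j (set xs). (f(j := t)) b *\<^sub>R b) = t *\<^sub>R j + (\<Sum>b\<in>set xs. f b *\<^sub>R b)"
      using Cons.prems by (subst sum.insert) (auto intro!: sum.cong)
    then show "F (x + t *\<^sub>R j + (\<Sum>b\<in>set xs. f b *\<^sub>R b)) = F (x + (\<Sum>b\<in>insert j (set xs). (f(j := t)) b *\<^sub>R b))"
      by (simp add: add.assoc)
  qed
  also have "\<dots> = (\<integral>\<^sup>+f. F (x + (\<Sum>b\<in>insert j (set xs). f b *\<^sub>R b)) \<partial>Pi\<^sub>M (insert j (set xs)) (\<lambda>_. lborel))"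
    using Cons.prems by (subst product_nn_integral_insert_rev) auto
  finally show ?case by simp
qed

lemma foldr_line_int_Basis:
  assumes [measurable]: "F \<in> borel_measurable (borel::'a::euclidean_space measure)"
    and xs: "distinct xs" "set xs = Basis"
  shows "foldr line_int xs F x = (\<integral>\<^sup>+y. F y \<partial>lborel)"
proof -
  have "foldr line_int xs F x = (\<integral>\<^sup>+f. F (x + (\<Sum>b\<in>Basis. f b *\<^sub>R b)) \<partial>Pi\<^sub>M Basis (\<lambda>_. lborel))"
    using foldr_line_int_PiM[OF assms(1) xs(1), of x] xs by simp
  also have "\<dots> = (\<integral>\<^sup>+y. F (x + y) \<partial>lborel)"
    by (subst lborel_eq) (simp add: nn_integral_distr)
  also have "\<dots> = (\<integral>\<^sup>+y. F y \<partial>lborel)"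
    by (subst (2) lborel_distr_plus[of x, symmetric]) (simp add: nn_integral_distr)
  finally show ?thesis .
qed

text \<open>Once every coordinate is integrated, all factors in \<open>gagliardo_step\<close> are
  the m-th root of the same total integral, one for each element of \<open>Basis\<close>.\<close>

lemma gagliardo:
  fixes F W :: "'a::euclidean_space \<Rightarrow> ennreal"
  assumes dim: "DIM('a) = Suc m" "m > 0"
    and [measurable]: "F \<in> borel_measurable borel" "W \<in> borel_measurable borel"
    and W: "\<And>x. W x \<le> (\<Prod>b\<in>Basis. eroot m (line_int b F x))"
  shows "(\<integral>\<^sup>+y. W y \<partial>lborel) \<le> eroot m (\<integral>\<^sup>+y. F y \<partial>lborel) ^ DIM('a)"
proof -
  obtain xs where xs: "distinct xs" "set xs = (Basis :: 'a set)"
    using finite_distinct_list[of "Basis :: 'a set"] by auto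
  have "foldr line_int xs W 0 \<le> (\<Prod>b\<in>(Basis::'a set). eroot m (foldr line_int xs F 0))"
    using gagliardo_step[OF dim _ _ W xs(1), of 0] xs by simp
  then show ?thesis using xs by (simp add: foldr_line_int_Basis)
qed

text \<open>The fundamental theorem of calculus along the line in direction \<open>b\<close>,
  started at a point outside the support of \<open>w\<close>.\<close>

lemma abs_le_line_int:
  fixes w :: "'a::euclidean_space \<Rightarrow> real"
  assumes w: "\<And>x. (w has_derivative w' x) (at x)"
    and cont: "\<And>v. continuous_on UNIV (\<lambda>x. w' x v)"
    and bdd: "bounded {x. w x \<noteq> 0}" and b: "b \<in> Basis"
  shows "ennreal \<bar>w x\<bar> \<le> line_int b (\<lambda>x. ennreal \<bar>w' x b\<bar>) x"
proof -
  obtain B where B: "\<And>x. w x \<noteq> 0 \<Longrightarrow> norm x \<le> B" using bdd by (auto simp: bounded_iff)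
  \<comment> \<open>Going back by \<open>R\<close> from \<open>x\<close> leaves a norm of at least
    \<open>R - norm x\<close>, which exceeds \<open>B\<close>.\<close>
  define R where "R = \<bar>B\<bar> + norm x + 1"
  have "w (x + (-R) *\<^sub>R b) = 0"
  proof (rule ccontr)
    assume "w (x + (-R) *\<^sub>R b) \<noteq> 0"
    then have "norm (x + (-R) *\<^sub>R b) \<le> B" by (rule B)
    moreover have "R = norm (R *\<^sub>R b)" using b by (simp add: R_def add_nonneg_pos)
    moreover have "\<dots> \<le> norm (x + (-R) *\<^sub>R b) + norm x"
      using norm_triangle_ineq4[of x "x + (-R) *\<^sub>R b"] by simp
    ultimately show False unfolding R_def by linarith
  qed
  moreover have "integral\<^sup>L lborel (\<lambda>t. indicator {-R..0} t *\<^sub>R w' (x + t *\<^sub>R b) b)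
      = w (x + 0 *\<^sub>R b) - w (x + (-R) *\<^sub>R b)"
    and int: "integrable lborel (\<lambda>t. indicator {-R..0} t *\<^sub>R w' (x + t *\<^sub>R b) b)"
  proof -
    have 1: "((\<lambda>t. w (x + t *\<^sub>R b)) has_vector_derivative w' (x + t *\<^sub>R b) b) (at t within {-R..0})" for t
    proof -
      have "((\<lambda>t. x + t *\<^sub>R b) has_derivative (\<lambda>t. t *\<^sub>R b)) (at t within {-R..0})"
        by (auto intro!: derivative_eq_intros)
      from diff_chain_within[OF this has_derivative_at_withinI[OF w[of "x + t *\<^sub>R b"]]]
      have "((\<lambda>t. w (x + t *\<^sub>R b)) has_derivative (\<lambda>s. w' (x + t *\<^sub>R b) (s *\<^sub>R b))) (at t within {-R..0})"
        by (simp add: o_def)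
      moreover have "linear (w' (x + t *\<^sub>R b))" using w has_derivative_linear by blast
      ultimately show ?thesis by (simp add: has_vector_derivative_def linear_cmul)
    qed
    have 2: "continuous_on {-R..0} (\<lambda>t. w' (x + t *\<^sub>R b) b)"
      by (rule continuous_on_compose2[OF cont]) (auto intro!: continuous_intros)
    have 3: "-R \<le> 0" unfolding R_def using norm_ge_zero[of x] by linarith
    show "integral\<^sup>L lborel (\<lambda>t. indicator {-R..0} t *\<^sub>R w' (x + t *\<^sub>R b) b)
      = w (x + 0 *\<^sub>R b) - w (x + (-R) *\<^sub>R b)"
      by (rule integral_FTC_Icc[OF 3 1 2])
    show "integrable lborel (\<lambda>t. indicator {-R..0} t *\<^sub>R w' (x + t *\<^sub>R b) b)"
      by (rule borel_integrable_compact[OF _ 2]) simp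
  qed
  ultimately have "ennreal \<bar>w x\<bar> = ennreal (norm (integral\<^sup>L lborel (\<lambda>t. indicator {-R..0} t *\<^sub>R w' (x + t *\<^sub>R b) b)))"
    by simp
  also have "\<dots> \<le> (\<integral>\<^sup>+t. ennreal (norm (indicator {-R..0} t *\<^sub>R w' (x + t *\<^sub>R b) b)) \<partial>lborel)"
    by (rule integral_norm_bound_ennreal[OF int])
  also have "\<dots> \<le> line_int b (\<lambda>x. ennreal \<bar>w' x b\<bar>) x"
    unfolding line_int_def by (intro nn_integral_mono ennreal_leI) (auto simp: indicator_def)
  finally show ?thesis .
qed

text \<open>Stated with weights 1 - theta and theta on nonnegative functions rather than with
  conjugate exponents, because it is used both with theta = 1/p in Sobolev's inequality and with the
  interpolation parameter for the exponent q.\<close>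

lemma Holder_integral:
  fixes f g :: "'b \<Rightarrow> real"
  assumes f: "integrable M f" "\<And>x. 0 \<le> f x" and g: "integrable M g" "\<And>x. 0 \<le> g x"
    and \<theta>: "0 < \<theta>" "\<theta> < 1"
  shows "integrable M (\<lambda>x. f x powr (1 - \<theta>) * g x powr \<theta>)"
    and "(\<integral>x. f x powr (1 - \<theta>) * g x powr \<theta> \<partial>M) \<le> (\<integral>x. f x \<partial>M) powr (1 - \<theta>) * (\<integral>x. g x \<partial>M) powr \<theta>"
proof -
  have [measurable]: "f \<in> borel_measurable M" "g \<in> borel_measurable M" using f g by auto
  have young: "a powr (1 - \<theta>) * b powr \<theta> \<le> (1 - \<theta>) * a + \<theta> * b" if "0 \<le> a" "0 \<le> b" for a b :: real
    using Youngs_inequality_0[of "1 - \<theta>" \<theta> a b] that \<theta> by (cases "a = 0 \<or> b = 0") auto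
  show int: "integrable M (\<lambda>x. f x powr (1 - \<theta>) * g x powr \<theta>)"
    by (rule Bochner_Integration.integrable_bound[of _ "\<lambda>x. (1 - \<theta>) * f x + \<theta> * g x"])
      (use f g \<theta> young in \<open>auto simp: abs_mult intro!: order_trans[OF young]\<close>)
  define F G where "F = (\<integral>x. f x \<partial>M)" and "G = (\<integral>x. g x \<partial>M)"
  have FG: "0 \<le> F" "0 \<le> G" using f g by (auto simp: F_def G_def)
  show "(\<integral>x. f x powr (1 - \<theta>) * g x powr \<theta> \<partial>M) \<le> F powr (1 - \<theta>) * G powr \<theta>"
  proof (cases "F = 0 \<or> G = 0")
    case True
    then have "(AE x in M. f x = 0) \<or> (AE x in M. g x = 0)"
      using f g by (auto simp: F_def G_def integral_nonneg_eq_0_iff_AE)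
    then have "AE x in M. f x powr (1 - \<theta>) * g x powr \<theta> = 0" by auto
    then have "(\<integral>x. f x powr (1 - \<theta>) * g x powr \<theta> \<partial>M) = 0" by (rule integral_eq_zero_AE)
    then show ?thesis by simp
  next
    case False
    then have pos: "F > 0" "G > 0" using FG by auto
    have "(\<integral>x. f x powr (1 - \<theta>) * g x powr \<theta> \<partial>M)
      \<le> (\<integral>x. F powr (1 - \<theta>) * G powr \<theta> * ((1 - \<theta>) * (f x / F) + \<theta> * (g x / G)) \<partial>M)"
    proof (rule integral_mono[OF int])
      show "integrable M (\<lambda>x. F powr (1 - \<theta>) * G powr \<theta> * ((1 - \<theta>) * (f x / F) + \<theta> * (g x / G)))"
        using f g by auto
      fix x
      have "f x powr (1 - \<theta>) * g x powr \<theta>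
        = F powr (1 - \<theta>) * G powr \<theta> * ((f x / F) powr (1 - \<theta>) * (g x / G) powr \<theta>)"
        using pos f g by (simp add: powr_divide)
      also have "\<dots> \<le> F powr (1 - \<theta>) * G powr \<theta> * ((1 - \<theta>) * (f x / F) + \<theta> * (g x / G))"
        using pos f g by (intro mult_left_mono young) auto
      finally show "f x powr (1 - \<theta>) * g x powr \<theta> \<le> F powr (1 - \<theta>) * G powr \<theta> * ((1 - \<theta>) * (f x / F) + \<theta> * (g x / G))" .
    qed
    also have "\<dots> = F powr (1 - \<theta>) * G powr \<theta> * ((1 - \<theta>) * (F / F) + \<theta> * (G / G))"
      using f g by (simp add: F_def G_def)
    also have "\<dots> = F powr (1 - \<theta>) * G powr \<theta>" using pos by simp
    finally show ?thesis .
  qed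
qed

lemma has_real_derivative_abs_powr:
  fixes s \<gamma> :: real
  assumes "\<gamma> > 1"
  shows "((\<lambda>s. \<bar>s\<bar> powr \<gamma>) has_real_derivative \<gamma> * (\<bar>s\<bar> powr (\<gamma> - 1) * sgn s)) (at s)"
proof -
  consider "s > 0" | "s < 0" | "s = 0" by linarith
  then show ?thesis
  proof cases
    case 1
    have "((\<lambda>s. s powr \<gamma>) has_real_derivative \<gamma> * (\<bar>s\<bar> powr (\<gamma> - 1) * sgn s)) (at s)"
      using 1 by (auto intro!: derivative_eq_intros)
    then show ?thesis
      by (rule has_field_derivative_transform_within_open[of _ _ _ "{0<..}"]) (use 1 in auto)
  next
    case 2
    have "((\<lambda>s. (-s) powr \<gamma>) has_real_derivative \<gamma> * (\<bar>s\<bar> powr (\<gamma> - 1) * sgn s)) (at s)"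
      using 2 by (auto intro!: derivative_eq_intros)
    then show ?thesis
      by (rule has_field_derivative_transform_within_open[of _ _ _ "{..<0}"]) (use 2 in auto)
  next
    case 3
    have "((\<lambda>h::real. \<bar>h\<bar> powr (\<gamma> - 1)) \<longlongrightarrow> \<bar>0\<bar> powr (\<gamma> - 1)) (at 0)"
      by (rule tendsto_powr') (use assms in \<open>auto intro!: tendsto_const tendsto_rabs_zero\<close>)
    then have *: "((\<lambda>h::real. \<bar>h\<bar> powr (\<gamma> - 1)) \<longlongrightarrow> 0) (at 0)" using assms by simp
    have "((\<lambda>h::real. \<bar>h\<bar> powr \<gamma> / h) \<longlongrightarrow> 0) (at 0)"
    proof (rule Lim_null_comparison[OF _ *], rule always_eventually, safe)
      fix h :: real
      have "\<bar>h\<bar> powr \<gamma> = \<bar>h\<bar> powr (\<gamma> - 1) * \<bar>h\<bar>"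
        by (cases "h = 0") (auto simp: powr_diff)
      then show "norm (\<bar>h\<bar> powr \<gamma> / h) \<le> \<bar>h\<bar> powr (\<gamma> - 1)" by (simp add: abs_mult)
    qed
    then show ?thesis using 3 by (simp add: DERIV_def)
  qed
qed

lemma continuous_on_abs_powr_sgn:
  fixes a :: real
  assumes "a > 0"
  shows "continuous_on UNIV (\<lambda>s. \<bar>s\<bar> powr a * sgn s)"
proof -
  have "isCont (\<lambda>s. \<bar>s\<bar> powr a * sgn s) s" for s :: real
  proof (cases "s = 0")
    case True
    have "((\<lambda>h::real. \<bar>h\<bar> powr a) \<longlongrightarrow> \<bar>0\<bar> powr a) (at 0)"
      by (rule tendsto_powr') (use assms in \<open>auto intro!: tendsto_const tendsto_rabs_zero\<close>)
    then have *: "((\<lambda>h::real. \<bar>h\<bar> powr a) \<longlongrightarrow> 0) (at 0)" using assms by simp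
    have "((\<lambda>h::real. \<bar>h\<bar> powr a * sgn h) \<longlongrightarrow> 0) (at 0)"
      by (rule Lim_null_comparison[OF _ *]) (auto simp: abs_mult sgn_if)
    then show ?thesis using True by (simp add: isCont_def)
  next
    case False
    then show ?thesis by (intro continuous_intros) auto
  qed
  then show ?thesis by (simp add: continuous_at_imp_continuous_on)
qed

section \<open>Continuously differentiable functions with bounded support\<close>

lemma integrable_cont_bounded_support:
  fixes f :: "'a::euclidean_space \<Rightarrow> 'b::{banach, second_countable_topology}"
  assumes "continuous_on UNIV f" "bounded {x. f x \<noteq> 0}"
  shows "integrable lborel f"
proof -
  have c: "compact (closure {x. f x \<noteq> 0})" using assms by (simp add: compact_closure)
  have "integrable lborel (\<lambda>x. indicator (closure {x. f x \<noteq> 0}) x *\<^sub>R f x)"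
    using assms by (intro borel_integrable_compact[OF c]) (auto intro: continuous_on_subset)
  also have "(\<lambda>x. indicator (closure {x. f x \<noteq> 0}) x *\<^sub>R f x) = f"
    using closure_subset[of "{x. f x \<noteq> 0}"] by (auto simp: indicator_def fun_eq_iff)
  finally show ?thesis .
qed

lemma deriv_0_outside_support:
  fixes v :: "'a::euclidean_space \<Rightarrow> real"
  assumes "(v has_derivative (\<lambda>h. g \<bullet> h)) (at x)" "x \<notin> closure {x. v x \<noteq> 0}"
  shows "g = 0"
proof -
  have "(v has_derivative (\<lambda>v. 0)) (at x)"
    by (rule has_derivative_transform_within_open[of "\<lambda>_. 0" _ _ _ "- closure {x. v x \<noteq> 0}"])
      (use assms closure_subset[of "{x. v x \<noteq> 0}"] in auto)
  then have "(\<lambda>v. g \<bullet> v) = (\<lambda>v. 0)" using assms(1) has_derivative_unique by blast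
  then show ?thesis by (metis inner_eq_zero_iff)
qed

lemma lborel_integral_shift:
  fixes f :: "'a::euclidean_space \<Rightarrow> 'b::{banach, second_countable_topology}"
  assumes [measurable]: "f \<in> borel_measurable borel"
  shows "(\<integral>x. f (x + w) \<partial>lborel) = (\<integral>x. f x \<partial>lborel)"
  by (subst (2) lborel_distr_plus[of w, symmetric]) (simp add: integral_distr add.commute)

text \<open>The gradient is a parameter instead of \<open>grad f\<close>, so that products and
  powers can be inserted together with their computed gradients.\<close>

locale C1_bounded_support =
  fixes f :: "'a::euclidean_space \<Rightarrow> real" and g :: "'a \<Rightarrow> 'a" and R :: real
  assumes deriv: "\<And>x. (f has_derivative (\<lambda>v. g x \<bullet> v)) (at x)"
    and cont_g: "continuous_on UNIV g"
    and supp: "\<And>x. f x \<noteq> 0 \<Longrightarrow> norm x \<le> R"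
begin

lemma cont_f: "continuous_on UNIV f"
  using deriv by (meson continuous_at_imp_continuous_on has_derivative_continuous)

lemma supp_g: "g x \<noteq> 0 \<Longrightarrow> norm x \<le> R"
proof (rule ccontr)
  assume g: "g x \<noteq> 0" and x: "\<not> norm x \<le> R"
  have "closure {x. f x \<noteq> 0} \<subseteq> cball 0 R"
    by (rule closure_minimal) (use supp in auto)
  then have "x \<notin> closure {x. f x \<noteq> 0}" using x by auto
  then show False using deriv_0_outside_support[OF deriv] g by blast
qed

lemma bounded_supp: "bounded {x. f x \<noteq> 0}" "bounded {x. g x \<noteq> 0}"
  using supp supp_g by (auto simp: bounded_iff intro!: exI[of _ R])

lemma integrable_f: "integrable lborel f" and integrable_g: "integrable lborel g"
  by (auto intro!: integrable_cont_bounded_support cont_f cont_g bounded_supp)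

text \<open>The Taylor error is uniform because \<open>g\<close> is uniformly continuous on a ball,
  and the indicator makes it integrable. Increments of length at most 1 keep the segment from a
  point of the ball of radius \<open>\<bar>R\<bar> + 1\<close> inside the ball of radius
  \<open>\<bar>R\<bar> + 2\<close>; beyond the smaller ball all terms vanish.\<close>

lemma uniform_deriv:
  assumes "e > 0"
  obtains \<delta> where "\<delta> > 0" "\<delta> \<le> 1"
    "\<And>y w. norm w \<le> \<delta> \<Longrightarrow> \<bar>f (y + w) - f y - g y \<bullet> w\<bar> \<le> e * norm w * indicator (cball 0 (\<bar>R\<bar> + 1)) y"
proof -
  have "uniformly_continuous_on (cball 0 (\<bar>R\<bar> + 2)) g"
    by (intro compact_uniformly_continuous continuous_on_subset[OF cont_g]) auto
  then obtain d where d: "d > 0" "\<And>x y. x \<in> cball 0 (\<bar>R\<bar> + 2) \<Longrightarrow> y \<in> cball 0 (\<bar>R\<bar> + 2) \<Longrightarrow> dist y x < d \<Longrightarrow> dist (g y) (g x) < e"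
    using assms unfolding uniformly_continuous_on_def by metis
  define \<delta> where "\<delta> = min 1 (d / 2)"
  have \<delta>: "\<delta> > 0" "\<delta> \<le> 1" "\<delta> < d" using d by (auto simp: \<delta>_def)
  show ?thesis
  proof (rule that[OF \<delta>(1,2)])
    fix y w :: 'a assume w: "norm w \<le> \<delta>"
    show "\<bar>f (y + w) - f y - g y \<bullet> w\<bar> \<le> e * norm w * indicator (cball 0 (\<bar>R\<bar> + 1)) y"
    proof (cases "y \<in> cball 0 (\<bar>R\<bar> + 1)")
      case True
      have "norm ((\<lambda>z. f z - g y \<bullet> z) (y + w) - (\<lambda>z. f z - g y \<bullet> z) y) \<le> e * norm (y + w - y)"
      proof (rule differentiable_bound[of "cball y \<delta>" _ "\<lambda>z v. (g z - g y) \<bullet> v"])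
        fix z assume z: "z \<in> cball y \<delta>"
        show "((\<lambda>z. f z - g y \<bullet> z) has_derivative (\<lambda>v. (g z - g y) \<bullet> v)) (at z within cball y \<delta>)"
          by (auto intro!: derivative_eq_intros has_derivative_at_withinI[OF deriv] simp: inner_diff_left)
        have "norm z \<le> norm y + \<delta>" using z norm_triangle_ineq2[of z y] by (simp add: dist_norm norm_minus_commute)
        then have "dist (g z) (g y) < e" using z \<delta> True by (intro d) (auto simp: dist_commute)
        then have "norm (g z - g y) \<le> e" by (simp add: dist_norm)
        then have "\<bar>(g z - g y) \<bullet> v\<bar> \<le> e * norm v" for v
          using Cauchy_Schwarz_ineq2[of "g z - g y" v] by (meson mult_right_mono norm_ge_zero order_trans)
        then show "onorm (\<lambda>v. (g z - g y) \<bullet> v) \<le> e" by (intro onorm_le) simp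
      qed (use w \<delta> in \<open>auto simp: dist_norm\<close>)
      then show ?thesis using True by (simp add: inner_add_right)
    next
      case False
      then have y: "norm y > \<bar>R\<bar> + 1" by simp
      have "norm (y + w) > R" using y w \<delta> norm_triangle_ineq2[of y "-w"] by (simp add: norm_minus_commute)
      then have "f (y + w) = 0" "f y = 0" "g y = 0" using supp supp_g y by force+
      then show ?thesis using False by simp
    qed
  qed
qed

lemma integral_f_shift: "(\<integral>x. f (x + w) \<partial>lborel) = (\<integral>x. f x \<partial>lborel)"
  using cont_f by (intro lborel_integral_shift borel_measurable_continuous_onI)

lemma integrable_f_shift: "integrable lborel (\<lambda>x. f (x + w))"
proof (rule integrable_cont_bounded_support)
  show "continuous_on UNIV (\<lambda>x. f (x + w))"
    by (rule continuous_on_compose2[OF cont_f]) (auto intro!: continuous_intros)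
  have "norm x \<le> R + norm w" if "f (x + w) \<noteq> 0" for x
    using supp[OF that] norm_triangle_ineq4[of "x + w" w] by simp
  then show "bounded {x. f (x + w) \<noteq> 0}" by (auto simp: bounded_iff)
qed

text \<open>Translation does not change the integral of \<open>f\<close>, so in the integrated
  first-order expansion of \<open>f (x + t *\<^sub>R v) - f x\<close> only the linear term and an
  error of smaller order remain. This avoids Fubini's theorem.\<close>

lemma integral_gradient_inner: "(\<integral>x. g x \<bullet> v \<partial>lborel) = 0"
proof -
  define I where "I = (\<integral>x. g x \<bullet> v \<partial>lborel)"
  define V where "V = measure lborel (cball (0::'a) (\<bar>R\<bar> + 1))"
  have V: "integrable lborel (indicator (cball (0::'a) (\<bar>R\<bar> + 1)) :: 'a \<Rightarrow> real)"
    using emeasure_lborel_cball_finite by (intro integrable_real_indicator) auto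
  have "\<bar>I\<bar> \<le> e * norm v * V" if e: "e > 0" for e
  proof -
    obtain \<delta> where \<delta>: "\<delta> > 0" "\<And>y w. norm w \<le> \<delta> \<Longrightarrow> \<bar>f (y + w) - f y - g y \<bullet> w\<bar> \<le> e * norm w * indicator (cball 0 (\<bar>R\<bar> + 1)) y"
      using uniform_deriv[OF e] by metis
    \<comment> \<open>The summand 1 covers \<open>v = 0\<close>; the step
      \<open>t *\<^sub>R v\<close> then has norm at most \<open>\<delta>\<close>.\<close>
    define t where "t = \<delta> / (norm v + 1)"
    have t: "t > 0" using \<delta> by (auto simp: t_def add_nonneg_pos)
    have "norm (t *\<^sub>R v) \<le> \<delta>"
    proof -
      have "\<delta> * norm v \<le> \<delta> * (norm v + 1)" "0 < norm v + 1" using \<delta> by (auto simp: add_nonneg_pos)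
      then show ?thesis using \<delta> t by (simp add: t_def pos_divide_le_eq)
    qed
    note b = \<delta>(2)[OF this]
    have "t * \<bar>I\<bar> = \<bar>\<integral>x. (f (x + t *\<^sub>R v) - f x - g x \<bullet> (t *\<^sub>R v)) \<partial>lborel\<bar>"
      using t integrable_g by (simp add: integrable_f integrable_f_shift integral_f_shift I_def abs_mult)
    also have "\<dots> \<le> (\<integral>x. e * norm (t *\<^sub>R v) * indicator (cball (0::'a) (\<bar>R\<bar> + 1)) x \<partial>lborel)"
    proof (rule Bochner_Integration.integral_norm_bound_integral[where f="\<lambda>x. f (x + t *\<^sub>R v) - f x - g x \<bullet> t *\<^sub>R v", unfolded real_norm_def])
      show "integrable lborel (\<lambda>x. f (x + t *\<^sub>R v) - f x - g x \<bullet> t *\<^sub>R v)"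
        by (intro Bochner_Integration.integrable_diff integrable_f integrable_f_shift integrable_inner_left integrable_g)
      show "integrable lborel (\<lambda>x. e * norm (t *\<^sub>R v) * indicat_real (cball (0::'a) (\<bar>R\<bar> + 1)) x)"
        by (intro integrable_mult_right V)
    qed (rule b)
    also have "\<dots> = t * (e * norm v * V)" using t by (simp add: V_def)
    finally show ?thesis using t by simp
  qed
  then have "\<bar>I\<bar> / (norm v * V + 1) \<le> e" if "e > 0" for e
    using that[THEN mult_pos_pos, of 1] by (smt (verit) V_def measure_nonneg mult_nonneg_nonneg norm_ge_zero pos_divide_le_eq mult.assoc distrib_left that)
  then have "\<bar>I\<bar> / (norm v * V + 1) \<le> 0" by (rule field_le_epsilon[of _ 0, simplified])
  then show ?thesis unfolding I_def[symmetric]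
    by (smt (verit) V_def divide_le_0_iff measure_nonneg mult_nonneg_nonneg norm_ge_zero)
qed

lemma integral_gradient: "(\<integral>x. g x \<partial>lborel) = 0"
proof -
  have "(\<integral>x. g x \<partial>lborel) \<bullet> v = 0" for v
    using integral_gradient_inner[of v] integrable_g by simp
  then show ?thesis by (metis inner_eq_zero_iff)
qed

end

text \<open>Sobolev's inequality for p = 1, with exponent N/(N-1) where N = m + 1. Each of the N
  coordinates bounds |w| by a line integral of the gradient; the product of the m-th roots of these
  N bounds is the hypothesis of \<open>gagliardo\<close>.\<close>

lemma gagliardo_nirenberg_L1:
  fixes w :: "'a::euclidean_space \<Rightarrow> real"
  assumes dim: "DIM('a) = Suc m" "m > 0" and w: "C1_bounded_support w g R"
  shows "(\<integral>x. root m \<bar>w x\<bar> ^ DIM('a) \<partial>lborel) \<le> root m (\<integral>x. norm (g x) \<partial>lborel) ^ DIM('a)"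
proof -
  interpret C1_bounded_support w g R by (rule w)
  have intg: "integrable lborel (\<lambda>x. norm (g x))" using integrable_g by simp
  have [measurable]: "w \<in> borel_measurable borel" "g \<in> borel_measurable borel"
    using cont_f cont_g by (auto intro: borel_measurable_continuous_onI)
  define F where "F x = ennreal (norm (g x))" for x
  have [measurable]: "F \<in> borel_measurable borel" unfolding F_def by measurable
  have "(\<integral>\<^sup>+x. eroot m (ennreal \<bar>w x\<bar>) ^ DIM('a) \<partial>lborel) \<le> eroot m (\<integral>\<^sup>+x. F x \<partial>lborel) ^ DIM('a)"
  proof (rule gagliardo[OF dim])
    fix x
    have "eroot m (ennreal \<bar>w x\<bar>) ^ DIM('a) = (\<Prod>b\<in>(Basis::'a set). eroot m (ennreal \<bar>w x\<bar>))" by simp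
    also have "\<dots> \<le> (\<Prod>b\<in>Basis. eroot m (line_int b F x))"
    proof (rule prod_mono_ennreal)
      fix b :: 'a assume b: "b \<in> Basis"
      have "ennreal \<bar>w x\<bar> \<le> line_int b (\<lambda>x. ennreal \<bar>g x \<bullet> b\<bar>) x"
        by (rule abs_le_line_int[OF deriv _ bounded_supp(1) b]) (auto intro!: continuous_intros cont_g)
      also have "\<dots> \<le> line_int b F x"
        unfolding F_def by (intro line_int_mono ennreal_leI) (simp add: Basis_le_norm b)
      finally show "eroot m (ennreal \<bar>w x\<bar>) \<le> eroot m (line_int b F x)" using dim by (intro eroot_mono)
    qed
    finally show "eroot m (ennreal \<bar>w x\<bar>) ^ DIM('a) \<le> (\<Prod>b\<in>Basis. eroot m (line_int b F x))" .
  qed measurable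
  also have "(\<integral>\<^sup>+x. F x \<partial>lborel) = ennreal (\<integral>x. norm (g x) \<partial>lborel)"
    unfolding F_def by (rule nn_integral_eq_integral[OF intg]) simp
  also have "(\<integral>\<^sup>+x. eroot m (ennreal \<bar>w x\<bar>) ^ DIM('a) \<partial>lborel) = (\<integral>\<^sup>+x. ennreal (root m \<bar>w x\<bar> ^ DIM('a)) \<partial>lborel)"
    by (intro nn_integral_cong) (simp add: eroot_ennreal ennreal_power dim(2) del: power_Suc)
  also have "\<dots> = ennreal (\<integral>x. root m \<bar>w x\<bar> ^ DIM('a) \<partial>lborel)"
  proof (rule nn_integral_eq_integral)
    show "integrable lborel (\<lambda>x. root m \<bar>w x\<bar> ^ DIM('a))"
      by (rule integrable_cont_bounded_support)
        (use dim bounded_supp(1) in \<open>auto intro!: continuous_intros cont_f\<close>)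
  qed (use dim in simp)
  finally show ?thesis using dim(2) by (simp add: eroot_ennreal ennreal_power del: power_Suc)
qed

text \<open>The case p = 1 is applied to a power of |v|, and Hoelder's inequality separates the
  gradient from |v|. A smaller power of the left side then appears on the right and is divided
  out.\<close>

lemma sobolev_inequality_C1:
  fixes v :: "'a::euclidean_space \<Rightarrow> real" and p :: real
  assumes p: "1 < p" "p < DIM('a)"
    and v: "C1_bounded_support v g R"
  defines "N \<equiv> real DIM('a)"
  shows "(\<integral>x. \<bar>v x\<bar> powr (N * p / (N - p)) \<partial>lborel) powr ((N - p) / N)
    \<le> (p * (N - 1) / (N - p)) powr p * (\<integral>x. norm (g x) powr p \<partial>lborel)"
proof -
  interpret C1_bounded_support v g R by (rule v)
  define m where "m = DIM('a) - 1"
  have m: "DIM('a) = Suc m" "m > 0" "real m = N - 1" using p by (auto simp: m_def N_def)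
  \<comment> \<open>This power of |v| makes both exponents equal to the critical one: gamma N/(N-1)
    = P on the left, and (gamma - 1) p/(p-1) = P after Hoelder's inequality on the right.\<close>
  define \<gamma> where "\<gamma> = p * (N - 1) / (N - p)"
  have N: "p < N" "1 < N" using p by (auto simp: N_def)
  have \<gamma>: "\<gamma> > 1"
  proof -
    have "N - p < p * (N - 1)" using p N by (simp add: algebra_simps)
    then show ?thesis using N by (simp add: \<gamma>_def)
  qed
  define P where "P = N * p / (N - p)"
  have P: "P = \<gamma> * (N / (N - 1))" "\<gamma> - 1 = P * (1 - 1/p)" "P > 0"
  proof -
    have "N - 1 \<noteq> 0" "N - p \<noteq> 0" "p \<noteq> 0" using N p by auto
    then show "P = \<gamma> * (N / (N - 1))" "\<gamma> - 1 = P * (1 - 1/p)"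
      unfolding P_def \<gamma>_def by (simp add: divide_simps; (simp add: algebra_simps)?)+
    show "P > 0" using N p by (simp add: P_def)
  qed
  define A B where "A = (\<integral>x. \<bar>v x\<bar> powr P \<partial>lborel)" and "B = (\<integral>x. norm (g x) powr p \<partial>lborel)"
  have AB: "0 \<le> A" "0 \<le> B" by (auto simp: A_def B_def)
  define w where "w x = \<bar>v x\<bar> powr \<gamma>" for x
  define h where "h x = (\<gamma> * (\<bar>v x\<bar> powr (\<gamma> - 1) * sgn (v x))) *\<^sub>R g x" for x
  have wd: "(w has_derivative (\<lambda>k. h x \<bullet> k)) (at x)" for x
  proof -
    have "((\<lambda>s. \<bar>s\<bar> powr \<gamma>) has_derivative (*) (\<gamma> * (\<bar>v x\<bar> powr (\<gamma> - 1) * sgn (v x)))) (at (v x))"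
      using has_real_derivative_abs_powr[OF \<gamma>] by (simp add: has_field_derivative_def)
    from diff_chain_at[OF deriv this] show ?thesis
      by (simp add: o_def w_def[abs_def] h_def)
  qed
  have w: "C1_bounded_support w h R"
  proof
    show "continuous_on UNIV h"
      unfolding h_def using \<gamma> cont_g
      by (auto intro!: continuous_intros continuous_on_compose2[OF continuous_on_abs_powr_sgn cont_f])
    show "w x \<noteq> 0 \<Longrightarrow> norm x \<le> R" for x using supp by (auto simp: w_def)
  qed (rule wd)
  have "root m \<bar>w x\<bar> ^ DIM('a) = \<bar>v x\<bar> powr P" for x
  proof (cases "v x = 0")
    case False
    have "root m \<bar>w x\<bar> = \<bar>v x\<bar> powr (\<gamma> / (N - 1))"
      using m by (simp add: w_def root_powr_inverse powr_powr)
    then show ?thesis using False P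
      by (simp add: powr_realpow[symmetric] powr_powr N_def field_simps)
  qed (use P m in \<open>simp add: w_def\<close>)
  with gagliardo_nirenberg_L1[OF m(1,2) w]
  have "A \<le> root m (\<integral>x. norm (h x) \<partial>lborel) ^ DIM('a)" by (simp add: A_def)
  also have "\<dots> = (\<integral>x. norm (h x) \<partial>lborel) powr (N / (N - 1))"
  proof (cases "(\<integral>x. norm (h x) \<partial>lborel) = 0")
    case False
    then have "0 < (\<integral>x. norm (h x) \<partial>lborel)" by (simp add: less_le)
    then have "root m (\<integral>x. norm (h x) \<partial>lborel) ^ DIM('a)
      = ((\<integral>x. norm (h x) \<partial>lborel) powr (1 / real m)) powr real DIM('a)"
      using m by (subst powr_realpow) (auto simp: root_powr_inverse)
    then show ?thesis by (simp add: powr_powr m(3) N_def)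
  qed (use m in auto)
  finally have 1: "A \<le> (\<integral>x. norm (h x) \<partial>lborel) powr (N / (N - 1))" .
  have intA: "integrable lborel (\<lambda>x. \<bar>v x\<bar> powr P)"
    by (rule integrable_cont_bounded_support)
      (use bounded_supp(1) P cont_f in \<open>auto intro!: continuous_intros continuous_on_powr'\<close>)
  have intB: "integrable lborel (\<lambda>x. norm (g x) powr p)"
    by (rule integrable_cont_bounded_support)
      (use bounded_supp(2) p cont_g in \<open>auto intro!: continuous_intros continuous_on_powr'\<close>)
  have hn: "norm (h x) = \<gamma> * ((\<bar>v x\<bar> powr P) powr (1 - 1/p) * (norm (g x) powr p) powr (1/p))" for x
  proof -
    have "(norm (g x) powr p) powr (1/p) = norm (g x)" using p by (simp add: powr_powr)
    moreover have "(\<bar>v x\<bar> powr P) powr (1 - 1/p) = \<bar>v x\<bar> powr (\<gamma> - 1)" by (simp add: powr_powr P(2))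
    ultimately show ?thesis using \<gamma> by (auto simp: h_def abs_mult sgn_if)
  qed
  have "(\<integral>x. norm (h x) \<partial>lborel) \<le> \<gamma> * (A powr (1 - 1/p) * B powr (1/p))"
    unfolding hn A_def B_def using \<gamma> p
    by (auto intro!: mult_left_mono Holder_integral(2) intA intB)
  then have 2: "A \<le> (\<gamma> * (A powr (1 - 1/p) * B powr (1/p))) powr (N / (N - 1))"
    using N by (intro order_trans[OF 1] powr_mono2) auto
  show ?thesis unfolding P_def[symmetric] A_def[symmetric] B_def[symmetric] \<gamma>_def[symmetric]
  \<comment> \<open>Dividing by \<open>A powr (1 - 1/p)\<close> needs \<open>A\<close> to be
    positive; it is finite since \<open>v\<close> has bounded support.\<close>
  proof (cases "A = 0")
    case False
    then have A: "A > 0" using AB by simp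
    have "A powr ((N - 1) / N) \<le> ((\<gamma> * (A powr (1 - 1/p) * B powr (1/p))) powr (N / (N - 1))) powr ((N - 1) / N)"
      using 2 A N by (intro powr_mono2) auto
    also have "\<dots> = \<gamma> * (A powr (1 - 1/p) * B powr (1/p))"
      using N \<gamma> AB by (simp add: powr_powr)
    finally have "A powr ((N - 1) / N) / A powr (1 - 1/p) \<le> \<gamma> * B powr (1/p)"
      using A by (simp add: field_simps)
    moreover have "A powr ((N - 1) / N) / A powr (1 - 1/p) = A powr ((N - p) / (N * p))"
      using A N p by (simp add: powr_diff[symmetric] field_simps)
    ultimately have "(A powr ((N - p) / (N * p))) powr p \<le> (\<gamma> * B powr (1/p)) powr p"
      using p by (intro powr_mono2) auto
    then show "A powr ((N - p) / N) \<le> \<gamma> powr p * B"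
      using A N p AB \<gamma> by (simp add: powr_powr powr_mult)
  qed (use AB in simp)
qed

subsection \<open>Bump functions and mollification\<close>

lemma Ck_on_mono1: "Ck_on (Suc n) f U \<Longrightarrow> Ck_on n f U"
proof (induction n arbitrary: f)
  case 0
  then show ?case by (simp add: differentiable_imp_continuous_on)
next
  case (Suc n)
  then show ?case by (metis Ck_on.simps(2))
qed

lemma Ck_on_const [simp]: "Ck_on n (\<lambda>x. c) UNIV"
  by (induction n arbitrary: c) (auto simp: frechet_derivative_const)

lemma frechet_derivative_eqI: "(f has_derivative f') (at x) \<Longrightarrow> frechet_derivative f (at x) = f'"
  using frechet_derivative_at by metis

lemma Ck_on_SucI:
  assumes "\<And>x. (f has_derivative f' x) (at x)" "\<And>v. Ck_on n (\<lambda>x. f' x v) UNIV"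
  shows "Ck_on (Suc n) f UNIV"
  using assms frechet_derivative_eqI[OF assms(1)]
  by (auto simp: differentiable_on_def differentiable_def)

lemma Ck_on_SucD:
  assumes "Ck_on (Suc n) f UNIV"
  shows "(f has_derivative frechet_derivative f (at x)) (at x)" "Ck_on n (\<lambda>x. frechet_derivative f (at x) v) UNIV"
  using assms by (auto simp: differentiable_on_def frechet_derivative_works)

lemma Ck_on_add:
  "Ck_on n f UNIV \<Longrightarrow> Ck_on n g UNIV \<Longrightarrow> Ck_on n (\<lambda>x. f x + g x) UNIV"
proof (induction n arbitrary: f g)
  case (Suc n)
  show ?case
    by (rule Ck_on_SucI, rule has_derivative_add[OF Ck_on_SucD(1)[OF Suc.prems(1)] Ck_on_SucD(1)[OF Suc.prems(2)]])
      (intro Suc.IH Ck_on_SucD(2)[OF Suc.prems(1)] Ck_on_SucD(2)[OF Suc.prems(2)])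
qed (auto intro: continuous_intros)

lemma Ck_on_mult:
  fixes f g :: "'a::euclidean_space \<Rightarrow> real"
  shows "Ck_on n f UNIV \<Longrightarrow> Ck_on n g UNIV \<Longrightarrow> Ck_on n (\<lambda>x. f x * g x) UNIV"
proof (induction n arbitrary: f g)
  case (Suc n)
  show ?case
    by (rule Ck_on_SucI, rule has_derivative_mult[OF Ck_on_SucD(1)[OF Suc.prems(1)] Ck_on_SucD(1)[OF Suc.prems(2)]])
      (intro Suc.IH Ck_on_add Ck_on_SucD(2)[OF Suc.prems(1)] Ck_on_SucD(2)[OF Suc.prems(2)]
        Ck_on_mono1[OF Suc.prems(1)] Ck_on_mono1[OF Suc.prems(2)])
qed (auto intro: continuous_intros)

lemma Ck_on_prod:
  fixes f :: "'i \<Rightarrow> 'a::euclidean_space \<Rightarrow> real"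
  assumes "finite I" "\<And>i. i \<in> I \<Longrightarrow> Ck_on n (f i) UNIV"
  shows "Ck_on n (\<lambda>x. \<Prod>i\<in>I. f i x) UNIV"
  using assms by (induction I rule: finite_induct) (auto intro!: Ck_on_mult)

text \<open>Each derivative of a ridge function is a ridge function of the next member of the
  sequence, times a constant; hence the induction on n needs all k at once. The box bumps below are
  products of such functions.\<close>

lemma Ck_on_ridge:
  fixes \<Psi> :: "nat \<Rightarrow> real \<Rightarrow> real" and c :: "'a::euclidean_space"
  assumes "\<And>k t. (\<Psi> k has_real_derivative \<Psi> (Suc k) t) (at t)"
  shows "Ck_on n (\<lambda>x. \<Psi> k (c \<bullet> x + \<beta>)) UNIV"
proof (induction n arbitrary: k)
  case 0
  have "continuous_on UNIV (\<Psi> k)" using assms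
    by (meson DERIV_isCont continuous_at_imp_continuous_on)
  then show ?case by (auto intro!: continuous_intros continuous_on_compose2[of UNIV "\<Psi> k"])
next
  case (Suc n)
  have "((\<lambda>x. \<Psi> k (c \<bullet> x + \<beta>)) has_derivative (\<lambda>v. \<Psi> (Suc k) (c \<bullet> x + \<beta>) * (c \<bullet> v))) (at x)" for x
  proof -
    have 1: "((\<lambda>x. c \<bullet> x + \<beta>) has_derivative (\<lambda>v. c \<bullet> v)) (at x)"
      by (auto intro!: derivative_eq_intros)
    have 2: "(\<Psi> k has_derivative (*) (\<Psi> (Suc k) (c \<bullet> x + \<beta>))) (at (c \<bullet> x + \<beta>))"
      using assms by (simp add: has_field_derivative_def)
    show ?thesis using diff_chain_at[OF 1 2] by (simp add: o_def)
  qed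
  then show ?case by (rule Ck_on_SucI) (intro Ck_on_mult Suc Ck_on_const)
qed

text \<open>With s = 1/t one has d/dt = -s^2 d/ds, which maps P(s) exp(-s) to s^2 (P(s) - P'(s))
  exp(-s); the recursion is this map on the polynomial factor.\<close>

fun flat_poly :: "nat \<Rightarrow> real poly" where
  "flat_poly 0 = 1"
| "flat_poly (Suc k) = [:0, 0, 1:] * (flat_poly k - pderiv (flat_poly k))"

text \<open>The \<open>k\<close>-th derivative of \<open>t \<mapsto> exp (-1/t)\<close>, extended by \<open>0\<close> to \<open>t \<le> 0\<close>.\<close>
definition flat_exp :: "nat \<Rightarrow> real \<Rightarrow> real" where
  "flat_exp k t = (if t > 0 then poly (flat_poly k) (1 / t) * exp (- 1 / t) else 0)"

lemma poly_exp_tendsto_0: "((\<lambda>s. poly p s * exp (- s)) \<longlongrightarrow> (0::real)) at_top"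
proof -
  have "((\<lambda>s. \<Sum>i\<le>degree p. coeff p i * (s ^ i / exp s)) \<longlongrightarrow> (\<Sum>i\<le>degree p. coeff p i * 0)) at_top"
    by (intro tendsto_intros tendsto_power_div_exp_0)
  then show ?thesis by (simp add: poly_altdef exp_minus field_simps sum_divide_distrib)
qed

lemma flat_exp_deriv: "(flat_exp k has_real_derivative flat_exp (Suc k) t) (at t)"
proof -
  consider "t > 0" | "t < 0" | "t = 0" by linarith
  then show ?thesis
  proof cases
    case 1
    have "((\<lambda>t. poly (flat_poly k) (1 / t) * exp (- 1 / t)) has_real_derivative flat_exp (Suc k) t) (at t)"
      using 1 by (auto intro!: derivative_eq_intros DERIV_chain2[OF poly_DERIV]
          simp: flat_exp_def field_simps power2_eq_square)
    then show ?thesis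
      by (rule has_field_derivative_transform_within_open[of _ _ _ "{0<..}"]) (use 1 in \<open>auto simp: flat_exp_def\<close>)
  next
    case 2
    have "((\<lambda>t. 0) has_real_derivative flat_exp (Suc k) t) (at t)"
      using 2 by (auto simp: flat_exp_def)
    then show ?thesis
      by (rule has_field_derivative_transform_within_open[of _ _ _ "{..<0}"]) (use 2 in \<open>auto simp: flat_exp_def\<close>)
  next
    case 3
    \<comment> \<open>The extra factor \<open>[:0, 1:]\<close> is the division by h in the
      difference quotient, where s = 1/h.\<close>
    have "((\<lambda>s. poly ([:0, 1:] * flat_poly k) s * exp (- s)) \<longlongrightarrow> 0) at_top"
      by (rule poly_exp_tendsto_0)
    then have "((\<lambda>h. poly ([:0, 1:] * flat_poly k) (inverse h) * exp (- inverse h)) \<longlongrightarrow> 0) (at_right 0)"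
      by (rule filterlim_compose) (rule filterlim_inverse_at_top_right)
    then have "((\<lambda>h. flat_exp k h / h) \<longlongrightarrow> 0) (at_right 0)"
      by (rule Lim_transform_eventually)
        (auto simp: flat_exp_def eventually_at_filter field_simps)
    moreover have "((\<lambda>h. flat_exp k h / h) \<longlongrightarrow> 0) (at_left 0)"
      by (rule tendsto_eventually) (auto simp: flat_exp_def eventually_at_filter)
    ultimately have "((\<lambda>h. flat_exp k h / h) \<longlongrightarrow> 0) (at 0)"
      by (simp add: filterlim_split_at)
    then show ?thesis using 3 by (simp add: DERIV_def flat_exp_def)
  qed
qed

text \<open>The scale \<open>r\<close> does not affect where the bump is positive but drives its
  values inside the box to 1. One family therefore serves as mollification kernel, as cutoff and as
  approximation of indicators of boxes.\<close>

definition box_bump :: "real \<Rightarrow> 'a::euclidean_space \<Rightarrow> 'a \<Rightarrow> 'a \<Rightarrow> real" where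
  "box_bump r a c x = (\<Prod>b\<in>Basis. flat_exp 0 (r * (x \<bullet> b - a \<bullet> b)) * flat_exp 0 (r * (c \<bullet> b - x \<bullet> b)))"

lemma flat_exp_0: "flat_exp 0 t = (if t > 0 then exp (- 1 / t) else 0)"
  by (simp add: flat_exp_def)

lemma flat_exp_0_range: "0 \<le> flat_exp 0 t" "flat_exp 0 t \<le> 1"
  by (auto simp: flat_exp_0)

lemma box_bump_range: "0 \<le> box_bump r a c x" "box_bump r a c x \<le> 1"
  unfolding box_bump_def using flat_exp_0_range
  by (auto intro!: prod_nonneg prod_le_1 mult_le_one)

lemma box_bump_eq_0: "r > 0 \<Longrightarrow> box_bump r a c x = 0 \<longleftrightarrow> x \<notin> box a c"
proof -
  assume "r > 0"
  then have "flat_exp 0 (r * (x \<bullet> b - a \<bullet> b)) * flat_exp 0 (r * (c \<bullet> b - x \<bullet> b)) = 0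
    \<longleftrightarrow> \<not> (a \<bullet> b < x \<bullet> b \<and> x \<bullet> b < c \<bullet> b)" for b
    by (auto simp: flat_exp_0 zero_less_mult_iff)
  then show ?thesis by (simp add: box_bump_def mem_box del: mult_eq_0_iff)
qed

lemma Ck_on_box_bump: "Ck_on n (box_bump r a c) UNIV"
proof -
  have 1: "flat_exp 0 (r * (x \<bullet> b - a \<bullet> b)) = flat_exp 0 ((r *\<^sub>R b) \<bullet> x + (- r * (a \<bullet> b)))"
    "flat_exp 0 (r * (c \<bullet> b - x \<bullet> b)) = flat_exp 0 (((- r) *\<^sub>R b) \<bullet> x + r * (c \<bullet> b))" for x b :: 'a
    by (auto simp: algebra_simps inner_commute)
  show ?thesis unfolding box_bump_def[abs_def] 1
    by (intro Ck_on_prod Ck_on_mult Ck_on_ridge flat_exp_deriv) simp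
qed

lemma box_bump_Cinf_c:
  assumes "r > 0" "cbox a c \<subseteq> U" shows "box_bump r a c \<in> Cinf_c U"
proof -
  have "closure {x. box_bump r a c x \<noteq> 0} \<subseteq> cbox a c"
    using assms by (intro closure_minimal) (auto simp: box_bump_eq_0 box_subset_cbox[THEN subsetD])
  moreover from this have "compact (closure {x. box_bump r a c x \<noteq> 0})"
    by (meson bounded_cbox bounded_subset closed_closure compact_eq_bounded_closed)
  ultimately show ?thesis using assms Ck_on_box_bump[of _ r a c]
    by (auto simp: Cinf_c_def Ck_c_def)
qed

lemma box_bump_tendsto: "(\<lambda>n. box_bump (real n) a c x) \<longlonglongrightarrow> indicator (box a c) x"
proof -
  have 1: "(\<lambda>n. flat_exp 0 (real n * t)) \<longlonglongrightarrow> (if t > 0 then 1 else 0)" for t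
  proof (cases "t > 0")
    case True
    have "(\<lambda>n. exp (- (1/t) * inverse (real n))) \<longlonglongrightarrow> exp (- (1/t) * 0)"
      by (intro tendsto_intros lim_inverse_n)
    then have "(\<lambda>n. flat_exp 0 (real n * t)) \<longlonglongrightarrow> exp (- (1/t) * 0)"
    proof (rule Lim_transform_eventually)
      show "\<forall>\<^sub>F n in sequentially. exp (- (1/t) * inverse (real n)) = flat_exp 0 (real n * t)"
        using eventually_gt_at_top[of 0]
        by eventually_elim (use True in \<open>simp add: flat_exp_0 field_simps\<close>)
    qed
    then show ?thesis using True by simp
  next
    case False
    then have "flat_exp 0 (real n * t) = 0" for n
      by (auto simp: flat_exp_0 zero_less_mult_iff)
    then show ?thesis using False by simp
  qed
  have "(\<lambda>n. box_bump (real n) a c x) \<longlonglongrightarrow> (\<Prod>b\<in>Basis. (if x \<bullet> b - a \<bullet> b > 0 then 1 else 0) * (if c \<bullet> b - x \<bullet> b > 0 then 1 else 0))"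
    unfolding box_bump_def by (intro tendsto_intros 1)
  also have "(\<Prod>b\<in>Basis. (if x \<bullet> b - a \<bullet> b > 0 then 1 else 0) * (if c \<bullet> b - x \<bullet> b > 0 then 1 else 0)) = (indicator (box a c) x :: real)"
    by (auto simp: indicator_def mem_box)
  finally show ?thesis .
qed

section \<open>The gradient as a vector representing the derivative\<close>

lemma grad_works:
  assumes "f differentiable at x"
  shows "(f has_derivative (\<lambda>v. grad f x \<bullet> v)) (at x)"
proof -
  have d: "(f has_derivative frechet_derivative f (at x)) (at x)"
    using assms frechet_derivative_works by blast
  then have lin: "linear (frechet_derivative f (at x))" by (rule has_derivative_linear)
  have "frechet_derivative f (at x) v = grad f x \<bullet> v" for v
  proof -
    have "frechet_derivative f (at x) v = frechet_derivative f (at x) (\<Sum>b\<in>Basis. (v \<bullet> b) *\<^sub>R b)"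
      by (simp add: euclidean_representation)
    also have "\<dots> = (\<Sum>b\<in>Basis. (v \<bullet> b) * frechet_derivative f (at x) b)"
      by (simp add: linear_sum[OF lin] linear_cmul[OF lin])
    also have "\<dots> = grad f x \<bullet> v"
      by (simp add: grad_def inner_sum_left inner_commute[of v] mult.commute)
    finally show ?thesis .
  qed
  then have "frechet_derivative f (at x) = (\<lambda>v. grad f x \<bullet> v)" by blast
  with d show ?thesis by simp
qed

lemma grad_eqI:
  assumes "(f has_derivative (\<lambda>v. g \<bullet> v)) (at x)" shows "grad f x = g"
proof -
  have "f differentiable at x" using assms by (auto simp: differentiable_def)
  from grad_works[OF this] assms have "(\<lambda>v. grad f x \<bullet> v) = (\<lambda>v. g \<bullet> v)"
    by (rule has_derivative_unique)
  then have "(grad f x - g) \<bullet> (grad f x - g) = 0" by (metis inner_diff_left right_minus_eq)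
  then show ?thesis by simp
qed

lemma Ck_on_1_iff:
  fixes f :: "'a::euclidean_space \<Rightarrow> real"
  shows "Ck_on 1 f UNIV \<longleftrightarrow> (\<forall>x. (f has_derivative (\<lambda>v. grad f x \<bullet> v)) (at x)) \<and> continuous_on UNIV (grad f)"
proof
  assume C: "Ck_on 1 f UNIV"
  then have "\<forall>x. (f has_derivative (\<lambda>v. grad f x \<bullet> v)) (at x)"
    by (auto simp: differentiable_on_def intro: grad_works)
  moreover have "continuous_on UNIV (grad f)"
    unfolding grad_def[abs_def] using C by (intro continuous_intros) auto
  ultimately show "(\<forall>x. (f has_derivative (\<lambda>v. grad f x \<bullet> v)) (at x)) \<and> continuous_on UNIV (grad f)" by blast
next
  assume R: "(\<forall>x. (f has_derivative (\<lambda>v. grad f x \<bullet> v)) (at x)) \<and> continuous_on UNIV (grad f)"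
  have "Ck_on (Suc 0) f UNIV"
    by (rule Ck_on_SucI[of _ "\<lambda>x v. grad f x \<bullet> v"]) (use R in \<open>auto intro!: continuous_intros\<close>)
  then show "Ck_on 1 f UNIV" by simp
qed

lemma Ck_c_1_iff:
  "f \<in> Ck_c 1 U \<longleftrightarrow> (\<forall>x. (f has_derivative (\<lambda>v. grad f x \<bullet> v)) (at x)) \<and> continuous_on UNIV (grad f) \<and>
     compact (closure {x. f x \<noteq> 0}) \<and> closure {x. f x \<noteq> 0} \<subseteq> U"
  unfolding Ck_c_def mem_Collect_eq Ck_on_1_iff by blast

lemma Cinf_c_subset: "Cinf_c U \<subseteq> Ck_c n U"
  by (auto simp: Cinf_c_def)

section \<open>Mollification of Lipschitz functions\<close>

locale mollifier = C1_bounded_support \<eta> \<zeta> R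
  for \<eta> :: "'a::euclidean_space \<Rightarrow> real" and \<zeta> R +
  assumes nonneg: "\<And>x. 0 \<le> \<eta> x" and mass: "(\<integral>x. \<eta> x \<partial>lborel) = 1" and R: "R > 0"
begin

lemma integrable_mult_\<eta>:
  fixes k :: "'a \<Rightarrow> real"
  assumes "continuous_on UNIV k" shows "integrable lborel (\<lambda>y. k y * \<eta> y)"
  by (rule integrable_cont_bounded_support)
    (use assms in \<open>auto intro!: continuous_intros cont_f bounded_subset[OF bounded_supp(1)]\<close>)

lemma integrable_scale_\<zeta>:
  fixes k :: "'a \<Rightarrow> real"
  assumes "continuous_on UNIV k" shows "integrable lborel (\<lambda>y. k y *\<^sub>R \<zeta> y)"
  by (rule integrable_cont_bounded_support)
    (use assms in \<open>auto intro!: continuous_intros cont_g bounded_subset[OF bounded_supp(2)]\<close>)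

text \<open>Integration by parts: the gradient of (G . y) \<open>\<eta>\<close> y integrates to 0,
  and \<open>\<eta>\<close> has mass 1. This identifies the limit of the mollified
  gradients.\<close>

lemma integral_moment: "(\<integral>y. (G \<bullet> y) *\<^sub>R \<zeta> y \<partial>lborel) = - G"
proof -
  interpret P: C1_bounded_support "\<lambda>y. (G \<bullet> y) * \<eta> y" "\<lambda>y. \<eta> y *\<^sub>R G + (G \<bullet> y) *\<^sub>R \<zeta> y" R
    by unfold_locales
      (use supp in \<open>auto intro!: derivative_eq_intros deriv continuous_intros cont_f cont_g simp: algebra_simps\<close>)
  have "(\<integral>y. \<eta> y *\<^sub>R G + (G \<bullet> y) *\<^sub>R \<zeta> y \<partial>lborel) = (\<integral>y. \<eta> y *\<^sub>R G \<partial>lborel) + (\<integral>y. (G \<bullet> y) *\<^sub>R \<zeta> y \<partial>lborel)"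
    by (intro Bochner_Integration.integral_add integrable_scale_\<zeta> integrable_scaleR_left integrable_f continuous_intros)
  moreover have "(\<integral>y. \<eta> y *\<^sub>R G \<partial>lborel) = G" using integrable_f by (simp add: mass)
  ultimately show ?thesis using P.integral_gradient by (simp add: eq_neg_iff_add_eq_0 add.commute)
qed

context
  fixes \<phi> :: "'a \<Rightarrow> real" and L :: real
  assumes lip: "\<And>x y. \<bar>\<phi> x - \<phi> y\<bar> \<le> L * norm (x - y)"
begin

lemma L_nonneg: "0 \<le> L"
proof -
  have "0 \<le> L * norm (One - 0 :: 'a)" using lip[of One 0] by linarith
  moreover have "norm (One :: 'a) > 0" by (simp add: One_non_0)
  ultimately show ?thesis by (simp add: zero_le_mult_iff)
qed

lemma cont_\<phi>: "continuous_on UNIV \<phi>"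
  by (rule lipschitz_on_continuous_on[of L])
    (use lip L_nonneg in \<open>auto intro!: lipschitz_onI simp: dist_norm\<close>)

text \<open>Convolution after rescaling the variable: the parameter h sits in the argument of
  \<open>\<phi>\<close> and the kernel stays fixed.\<close>

definition moll :: "real \<Rightarrow> 'a \<Rightarrow> real" where
  "moll h x = (\<integral>y. \<phi> (x - h *\<^sub>R y) * \<eta> y \<partial>lborel)"

text \<open>The gradient of \<open>moll h\<close>, with the derivative placed on the kernel because
  \<open>\<phi>\<close> need not be differentiable; the rescaling produces the factor 1/h.\<close>

definition dmoll :: "real \<Rightarrow> 'a \<Rightarrow> 'a" where
  "dmoll h x = (1 / h) *\<^sub>R (\<integral>y. \<phi> (x - h *\<^sub>R y) *\<^sub>R \<zeta> y \<partial>lborel)"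

lemma cont_\<phi>_aff: "continuous_on UNIV (\<lambda>y. \<phi> (x - h *\<^sub>R y))"
  by (rule continuous_on_compose2[OF cont_\<phi>]) (auto intro!: continuous_intros)

text \<open>Since \<open>\<zeta>\<close> has integral 0, subtracting \<open>\<phi> x\<close> is
  free. The integrand now contains difference quotients, which the Lipschitz constant bounds
  independently of h.\<close>

lemma dmoll_diff:
  "dmoll h x = (\<integral>y. ((\<phi> (x - h *\<^sub>R y) - \<phi> x) / h) *\<^sub>R \<zeta> y \<partial>lborel)"
proof -
  have "(\<integral>y. (\<phi> (x - h *\<^sub>R y) - \<phi> x) *\<^sub>R \<zeta> y \<partial>lborel)
      = (\<integral>y. \<phi> (x - h *\<^sub>R y) *\<^sub>R \<zeta> y \<partial>lborel) - (\<integral>y. \<phi> x *\<^sub>R \<zeta> y \<partial>lborel)"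
    unfolding scaleR_diff_left
    by (intro Bochner_Integration.integral_diff integrable_scale_\<zeta> cont_\<phi>_aff continuous_intros)
  also have "(\<integral>y. \<phi> x *\<^sub>R \<zeta> y \<partial>lborel) = 0" by (simp add: integral_gradient)
  finally have "dmoll h x = (1 / h) *\<^sub>R (\<integral>y. (\<phi> (x - h *\<^sub>R y) - \<phi> x) *\<^sub>R \<zeta> y \<partial>lborel)"
    by (simp add: dmoll_def)
  also have "\<dots> = (\<integral>y. (1 / h) *\<^sub>R ((\<phi> (x - h *\<^sub>R y) - \<phi> x) *\<^sub>R \<zeta> y) \<partial>lborel)"
    by (rule integral_scaleR_right[symmetric])
  also have "\<dots> = (\<integral>y. ((\<phi> (x - h *\<^sub>R y) - \<phi> x) / h) *\<^sub>R \<zeta> y \<partial>lborel)"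
    by (rule Bochner_Integration.integral_cong) auto
  finally show ?thesis .
qed

lemma quotient_bound:
  assumes "h > 0"
  shows "norm (((\<phi> (x - h *\<^sub>R y) - \<phi> x) / h) *\<^sub>R \<zeta> y) \<le> L * (norm y * norm (\<zeta> y))"
proof -
  have "\<bar>\<phi> (x - h *\<^sub>R y) - \<phi> x\<bar> \<le> L * (h * norm y)" using lip[of "x - h *\<^sub>R y" x] assms by simp
  then have "\<bar>\<phi> (x - h *\<^sub>R y) - \<phi> x\<bar> / h \<le> L * norm y" using assms by (simp add: field_simps)
  from mult_right_mono[OF this norm_ge_zero[of "\<zeta> y"]] show ?thesis using assms by (simp add: mult.assoc)
qed

lemma integrable_dom: "integrable lborel (\<lambda>y. L * (norm y * norm (\<zeta> y)))"
  by (rule integrable_cont_bounded_support)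
    (auto intro!: continuous_intros cont_g bounded_subset[OF bounded_supp(2)])

lemma norm_dmoll_le:
  assumes "h > 0"
  shows "norm (dmoll h x) \<le> (\<integral>y. L * (norm y * norm (\<zeta> y)) \<partial>lborel)"
  unfolding dmoll_diff
  by (rule Bochner_Integration.integral_norm_bound_integral[OF _ integrable_dom quotient_bound[OF assms]])
    (use assms in \<open>auto intro!: integrable_scale_\<zeta> continuous_intros cont_\<phi>_aff\<close>)

lemma moll_nonneg: "(\<And>x. 0 \<le> \<phi> x) \<Longrightarrow> 0 \<le> moll h x"
  unfolding moll_def by (intro Bochner_Integration.integral_nonneg) (auto simp: nonneg)

lemma moll_close:
  assumes "h > 0"
  shows "\<bar>moll h x - \<phi> x\<bar> \<le> L * R * h"
proof -
  have "moll h x - \<phi> x = (\<integral>y. (\<phi> (x - h *\<^sub>R y) - \<phi> x) * \<eta> y \<partial>lborel)"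
    unfolding moll_def left_diff_distrib
    by (subst Bochner_Integration.integral_diff) (auto intro!: integrable_mult_\<eta> cont_\<phi>_aff integrable_f simp: mass)
  also have "\<bar>\<dots>\<bar> \<le> (\<integral>y. L * R * h * \<eta> y \<partial>lborel)"
  proof (rule integral_abs_bound_integral)
    fix y
    show "\<bar>(\<phi> (x - h *\<^sub>R y) - \<phi> x) * \<eta> y\<bar> \<le> L * R * h * \<eta> y"
    proof (cases "\<eta> y = 0")
      case False
      then have "norm y \<le> R" by (rule supp)
      then have "L * (h * norm y) \<le> L * (h * R)" using L_nonneg assms by (intro mult_left_mono) auto
      moreover have "\<bar>\<phi> (x - h *\<^sub>R y) - \<phi> x\<bar> \<le> L * (h * norm y)" using lip[of "x - h *\<^sub>R y" x] assms by simp
      ultimately have "\<bar>\<phi> (x - h *\<^sub>R y) - \<phi> x\<bar> \<le> L * R * h" by (simp add: ac_simps)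
      then show ?thesis using nonneg[of y] by (simp add: abs_mult mult_right_mono)
    qed simp
  qed (auto intro!: integrable_mult_\<eta> cont_\<phi>_aff continuous_intros integrable_f)
  also have "\<dots> = L * R * h" by (simp add: mass)
  finally show ?thesis .
qed

lemma continuous_dmoll:
  shows "continuous_on UNIV (dmoll h)"
proof -
  define Z where "Z = (\<integral>y. norm (\<zeta> y) \<partial>lborel)"
  have Z: "0 \<le> Z" by (simp add: Z_def)
  have "norm (dmoll h x - dmoll h x') \<le> (\<bar>1 / h\<bar> * (L * Z)) * norm (x - x')" for x x'
  proof -
    have "dmoll h x - dmoll h x' = (1 / h) *\<^sub>R (\<integral>y. (\<phi> (x - h *\<^sub>R y) - \<phi> (x' - h *\<^sub>R y)) *\<^sub>R \<zeta> y \<partial>lborel)"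
      unfolding dmoll_def scaleR_diff_left
      by (subst Bochner_Integration.integral_diff) (auto intro!: integrable_scale_\<zeta> cont_\<phi>_aff simp: scaleR_diff_right)
    also have "norm \<dots> \<le> \<bar>1 / h\<bar> * (\<integral>y. L * norm (x - x') * norm (\<zeta> y) \<partial>lborel)"
      unfolding norm_scaleR
    proof (rule mult_left_mono, rule Bochner_Integration.integral_norm_bound_integral)
      fix y show "norm ((\<phi> (x - h *\<^sub>R y) - \<phi> (x' - h *\<^sub>R y)) *\<^sub>R \<zeta> y) \<le> L * norm (x - x') * norm (\<zeta> y)"
        using lip[of "x - h *\<^sub>R y" "x' - h *\<^sub>R y"] by (auto intro!: mult_right_mono)
    qed (auto intro!: integrable_scale_\<zeta> continuous_intros cont_\<phi>_aff integrable_norm integrable_g)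
    also have "\<dots> = (\<bar>1 / h\<bar> * (L * Z)) * norm (x - x')" by (simp add: Z_def)
    finally show ?thesis .
  qed
  then have "(\<bar>1 / h\<bar> * (L * Z))-lipschitz_on UNIV (dmoll h)"
    using L_nonneg Z by (intro lipschitz_onI) (auto simp: dist_norm)
  then show ?thesis by (rule lipschitz_on_continuous_on)
qed

text \<open>A translation of the integration variable by \<open>w\<close>, where h w is the
  increment of x, moves the increment from \<open>\<phi>\<close> to the smooth kernel;
  \<open>uniform_deriv\<close> for the kernel gives the rest.\<close>

lemma moll_has_derivative:
  assumes h: "h > 0" and B: "\<And>x. \<bar>\<phi> x\<bar> \<le> B"
  shows "(moll h has_derivative (\<lambda>v. dmoll h x \<bullet> v)) (at x)"
  unfolding has_derivative_at_alt
proof (intro conjI allI impI)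
  show "bounded_linear (\<lambda>v. dmoll h x \<bullet> v)" by (rule bounded_linear_inner_right)
  fix e :: real assume e: "e > 0"
  define V where "V = measure lborel (cball (0::'a) (\<bar>R\<bar> + 1))"
  have V: "integrable lborel (indicator (cball (0::'a) (\<bar>R\<bar> + 1)) :: 'a \<Rightarrow> real)"
    using emeasure_lborel_cball_finite by (intro integrable_real_indicator) auto
  have B0: "0 \<le> B" using B[of 0] by linarith
  have V0: "0 \<le> V" by (simp add: V_def)
  \<comment> \<open>\<open>B\<close> bounds \<open>\<phi>\<close> and \<open>V\<close> is the volume
    of the ball carrying the Taylor error, so the total error is at most B V (e'/h) times the norm
    of the increment. The summand 1 avoids division by 0.\<close>
  define e' where "e' = e * h / (B * V + 1)"
  have BV: "0 < B * V + 1" using B0 V0 by (simp add: add_nonneg_pos)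
  have e': "e' > 0" using e h BV by (simp add: e'_def)
  obtain \<delta> where \<delta>: "\<delta> > 0" "\<And>y w. norm w \<le> \<delta> \<Longrightarrow> \<bar>\<eta> (y + w) - \<eta> y - \<zeta> y \<bullet> w\<bar> \<le> e' * norm w * indicator (cball 0 (\<bar>R\<bar> + 1)) y"
    using uniform_deriv[OF e'] by metis
  show "\<exists>d>0. \<forall>y. norm (y - x) < d \<longrightarrow> norm (moll h y - moll h x - dmoll h x \<bullet> (y - x)) \<le> e * norm (y - x)"
  proof (intro exI[of _ "\<delta> * h"] conjI allI impI)
    show "0 < \<delta> * h" using \<delta> h by simp
    fix z assume z: "norm (z - x) < \<delta> * h"
    define v where "v = z - x"
    define w where "w = (1 / h) *\<^sub>R v"
    have nw: "norm w = norm v / h" using h by (simp add: w_def)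
    have w: "norm w \<le> \<delta>" using z h by (simp add: nw v_def field_simps)
    have hw: "h *\<^sub>R w = v" using h by (simp add: w_def)
    have m: "(\<lambda>y. \<phi> (x + v - h *\<^sub>R y) * \<eta> y) \<in> borel_measurable borel"
      by (intro borel_measurable_continuous_onI continuous_intros cont_\<phi>_aff cont_f)
    have c1: "continuous_on UNIV (\<lambda>y. \<phi> (x - h *\<^sub>R y) * \<eta> (y + w))"
      by (intro continuous_intros cont_\<phi>_aff continuous_on_compose2[OF cont_f]) auto
    have i1: "integrable lborel (\<lambda>y. \<phi> (x - h *\<^sub>R y) * \<eta> (y + w))"
    proof (rule integrable_cont_bounded_support[OF c1])
      have "norm y \<le> R + norm w" if "\<eta> (y + w) \<noteq> 0" for y
        using supp[OF that] norm_triangle_ineq4[of "y + w" w] by simp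
      then show "bounded {y. \<phi> (x - h *\<^sub>R y) * \<eta> (y + w) \<noteq> 0}"
        by (auto simp: bounded_iff intro!: exI[of _ "R + norm w"])
    qed
    have "moll h z = (\<integral>y. \<phi> (x + v - h *\<^sub>R y) * \<eta> y \<partial>lborel)" by (simp add: moll_def v_def)
    also have "\<dots> = (\<integral>y. \<phi> (x + v - h *\<^sub>R (y + w)) * \<eta> (y + w) \<partial>lborel)"
      using lborel_integral_shift[OF m, of w] by simp
    also have "\<dots> = (\<integral>y. \<phi> (x - h *\<^sub>R y) * \<eta> (y + w) \<partial>lborel)"
      by (simp add: scaleR_add_right hw)
    finally have 1: "moll h z = (\<integral>y. \<phi> (x - h *\<^sub>R y) * \<eta> (y + w) \<partial>lborel)" .
    have "dmoll h x \<bullet> v = (\<integral>y. \<phi> (x - h *\<^sub>R y) *\<^sub>R \<zeta> y \<partial>lborel) \<bullet> w"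
      by (simp add: dmoll_def w_def)
    also have "\<dots> = (\<integral>y. \<phi> (x - h *\<^sub>R y) * (\<zeta> y \<bullet> w) \<partial>lborel)"
      by (subst integral_inner_left[symmetric]) (auto intro!: integrable_scale_\<zeta> cont_\<phi>_aff)
    finally have 2: "dmoll h x \<bullet> v = (\<integral>y. \<phi> (x - h *\<^sub>R y) * (\<zeta> y \<bullet> w) \<partial>lborel)" .
    have 3: "moll h x = (\<integral>y. \<phi> (x - h *\<^sub>R y) * \<eta> y \<partial>lborel)" by (simp add: moll_def)
    have i2: "integrable lborel (\<lambda>y. \<phi> (x - h *\<^sub>R y) * (\<zeta> y \<bullet> w))"
    proof -
      have "integrable lborel (\<lambda>y. (\<phi> (x - h *\<^sub>R y) *\<^sub>R \<zeta> y) \<bullet> w)"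
        by (intro integrable_inner_left integrable_scale_\<zeta> cont_\<phi>_aff)
      then show ?thesis by simp
    qed
    have i3: "integrable lborel (\<lambda>y. \<phi> (x - h *\<^sub>R y) * \<eta> y)" by (intro integrable_mult_\<eta> cont_\<phi>_aff)
    have "moll h z - moll h x - dmoll h x \<bullet> v
      = (\<integral>y. \<phi> (x - h *\<^sub>R y) * (\<eta> (y + w) - \<eta> y - \<zeta> y \<bullet> w) \<partial>lborel)"
      unfolding 1 2 3 using i1 i2 i3 by (simp add: right_diff_distrib)
    also have "\<bar>\<dots>\<bar> \<le> (\<integral>y. B * (e' * norm w) * indicator (cball (0::'a) (\<bar>R\<bar> + 1)) y \<partial>lborel)"
    proof (rule integral_abs_bound_integral)
      show "integrable lborel (\<lambda>y. \<phi> (x - h *\<^sub>R y) * (\<eta> (y + w) - \<eta> y - \<zeta> y \<bullet> w))"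
        unfolding right_diff_distrib by (intro Bochner_Integration.integrable_diff i1 i2 i3)
      show "integrable lborel (\<lambda>y. B * (e' * norm w) * indicator (cball (0::'a) (\<bar>R\<bar> + 1)) y)"
        by (intro integrable_mult_right V)
      fix y
      have "\<bar>\<phi> (x - h *\<^sub>R y)\<bar> * \<bar>\<eta> (y + w) - \<eta> y - \<zeta> y \<bullet> w\<bar> \<le> B * (e' * norm w * indicator (cball 0 (\<bar>R\<bar> + 1)) y)"
        by (intro mult_mono B \<delta> w B0) simp
      then show "\<bar>\<phi> (x - h *\<^sub>R y) * (\<eta> (y + w) - \<eta> y - \<zeta> y \<bullet> w)\<bar> \<le> B * (e' * norm w) * indicator (cball (0::'a) (\<bar>R\<bar> + 1)) y"
        by (simp add: abs_mult mult.assoc)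
    qed
    also have "\<dots> = (B * V) * (e' / h) * norm v" by (simp add: V_def nw)
    also have "\<dots> \<le> (B * V + 1) * (e' / h) * norm v" using e' h by (intro mult_right_mono) auto
    also have "\<dots> = e * norm v" using BV h by (simp add: e'_def)
    finally show "norm (moll h z - moll h x - dmoll h x \<bullet> (z - x)) \<le> e * norm (z - x)"
      by (simp add: v_def)
  qed
qed

text \<open>Differentiability at the single point \<open>x\<close> is enough: the quotients in
  \<open>dmoll_diff\<close> converge to -(G . y) for each y, they are dominated through the
  Lipschitz bound, and \<open>integral_moment\<close> evaluates the limit.\<close>

lemma dmoll_tendsto:
  assumes \<phi>: "(\<phi> has_derivative (\<lambda>v. G \<bullet> v)) (at x)"
    and h: "\<And>n. h n > 0" "h \<longlonglongrightarrow> 0"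
  shows "(\<lambda>n. dmoll (h n) x) \<longlonglongrightarrow> G"
proof -
  have "(\<lambda>n. dmoll (h n) x) \<longlonglongrightarrow> (\<integral>y. (- (G \<bullet> y)) *\<^sub>R \<zeta> y \<partial>lborel)"
    unfolding dmoll_diff
  proof (rule integral_dominated_convergence[OF _ _ integrable_dom])
    show "AE y in lborel. (\<lambda>n. ((\<phi> (x - h n *\<^sub>R y) - \<phi> x) / h n) *\<^sub>R \<zeta> y) \<longlonglongrightarrow> (- (G \<bullet> y)) *\<^sub>R \<zeta> y"
    proof (intro AE_I2 tendsto_scaleR tendsto_const)
      fix y
      have "((\<lambda>t. x - t *\<^sub>R y) has_derivative (\<lambda>t. - (t *\<^sub>R y))) (at 0)"
        by (auto intro!: derivative_eq_intros)
      from diff_chain_at[OF this, of \<phi> "\<lambda>v. G \<bullet> v"] \<phi>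
      have "((\<lambda>t. \<phi> (x - t *\<^sub>R y)) has_derivative ((\<lambda>v. G \<bullet> v) \<circ> (\<lambda>t. - (t *\<^sub>R y)))) (at 0)"
        by (simp add: o_def)
      moreover have "((\<lambda>v. G \<bullet> v) \<circ> (\<lambda>t. - (t *\<^sub>R y))) = (*) (- (G \<bullet> y))"
        by (auto simp: fun_eq_iff)
      ultimately have "((\<lambda>t. \<phi> (x - t *\<^sub>R y)) has_derivative (*) (- (G \<bullet> y))) (at 0)" by simp
      then have "((\<lambda>t. \<phi> (x - t *\<^sub>R y)) has_real_derivative - (G \<bullet> y)) (at 0)"
        by (simp add: has_field_derivative_def)
      then have "((\<lambda>t. (\<phi> (x - t *\<^sub>R y) - \<phi> x) / t) \<longlongrightarrow> - (G \<bullet> y)) (at 0)"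
        by (simp add: DERIV_def)
      moreover have "filterlim h (at 0) sequentially"
        using h by (auto simp: filterlim_at less_imp_neq[symmetric])
      ultimately show "(\<lambda>n. (\<phi> (x - h n *\<^sub>R y) - \<phi> x) / h n) \<longlonglongrightarrow> - (G \<bullet> y)"
        by (rule filterlim_compose)
    qed
    show "AE y in lborel. norm (((\<phi> (x - h n *\<^sub>R y) - \<phi> x) / h n) *\<^sub>R \<zeta> y) \<le> L * (norm y * norm (\<zeta> y))" for n
      using quotient_bound[OF h(1)] by blast
    show "(\<lambda>y. (- (G \<bullet> y)) *\<^sub>R \<zeta> y) \<in> borel_measurable lborel"
      by (rule borel_measurable_integrable, intro integrable_scale_\<zeta> continuous_intros)
    show "(\<lambda>y. ((\<phi> (x - h n *\<^sub>R y) - \<phi> x) / h n) *\<^sub>R \<zeta> y) \<in> borel_measurable lborel" for n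
      by (rule borel_measurable_integrable, intro integrable_scale_\<zeta> continuous_intros cont_\<phi>_aff)
        (use h(1)[of n] in auto)
  qed
  also have "(\<integral>y. (- (G \<bullet> y)) *\<^sub>R \<zeta> y \<partial>lborel) = G"
    using integral_moment[of "- G"] by simp
  finally show ?thesis .
qed

end

end

lemma box_bump_Ck_c: "r > 0 \<Longrightarrow> cbox a c \<subseteq> U \<Longrightarrow> box_bump r a c \<in> Ck_c n U"
  using box_bump_Cinf_c Cinf_c_subset by blast

lemma mollifier_exists: "\<exists>\<eta> \<zeta> R. mollifier (\<eta> :: 'a::euclidean_space \<Rightarrow> real) \<zeta> R"
proof -
  define \<beta> :: "'a \<Rightarrow> real" where "\<beta> = box_bump 1 (- One) One"
  have "\<beta> \<in> Ck_c 1 UNIV" unfolding \<beta>_def by (rule box_bump_Ck_c) auto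
  then have \<beta>: "(\<beta> has_derivative (\<lambda>v. grad \<beta> x \<bullet> v)) (at x)" "continuous_on UNIV (grad \<beta>)" for x
    using Ck_c_1_iff[of \<beta> UNIV] by blast+
  obtain B where B: "\<And>x. x \<in> box (- One) (One :: 'a) \<Longrightarrow> norm x \<le> B"
    using bounded_box[of "- One" "One :: 'a"] by (auto simp: bounded_iff)
  interpret b: C1_bounded_support \<beta> "grad \<beta>" "\<bar>B\<bar> + 1"
    by unfold_locales (use \<beta> B in \<open>force simp: \<beta>_def box_bump_eq_0\<close>)+
  define m where "m = (\<integral>x. \<beta> x \<partial>lborel)"
  have "m \<ge> 0" unfolding m_def by (intro Bochner_Integration.integral_nonneg) (auto simp: \<beta>_def box_bump_range)
  moreover have "m \<noteq> 0"
  proof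
    assume "m = 0"
    then have "AE x in lborel. \<beta> x = 0"
      using b.integrable_f unfolding m_def
      by (subst (asm) integral_nonneg_eq_0_iff_AE) (auto simp: \<beta>_def box_bump_range)
    then have "AE x in lborel. x \<notin> box (- One) (One :: 'a)" by (simp add: \<beta>_def box_bump_eq_0)
    then have "emeasure lborel (box (- One) (One :: 'a)) = 0"
      by (subst (asm) AE_iff_measurable[OF _ refl]) auto
    moreover have "0 < (\<Prod>b\<in>Basis. (One + One :: 'a) \<bullet> b)" by (intro prod_pos) (simp add: inner_add_left)
    ultimately show False by (simp add: emeasure_lborel_box_eq ennreal_eq_0_iff split: if_splits)
  qed
  ultimately have m: "m > 0" by simp
  have "mollifier (\<lambda>x. \<beta> x / m) (\<lambda>x. (1 / m) *\<^sub>R grad \<beta> x) (\<bar>B\<bar> + 1)"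
  proof unfold_locales
    show "((\<lambda>x. \<beta> x / m) has_derivative (\<lambda>v. (1 / m) *\<^sub>R grad \<beta> x \<bullet> v)) (at x)" for x
      using m by (auto intro!: derivative_eq_intros \<beta>)
    show "0 \<le> \<beta> x / m" for x using m by (simp add: \<beta>_def box_bump_range)
  qed (use m b.supp in \<open>auto intro!: continuous_intros \<beta> simp: m_def[symmetric]\<close>)
  then show ?thesis by blast
qed

text \<open>One compact set \<open>T\<close> inside \<open>U\<close> and one bound \<open>C\<close>
  serve all approximants, which is what dominated convergence needs; the last property keeps
  approximants of nonnegative functions admissible in the superharmonicity assumption.\<close>

lemma lipschitz_C1_approximation:
  fixes \<phi> :: "'a::euclidean_space \<Rightarrow> real"
  assumes lip: "\<And>x y. \<bar>\<phi> x - \<phi> y\<bar> \<le> L * norm (x - y)"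
    and S: "compact S" "\<And>x. \<phi> x \<noteq> 0 \<Longrightarrow> x \<in> S" and U: "open U" "S \<subseteq> U"
  obtains f g T C where
    "\<And>n x. (f n has_derivative (\<lambda>v. g n x \<bullet> v)) (at x)" "\<And>n. continuous_on UNIV (g n)"
    "compact T" "T \<subseteq> U" "S \<subseteq> T" "\<And>n x. f n x \<noteq> 0 \<Longrightarrow> x \<in> T" "\<And>n x. g n x \<noteq> 0 \<Longrightarrow> x \<in> T"
    "\<And>n x. norm (g n x) \<le> C" "\<And>n x. \<bar>f n x\<bar> \<le> C"
    "\<And>x. (\<lambda>n. f n x) \<longlonglongrightarrow> \<phi> x"
    "\<And>x G. (\<phi> has_derivative (\<lambda>v. G \<bullet> v)) (at x) \<Longrightarrow> (\<lambda>n. g n x) \<longlonglongrightarrow> G"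
    "\<And>n x. (\<And>y. 0 \<le> \<phi> y) \<Longrightarrow> 0 \<le> f n x"
proof -
  obtain \<eta> \<zeta> R where "mollifier (\<eta> :: 'a \<Rightarrow> real) \<zeta> R" using mollifier_exists by blast
  then interpret mollifier \<eta> \<zeta> R .
  have cont: "continuous_on UNIV \<phi>" by (rule cont_\<phi>[OF lip])
  obtain B where B: "B > 0" "\<And>x. \<bar>\<phi> x\<bar> \<le> B"
  proof -
    have "bounded (\<phi> ` S)"
      using S cont by (intro compact_imp_bounded compact_continuous_image) (auto intro: continuous_on_subset)
    then obtain b where b: "\<And>x. x \<in> S \<Longrightarrow> \<bar>\<phi> x\<bar> \<le> b" by (auto simp: bounded_iff)
    have "\<bar>\<phi> x\<bar> \<le> \<bar>b\<bar> + 1" for x using b[of x] S(2)[of x] by fastforce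
    then show ?thesis by (intro that[of "\<bar>b\<bar> + 1"]) auto
  qed
  obtain e where e: "e > 0" "(\<Union>x\<in>S. ball x e) \<subseteq> U"
    using compact_subset_open_imp_ball_epsilon_subset[OF S(1) U] by blast
  define T where "T = (\<Union>x\<in>S. cball x (e / 2))"
  have T: "compact T" "T \<subseteq> U" "S \<subseteq> T"
  proof -
    show "compact T" unfolding T_def by (rule compact_minkowski_sum_cball[OF S(1)])
    show "T \<subseteq> U" using e by (force simp: T_def subset_iff)
    show "S \<subseteq> T" using e by (force simp: T_def)
  qed
  \<comment> \<open>Points move by at most R h, which stays below e/2, so all supports lie in the
    closed e/2-neighbourhood \<open>T\<close> of \<open>S\<close>.\<close>
  define h where "h n = e / (2 * R) * inverse (real (Suc n))" for n
  have h: "h n > 0" "R * h n \<le> e / 2" for n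
  proof -
    show "h n > 0" using e R by (simp add: h_def)
    have "e / 2 * inverse (real (Suc n)) \<le> e / 2 * 1"
      using e by (intro mult_left_mono) (auto simp: inverse_le_1_iff)
    then show "R * h n \<le> e / 2" using R by (simp add: h_def)
  qed
  have h0: "h \<longlonglongrightarrow> 0"
    unfolding h_def using tendsto_mult[OF tendsto_const[of "e / (2 * R)"] LIMSEQ_inverse_real_of_nat] by simp
  define f where "f n = moll \<phi> (h n)" for n
  define g where "g n = dmoll \<phi> (h n)" for n
  have d: "(f n has_derivative (\<lambda>v. g n x \<bullet> v)) (at x)" for n x
    unfolding f_def g_def by (rule moll_has_derivative[OF lip h(1) B(2)])
  have supp: "x \<in> T" if "f n x \<noteq> 0" for n x
  proof -
    have "\<exists>y. \<phi> (x - h n *\<^sub>R y) * \<eta> y \<noteq> 0"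
    proof (rule ccontr)
      assume "\<not> ?thesis"
      then have "f n x = (\<integral>y. 0 \<partial>(lborel :: 'a measure))" unfolding f_def moll_def[OF lip] by (intro Bochner_Integration.integral_cong) auto
      then show False using that by simp
    qed
    then obtain y where y: "\<phi> (x - h n *\<^sub>R y) \<noteq> 0" "\<eta> y \<noteq> 0" by auto
    have "dist (x - h n *\<^sub>R y) x = h n * norm y" using h(1)[of n] by (simp add: dist_norm)
    also have "\<dots> \<le> h n * R" using supp[OF y(2)] h(1)[of n] by (intro mult_left_mono) auto
    also have "\<dots> \<le> e / 2" using h(2)[of n] by (simp add: mult.commute)
    finally show ?thesis using S(2)[OF y(1)] unfolding T_def by (intro UN_I[of "x - h n *\<^sub>R y"] mem_cball[THEN iffD2])
  qed
  define C where "C = max (B + L * R * (e / (2 * R))) (\<integral>y. L * (norm y * norm (\<zeta> y)) \<partial>lborel)"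
  show ?thesis
  proof (rule that[of f g T C])
    show "g n x \<noteq> 0 \<Longrightarrow> x \<in> T" for n x
    proof -
      assume "g n x \<noteq> 0"
      then have "x \<in> closure {x. f n x \<noteq> 0}" using deriv_0_outside_support[OF d] by blast
      moreover have "closure {x. f n x \<noteq> 0} \<subseteq> T"
        using supp T by (intro closure_minimal) (auto intro: compact_imp_closed)
      ultimately show ?thesis by blast
    qed
    show "norm (g n x) \<le> C" for n x
      using norm_dmoll_le[OF lip h(1), of n x] by (simp add: g_def C_def)
    show "\<bar>f n x\<bar> \<le> C" for n x
    proof -
      have "\<bar>f n x - \<phi> x\<bar> \<le> L * (R * h n)" using moll_close[OF lip h(1), of n x] by (simp add: f_def mult.assoc)
      also have "\<dots> \<le> L * (e / 2)" using h(2) by (intro mult_left_mono L_nonneg[OF lip])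
      finally have "\<bar>f n x\<bar> \<le> B + L * (e / 2)" using B(2)[of x] by linarith
      then show ?thesis using R by (simp add: C_def)
    qed
    show "(\<lambda>n. f n x) \<longlonglongrightarrow> \<phi> x" for x
    proof (rule LIM_zero_cancel, rule Lim_null_comparison)
      show "\<forall>\<^sub>F n in sequentially. norm (f n x - \<phi> x) \<le> L * R * h n"
        using moll_close[OF lip h(1)] by (simp add: f_def)
    next
      show "(\<lambda>n. L * R * h n) \<longlonglongrightarrow> 0" using tendsto_mult[OF tendsto_const h0] by simp
    qed
    show "(\<phi> has_derivative (\<lambda>v. G \<bullet> v)) (at x) \<Longrightarrow> (\<lambda>n. g n x) \<longlonglongrightarrow> G" for x G
      unfolding g_def by (rule dmoll_tendsto[OF lip _ h(1) h0])
    show "0 \<le> f n x" if "\<And>y. 0 \<le> \<phi> y" for n x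
      unfolding f_def by (rule moll_nonneg[OF lip that])
  qed (use d supp T continuous_dmoll[OF lip] in \<open>auto simp: g_def\<close>)
qed

subsection \<open>Differentiability of the distance function\<close>

text \<open>Division by h and not by its square: the value is the forward minus the backward
  difference quotient. For convex \<open>f\<close> it decreases, as h tends to 0, to the jump of the
  one-sided derivatives along \<open>b\<close>.\<close>

definition second_diff :: "('a::real_vector \<Rightarrow> real) \<Rightarrow> 'a \<Rightarrow> real \<Rightarrow> 'a \<Rightarrow> real" where
  "second_diff f b h x = (f (x + h *\<^sub>R b) + f (x - h *\<^sub>R b) - 2 * f x) / h"

lemma second_diff_nonneg:
  assumes f: "convex_on UNIV f" and "h > 0"
  shows "0 \<le> second_diff f b h x"
proof -
  have "f ((1/2) *\<^sub>R (x + h *\<^sub>R b) + (1/2) *\<^sub>R (x - h *\<^sub>R b)) \<le> (1/2) * f (x + h *\<^sub>R b) + (1/2) * f (x - h *\<^sub>R b)"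
    using convex_onD[OF f, of "1/2" "x + h *\<^sub>R b" "x - h *\<^sub>R b"] by simp
  also have "(1/2) *\<^sub>R (x + h *\<^sub>R b) + (1/2) *\<^sub>R (x - h *\<^sub>R b) = x"
    by (simp add: scaleR_add_right scaleR_diff_right flip: scaleR_add_left)
  finally show ?thesis using assms by (simp add: second_diff_def)
qed

lemma second_diff_mono:
  assumes f: "convex_on UNIV f" and h: "0 < h" "h \<le> h'"
  shows "second_diff f b h x \<le> second_diff f b h' x"
proof -
  define t where "t = h / h'"
  have t: "0 \<le> t" "t \<le> 1" "t * h' = h" using h by (auto simp: t_def)
  have *: "f (x + h *\<^sub>R c) \<le> (1 - t) * f x + t * f (x + h' *\<^sub>R c)" for c
  proof -
    have "f ((1 - t) *\<^sub>R x + t *\<^sub>R (x + h' *\<^sub>R c)) \<le> (1 - t) * f x + t * f (x + h' *\<^sub>R c)"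
      using f t by (intro convex_onD) auto
    moreover have "(1 - t) *\<^sub>R x + t *\<^sub>R (x + h' *\<^sub>R c) = x + h *\<^sub>R c"
      using t(3) by (simp add: algebra_simps)
    ultimately show ?thesis by simp
  qed
  have "f (x + h *\<^sub>R b) + f (x - h *\<^sub>R b) - 2 * f x \<le> t * (f (x + h' *\<^sub>R b) + f (x - h' *\<^sub>R b) - 2 * f x)"
    using *[of b] *[of "- b"] by (simp add: algebra_simps)
  then show ?thesis using h by (simp add: second_diff_def t_def field_simps)
qed

text \<open>A translation moves the second difference from \<open>f\<close> to a bump \<open>\<psi>\<close>, where it is \<open>o(h)\<close>;
  hence the mean of the nonnegative second differences of \<open>f\<close>, weighted by \<open>\<psi>\<close>, tends to \<open>0\<close>.\<close>
lemma AE_second_diff_small: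
  fixes f :: "'a::euclidean_space \<Rightarrow> real"
  assumes f: "convex_on UNIV f" "continuous_on UNIV f"
  shows "AE x in lborel. \<forall>e>0. \<exists>\<delta>>0. \<forall>h. 0 < h \<and> h \<le> \<delta> \<longrightarrow> second_diff f b h x \<le> e"
proof -
  define H where "H n = inverse (real (Suc n))" for n
  have H: "H n > 0" for n by (simp add: H_def)
  \<comment> \<open>The claim is localised to boxes, on each of which a bump is positive; countably
    many boxes cover the space.\<close>
  have "AE x in lborel. x \<in> box (- (real r *\<^sub>R One)) (real r *\<^sub>R One) \<longrightarrow>
      (\<forall>e>0. \<exists>\<delta>>0. \<forall>h. 0 < h \<and> h \<le> \<delta> \<longrightarrow> second_diff f b h x \<le> e)" for r
  proof -
    define \<psi> where "\<psi> = box_bump 1 (- (real r *\<^sub>R One)) (real r *\<^sub>R One :: 'a)"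
    have \<psi>0: "0 \<le> \<psi> x" for x by (simp add: \<psi>_def box_bump_range)
    have "\<psi> \<in> Ck_c 1 UNIV" unfolding \<psi>_def by (rule box_bump_Ck_c) auto
    then have \<psi>: "\<And>x. (\<psi> has_derivative (\<lambda>v. grad \<psi> x \<bullet> v)) (at x)" "continuous_on UNIV (grad \<psi>)"
      using Ck_c_1_iff[of \<psi> UNIV] by blast+
    obtain R where R: "\<And>x. x \<in> box (- (real r *\<^sub>R One)) (real r *\<^sub>R One :: 'a) \<Longrightarrow> norm x \<le> R"
      using bounded_box by (meson bounded_iff)
    interpret C1_bounded_support \<psi> "grad \<psi>" R
      by unfold_locales (use \<psi> R in \<open>auto simp: \<psi>_def box_bump_eq_0\<close>)
    define I where "I = (\<integral>x. \<bar>f x\<bar> * indicator (cball (0::'a) (\<bar>R\<bar> + 1)) x \<partial>lborel)"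
    have I: "integrable lborel (\<lambda>x. \<bar>f x\<bar> * indicator (cball (0::'a) (\<bar>R\<bar> + 1)) x)"
    proof -
      have "integrable lborel (\<lambda>x. indicator (cball (0::'a) (\<bar>R\<bar> + 1)) x *\<^sub>R \<bar>f x\<bar>)"
        using f(2) by (intro borel_integrable_compact continuous_intros) (auto intro: continuous_on_subset)
      then show ?thesis by (simp add: mult.commute)
    qed
    have cs: "continuous_on UNIV (\<lambda>x. f (x + w))" for w
      by (rule continuous_on_compose2[OF f(2)]) (auto intro!: continuous_intros)
    have c\<psi>: "continuous_on UNIV (\<lambda>x. \<psi> (x + w))" for w
      by (rule continuous_on_compose2[OF cont_f]) (auto intro!: continuous_intros)
    have int1: "integrable lborel (\<lambda>x. \<psi> x * f (x + w))" for w
      by (rule integrable_cont_bounded_support)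
        (auto intro!: continuous_intros cont_f cs bounded_subset[OF bounded_supp(1)])
    have int2: "integrable lborel (\<lambda>x. \<psi> (x + w) * f x)" for w
    proof (rule integrable_cont_bounded_support)
      have "norm x \<le> R + norm w" if "\<psi> (x + w) \<noteq> 0" for x
        using supp[OF that] norm_triangle_ineq4[of "x + w" w] by simp
      then show "bounded {x. \<psi> (x + w) * f x \<noteq> 0}" by (auto simp: bounded_iff intro!: exI[of _ "R + norm w"])
    qed (auto intro!: continuous_intros f c\<psi>)
    have shift: "(\<integral>x. \<psi> x * f (x + w) \<partial>lborel) = (\<integral>x. \<psi> (x - w) * f x \<partial>lborel)" for w
      using lborel_integral_shift[of "\<lambda>x. \<psi> (x - w) * f x" w]
      using borel_measurable_integrable[OF int2[of "-w"]] by simp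
    define J where "J h = (\<integral>x. \<psi> x * second_diff f b h x \<partial>lborel)" for h
    have intJ: "integrable lborel (\<lambda>x. \<psi> x * second_diff f b h x)" for h
    proof -
      have "(\<lambda>x. \<psi> x * second_diff f b h x) = (\<lambda>x. (\<psi> x * f (x + h *\<^sub>R b) + \<psi> x * f (x + (- h) *\<^sub>R b) - 2 * (\<psi> x * f (x + 0))) / h)"
        by (auto simp: second_diff_def algebra_simps fun_eq_iff diff_divide_distrib)
      then show ?thesis using int1[of "h *\<^sub>R b"] int1[of "- (h *\<^sub>R b)"] int1[of 0] by simp
    qed
    have Jlim: "\<exists>\<delta>>0. \<forall>h. 0 < h \<and> h \<le> \<delta> \<longrightarrow> J h \<le> e" if e: "e > 0" for e
    proof -
      define e' where "e' = e / (2 * (norm b + 1) * (I + 1))"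
      have I0: "0 \<le> I" by (simp add: I_def)
      have e': "e' > 0" using e I0 by (simp add: e'_def add_nonneg_pos)
      obtain \<delta> where \<delta>: "\<delta> > 0" "\<And>y w. norm w \<le> \<delta> \<Longrightarrow> \<bar>\<psi> (y + w) - \<psi> y - grad \<psi> y \<bullet> w\<bar> \<le> e' * norm w * indicator (cball 0 (\<bar>R\<bar> + 1)) y"
        using uniform_deriv[OF e'] by metis
      show ?thesis
      proof (intro exI[of _ "\<delta> / (norm b + 1)"] conjI allI impI)
        show "0 < \<delta> / (norm b + 1)" using \<delta> by (simp add: add_nonneg_pos)
        fix h assume h: "0 < h \<and> h \<le> \<delta> / (norm b + 1)"
        have "h * norm b \<le> h * (norm b + 1)" using h by auto
        also have "\<dots> \<le> \<delta>" using h by (simp add: pos_le_divide_eq add_nonneg_pos)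
        finally have w: "norm (h *\<^sub>R b) \<le> \<delta>" "norm (- (h *\<^sub>R b)) \<le> \<delta>" using h by auto
        have "J h = ((\<integral>x. \<psi> x * f (x + h *\<^sub>R b) \<partial>lborel) + (\<integral>x. \<psi> x * f (x + (- h) *\<^sub>R b) \<partial>lborel) - 2 * (\<integral>x. \<psi> x * f (x + 0) \<partial>lborel)) / h"
        proof -
          have "J h = (\<integral>x. (\<psi> x * f (x + h *\<^sub>R b) + \<psi> x * f (x + (- h) *\<^sub>R b) - 2 * (\<psi> x * f (x + 0))) / h \<partial>lborel)"
            unfolding J_def by (rule Bochner_Integration.integral_cong) (auto simp: second_diff_def algebra_simps diff_divide_distrib)
          then show ?thesis using int1[of "h *\<^sub>R b"] int1[of "(- h) *\<^sub>R b"] int1[of 0] by simp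
        qed
        also have "\<dots> = (\<integral>x. (\<psi> (x - h *\<^sub>R b) * f x + \<psi> (x + h *\<^sub>R b) * f x - 2 * (\<psi> x * f x)) / h \<partial>lborel)"
          unfolding shift using int2[of "- (h *\<^sub>R b)"] int2[of "h *\<^sub>R b"] int2[of 0] by simp
        also have "\<dots> \<le> (\<integral>x. 2 * e' * norm b * (\<bar>f x\<bar> * indicator (cball (0::'a) (\<bar>R\<bar> + 1)) x) \<partial>lborel)"
        proof (rule Bochner_Integration.integral_mono)
          show "integrable lborel (\<lambda>x. (\<psi> (x - h *\<^sub>R b) * f x + \<psi> (x + h *\<^sub>R b) * f x - 2 * (\<psi> x * f x)) / h)"
            using int2[of "- (h *\<^sub>R b)"] int2[of "h *\<^sub>R b"] int2[of 0] by simp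
          show "integrable lborel (\<lambda>x. 2 * e' * norm b * (\<bar>f x\<bar> * indicator (cball (0::'a) (\<bar>R\<bar> + 1)) x))"
            by (intro integrable_mult_right I)
          fix x
          let ?i = "indicator (cball (0::'a) (\<bar>R\<bar> + 1)) x :: real"
          \<comment> \<open>The linear Taylor terms for the increments h b and -h b cancel, leaving
            twice the Taylor error.\<close>
          have "\<bar>\<psi> (x - h *\<^sub>R b) + \<psi> (x + h *\<^sub>R b) - 2 * \<psi> x\<bar> \<le> 2 * (e' * norm (h *\<^sub>R b) * ?i)"
            using \<delta>(2)[OF w(1), of x] \<delta>(2)[OF w(2), of x] by simp
          then have "\<bar>f x\<bar> * \<bar>\<psi> (x - h *\<^sub>R b) + \<psi> (x + h *\<^sub>R b) - 2 * \<psi> x\<bar> \<le> \<bar>f x\<bar> * (2 * (e' * norm (h *\<^sub>R b) * ?i))"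
            by (rule mult_left_mono) simp
          then have "f x * (\<psi> (x - h *\<^sub>R b) + \<psi> (x + h *\<^sub>R b) - 2 * \<psi> x) \<le> h * (2 * e' * norm b * (\<bar>f x\<bar> * ?i))"
            using h abs_ge_self[of "f x * (\<psi> (x - h *\<^sub>R b) + \<psi> (x + h *\<^sub>R b) - 2 * \<psi> x)"]
            by (simp add: abs_mult ac_simps)
          then show "(\<psi> (x - h *\<^sub>R b) * f x + \<psi> (x + h *\<^sub>R b) * f x - 2 * (\<psi> x * f x)) / h \<le> 2 * e' * norm b * (\<bar>f x\<bar> * ?i)"
            using h by (simp add: pos_divide_le_eq algebra_simps)
        qed
        also have "\<dots> = 2 * e' * norm b * I" by (simp add: I_def)
        also have "\<dots> \<le> 2 * e' * (norm b + 1) * (I + 1)" using e' I0 by (intro mult_mono) auto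
        also have "\<dots> = e"
        proof -
          have *: "2 * (e / (2 * c * i)) * c * i = e" if "0 < c" "0 < i" for c i :: real using that by simp
          have "0 < norm b + 1" "0 < I + 1" using I0 norm_ge_zero[of b] by linarith+
          from *[OF this] show ?thesis unfolding e'_def .
        qed
        finally show "J h \<le> e" .
      qed
    qed
    have "(\<integral>\<^sup>+x. (INF n. ennreal (\<psi> x * second_diff f b (H n) x)) \<partial>lborel) \<le> ennreal e" if e: "e > 0" for e
    proof -
      obtain \<delta> where \<delta>: "\<delta> > 0" "\<And>h. 0 < h \<and> h \<le> \<delta> \<Longrightarrow> J h \<le> e" using Jlim[OF e] by blast
      obtain n where n: "H n < \<delta>" using reals_Archimedean[OF \<delta>(1)] by (auto simp: H_def)
      have "(\<integral>\<^sup>+x. (INF n. ennreal (\<psi> x * second_diff f b (H n) x)) \<partial>lborel) \<le> (\<integral>\<^sup>+x. ennreal (\<psi> x * second_diff f b (H n) x) \<partial>lborel)"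
        by (intro nn_integral_mono INF_lower) simp
      also have "\<dots> = ennreal (J (H n))" unfolding J_def
        using \<psi>0 second_diff_nonneg[OF f(1) H] by (intro nn_integral_eq_integral[OF intJ]) auto
      also have "\<dots> \<le> ennreal e" using n H[of n] \<delta>(2)[of "H n"] by (auto intro!: ennreal_leI)
      finally show ?thesis .
    qed
    then have le0: "(\<integral>\<^sup>+x. (INF n. ennreal (\<psi> x * second_diff f b (H n) x)) \<partial>lborel) \<le> 0"
      using ennreal_le_epsilon[of 0 "\<integral>\<^sup>+x. (INF n. ennreal (\<psi> x * second_diff f b (H n) x)) \<partial>lborel"] by simp
    \<comment> \<open>It suffices that the infimum along the sequence \<open>H\<close> vanishes.
      Where the bump is positive it yields one \<open>H n\<close> with small second difference, and
      \<open>second_diff_mono\<close> carries the bound to all smaller h.\<close>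
    have "AE x in lborel. (INF n. ennreal (\<psi> x * second_diff f b (H n) x)) = 0"
    proof -
      have [measurable]: "(\<lambda>x. \<psi> x * second_diff f b (H n) x) \<in> borel_measurable lborel" for n
        using intJ by (rule borel_measurable_integrable)
      have "(\<lambda>x. INF n. ennreal (\<psi> x * second_diff f b (H n) x)) \<in> borel_measurable lborel"
        by (intro borel_measurable_INF measurable_compose[OF _ measurable_ennreal]) auto
      then show ?thesis using le0 by (simp add: nn_integral_0_iff_AE)
    qed
    then show ?thesis
    proof eventually_elim
      fix x assume 0: "(INF n. ennreal (\<psi> x * second_diff f b (H n) x)) = 0"
      show "x \<in> box (- (real r *\<^sub>R One)) (real r *\<^sub>R One) \<longrightarrow>
        (\<forall>e>0. \<exists>\<delta>>0. \<forall>h. 0 < h \<and> h \<le> \<delta> \<longrightarrow> second_diff f b h x \<le> e)"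
      proof (intro impI allI)
        fix e :: real assume "x \<in> box (- (real r *\<^sub>R One)) (real r *\<^sub>R One)" and e: "e > 0"
        then have \<psi>x: "\<psi> x > 0" using \<psi>0[of x] box_bump_eq_0[of 1 _ _ x] by (auto simp: \<psi>_def less_le)
        have "(INF n. ennreal (\<psi> x * second_diff f b (H n) x)) < ennreal (\<psi> x * e)" using 0 \<psi>x e by simp
        then obtain n where "ennreal (\<psi> x * second_diff f b (H n) x) < ennreal (\<psi> x * e)" by (auto simp: INF_less_iff)
        then have n: "second_diff f b (H n) x < e" using \<psi>x
          by (subst (asm) ennreal_less_iff) (auto intro!: mult_nonneg_nonneg second_diff_nonneg f H)
        show "\<exists>\<delta>>0. \<forall>h. 0 < h \<and> h \<le> \<delta> \<longrightarrow> second_diff f b h x \<le> e"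
        proof (intro exI[of _ "H n"] conjI allI impI H)
          fix h assume "0 < h \<and> h \<le> H n"
          then show "second_diff f b h x \<le> e"
            using second_diff_mono[OF f(1), of h "H n" b x] n by linarith
        qed
      qed
    qed
  qed
  then have "AE x in lborel. \<forall>r. x \<in> box (- (real r *\<^sub>R One)) (real r *\<^sub>R One) \<longrightarrow>
      (\<forall>e>0. \<exists>\<delta>>0. \<forall>h. 0 < h \<and> h \<le> \<delta> \<longrightarrow> second_diff f b h x \<le> e)"
    by (subst AE_all_countable) blast
  then show ?thesis
  proof eventually_elim
    fix x :: 'a
    assume A: "\<forall>r. x \<in> box (- (real r *\<^sub>R One)) (real r *\<^sub>R One) \<longrightarrow>
      (\<forall>e>0. \<exists>\<delta>>0. \<forall>h. 0 < h \<and> h \<le> \<delta> \<longrightarrow> second_diff f b h x \<le> e)"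
    obtain r :: nat where r: "norm x < real r" using reals_Archimedean2 by blast
    have "x \<in> box (- (real r *\<^sub>R One)) (real r *\<^sub>R One)"
      unfolding mem_box
    proof
      fix i :: 'a assume i: "i \<in> Basis"
      then show "- (real r *\<^sub>R One) \<bullet> i < x \<bullet> i \<and> x \<bullet> i < (real r *\<^sub>R One) \<bullet> i"
        using Basis_le_norm[OF i, of x] r by auto
    qed
    with A show "\<forall>e>0. \<exists>\<delta>>0. \<forall>h. 0 < h \<and> h \<le> \<delta> \<longrightarrow> second_diff f b h x \<le> e" by blast
  qed
qed

text \<open>The affine minorant at the convex combination is evaluated at both end points; in the
  weighted sum its linear part cancels.\<close>

lemma convex_on_of_subgradients:
  fixes f :: "'a::real_inner \<Rightarrow> real"
  assumes "\<And>x. \<exists>g. \<forall>z. f z \<ge> f x + g \<bullet> (z - x)"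
  shows "convex_on UNIV f"
proof (rule convex_onI)
  fix t :: real and u v :: 'a
  assume t: "0 < t" "t < 1"
  define w where "w = (1 - t) *\<^sub>R u + t *\<^sub>R v"
  obtain g where g: "\<And>z. f z \<ge> f w + g \<bullet> (z - w)" using assms by blast
  have "(1 - t) * (f w + g \<bullet> (u - w)) \<le> (1 - t) * f u" "t * (f w + g \<bullet> (v - w)) \<le> t * f v"
    using t g by (auto intro!: mult_left_mono)
  moreover have "(1 - t) * (g \<bullet> (u - w)) + t * (g \<bullet> (v - w)) = g \<bullet> ((1 - t) *\<^sub>R (u - w) + t *\<^sub>R (v - w))"
    by (simp add: inner_add_right)
  moreover have "(1 - t) *\<^sub>R (u - w) + t *\<^sub>R (v - w) = 0" by (simp add: w_def algebra_simps)
  ultimately show "f ((1 - t) *\<^sub>R u + t *\<^sub>R v) \<le> (1 - t) * f u + t * f v"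
    unfolding w_def[symmetric] by (simp add: distrib_left) (simp add: algebra_simps)
qed auto

text \<open>The coordinate directions suffice. On an axis, the excesses of \<open>f\<close> over the
  affine minorant on the two sides are nonnegative and have a small sum, so each is small. A general
  x + v is the mean of the N axis points x + N (v . b) b, and convexity transfers the upper bound;
  the minorant itself is the lower bound.\<close>

lemma convex_differentiable_of_second_diff:
  fixes f :: "'a::euclidean_space \<Rightarrow> real"
  assumes f: "convex_on UNIV f" and g: "\<And>z. f z \<ge> f x + g \<bullet> (z - x)"
    and sd: "\<And>b e. b \<in> Basis \<Longrightarrow> e > 0 \<Longrightarrow> \<exists>\<delta>>0. \<forall>h. 0 < h \<and> h \<le> \<delta> \<longrightarrow> second_diff f b h x \<le> e"
  shows "(f has_derivative (\<lambda>v. g \<bullet> v)) (at x)"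
  unfolding has_derivative_at_alt
proof (intro conjI allI impI)
  show "bounded_linear (\<lambda>v. g \<bullet> v)" by (rule bounded_linear_inner_right)
  fix e :: real assume e: "e > 0"
  define N where "N = real DIM('a)"
  have N: "N > 0" by (simp add: N_def)
  have "\<forall>b\<in>Basis. \<exists>\<delta>>0. \<forall>h. 0 < h \<and> h \<le> \<delta> \<longrightarrow> second_diff f b h x \<le> e / N" using sd e N by simp
  then obtain \<delta>' where \<delta>': "\<And>b. b \<in> Basis \<Longrightarrow> \<delta>' b > 0"
    "\<And>b h. b \<in> Basis \<Longrightarrow> 0 < h \<Longrightarrow> h \<le> \<delta>' b \<Longrightarrow> second_diff f b h x \<le> e / N" by metis
  define \<delta> where "\<delta> = Min (\<delta>' ` (Basis :: 'a set))"
  have \<delta>: "\<delta> > 0" "\<And>b. b \<in> Basis \<Longrightarrow> \<delta> \<le> \<delta>' b" using \<delta>' by (auto simp: \<delta>_def)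
  have line: "f (x + t *\<^sub>R b) \<le> f x + t * (g \<bullet> b) + e / N * \<bar>t\<bar>" if b: "b \<in> Basis" and t: "\<bar>t\<bar> \<le> \<delta>" for b t
  proof (cases "t = 0")
    case False
    define h where "h = \<bar>t\<bar>"
    have h: "0 < h" "h \<le> \<delta>' b" using False t \<delta>(2)[OF b] by (auto simp: h_def)
    have "f (x + h *\<^sub>R b) + f (x - h *\<^sub>R b) - 2 * f x \<le> e / N * h"
      using \<delta>'(2)[OF b h] h by (simp add: second_diff_def pos_divide_le_eq)
    moreover have "f (x + h *\<^sub>R b) \<ge> f x + h * (g \<bullet> b)" "f (x - h *\<^sub>R b) \<ge> f x - h * (g \<bullet> b)"
      using g[of "x + h *\<^sub>R b"] g[of "x - h *\<^sub>R b"] by auto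
    ultimately show ?thesis by (cases "t > 0") (auto simp: h_def)
  qed simp
  show "\<exists>d>0. \<forall>y. norm (y - x) < d \<longrightarrow> norm (f y - f x - g \<bullet> (y - x)) \<le> e * norm (y - x)"
  proof (intro exI[of _ "\<delta> / N"] conjI allI impI)
    show "0 < \<delta> / N" using \<delta> N by simp
    fix y assume y: "norm (y - x) < \<delta> / N"
    define v where "v = y - x"
    have vb: "\<bar>N * (v \<bullet> b)\<bar> \<le> \<delta>" if "b \<in> Basis" for b
    proof -
      have "N * \<bar>v \<bullet> b\<bar> \<le> N * (\<delta> / N)" using y N Basis_le_norm[OF that, of v] by (intro mult_left_mono) (auto simp: v_def)
      then show ?thesis using N by (simp add: abs_mult)
    qed
    have "y = (\<Sum>b\<in>Basis. (1 / N) *\<^sub>R (x + (N * (v \<bullet> b)) *\<^sub>R b))"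
    proof -
      have "(\<Sum>b\<in>Basis. (1 / N) *\<^sub>R (x + (N * (v \<bullet> b)) *\<^sub>R b)) = (\<Sum>b\<in>(Basis::'a set). (1 / N) *\<^sub>R x) + (\<Sum>b\<in>Basis. (v \<bullet> b) *\<^sub>R b)"
        using N by (simp add: scaleR_add_right sum.distrib)
      also have "\<dots> = x + v" using N by (simp add: euclidean_representation sum_constant_scaleR N_def)
      finally show ?thesis by (simp add: v_def)
    qed
    then have "f y = f (\<Sum>b\<in>Basis. (1 / N) *\<^sub>R (x + (N * (v \<bullet> b)) *\<^sub>R b))" by simp
    also have "\<dots> \<le> (\<Sum>b\<in>Basis. (1 / N) * f (x + (N * (v \<bullet> b)) *\<^sub>R b))"
      by (rule convex_on_sum[OF _ _ f]) (use N in \<open>auto simp: N_def\<close>)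
    also have "\<dots> \<le> (\<Sum>b\<in>Basis. (1 / N) * (f x + (N * (v \<bullet> b)) * (g \<bullet> b) + e / N * \<bar>N * (v \<bullet> b)\<bar>))"
      using N by (intro sum_mono mult_left_mono line vb) auto
    also have "\<dots> = (\<Sum>b\<in>Basis. (1 / N) * f x + (v \<bullet> b) * (g \<bullet> b) + e / N * \<bar>v \<bullet> b\<bar>)"
      using N by (intro sum.cong) (auto simp: field_simps abs_mult)
    also have "\<dots> = f x + g \<bullet> v + e / N * (\<Sum>b\<in>Basis. \<bar>v \<bullet> b\<bar>)"
      using N by (simp add: sum.distrib sum_distrib_left N_def euclidean_inner[of g v] mult.commute)
    also have "\<dots> \<le> f x + g \<bullet> v + e / N * (N * norm v)"
      using e N sum_bounded_above[of "Basis :: 'a set" "\<lambda>b. \<bar>v \<bullet> b\<bar>" "norm v"] Basis_le_norm[of _ v]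
      by (intro add_left_mono mult_left_mono) (auto simp: N_def)
    finally have "f y - f x - g \<bullet> v \<le> e * norm v" using N by simp
    moreover have "f y - f x - g \<bullet> v \<ge> 0" using g[of y] by (simp add: v_def)
    ultimately show "norm (f y - f x - g \<bullet> (y - x)) \<le> e * norm (y - x)" by (simp add: v_def)
  qed
qed

lemma infdist_lipschitz: "\<bar>infdist x K - infdist y K\<bar> \<le> norm (x - y)"
  using infdist_triangle_abs[of x K y] by (simp add: dist_norm)

text \<open>Since |x|^2 - d^2 is the supremum over y in \<open>K\<close> of the affine functions 2 x
  . y - |y|^2, it is convex, with subgradient 2 y at x when y is a nearest point. Off
  \<open>K\<close> the square root recovers d.\<close>

lemma AE_infdist_differentiable:
  fixes K :: "'a::euclidean_space set"
  assumes K: "closed K" "K \<noteq> {}"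
  shows "AE x in lborel. x \<notin> K \<longrightarrow> ((\<lambda>y. infdist y K) has_derivative (\<lambda>v. grad (\<lambda>y. infdist y K) x \<bullet> v)) (at x)
    \<and> norm (grad (\<lambda>y. infdist y K) x) = 1"
proof -
  define d where "d x = infdist x K" for x
  define f where "f x = x \<bullet> x - (d x)\<^sup>2" for x
  have near: "\<exists>y\<in>K. d x = norm (x - y)" for x
    using infdist_attains_inf[OF K, of x] by (auto simp: d_def dist_norm)
  have sub: "f z \<ge> f x + (2 *\<^sub>R y) \<bullet> (z - x)" if y: "y \<in> K" "d x = norm (x - y)" for x y z
  proof -
    have "d z \<le> norm (z - y)" using infdist_le[OF y(1), of z] by (simp add: d_def dist_norm)
    then have "(d z)\<^sup>2 \<le> (z - y) \<bullet> (z - y)"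
      by (metis d_def infdist_nonneg power_mono power2_norm_eq_inner)
    moreover have "(d x)\<^sup>2 = (x - y) \<bullet> (x - y)" using y by (simp add: power2_norm_eq_inner)
    ultimately show ?thesis by (simp add: f_def inner_diff_left inner_diff_right inner_commute)
  qed
  have conv: "convex_on UNIV f"
    by (rule convex_on_of_subgradients) (use near sub in blast)
  have "continuous_on UNIV f" unfolding f_def d_def by (intro continuous_intros)
  then have "AE x in lborel. \<forall>e>0. \<exists>\<delta>>0. \<forall>h. 0 < h \<and> h \<le> \<delta> \<longrightarrow> second_diff f b h x \<le> e" for b
    by (rule AE_second_diff_small[OF conv])
  then have "AE x in lborel. \<forall>b\<in>Basis. \<forall>e>0. \<exists>\<delta>>0. \<forall>h. 0 < h \<and> h \<le> \<delta> \<longrightarrow> second_diff f b h x \<le> e"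
    by (subst AE_finite_all) auto
  then show ?thesis unfolding d_def[symmetric]
  proof eventually_elim
    fix x assume A: "\<forall>b\<in>Basis. \<forall>e>0. \<exists>\<delta>>0. \<forall>h. 0 < h \<and> h \<le> \<delta> \<longrightarrow> second_diff f b h x \<le> e"
    show "x \<notin> K \<longrightarrow> (d has_derivative (\<lambda>v. grad d x \<bullet> v)) (at x) \<and> norm (grad d x) = 1"
    proof
      assume x: "x \<notin> K"
      obtain y where y: "y \<in> K" "d x = norm (x - y)" using near by blast
      have dx: "d x > 0" using x K y by auto
      \<comment> \<open>The gradient of \<open>f\<close> is the subgradient 2 y, hence that of d is
        (x - y) / d, a unit vector.\<close>
      have fd: "(f has_derivative (\<lambda>v. (2 *\<^sub>R y) \<bullet> v)) (at x)"
        by (rule convex_differentiable_of_second_diff[OF conv]) (use A sub[OF y] in auto)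
      have pos: "0 < x \<bullet> x - f x" using dx by (simp add: f_def)
      have "((\<lambda>z. sqrt (z \<bullet> z - f z)) has_derivative (\<lambda>v. ((1 / d x) *\<^sub>R (x - y)) \<bullet> v)) (at x)"
      proof -
        have val: "sqrt (x \<bullet> x - f x) = d x" using dx by (simp add: f_def)
        have "((\<lambda>z. sqrt (z \<bullet> z - f z)) has_derivative (\<lambda>v. (v \<bullet> x + x \<bullet> v - (2 *\<^sub>R y) \<bullet> v) * (inverse (sqrt (x \<bullet> x - f x)) / 2))) (at x)"
          by (auto intro!: derivative_eq_intros fd pos)
        moreover have "(\<lambda>v. (v \<bullet> x + x \<bullet> v - (2 *\<^sub>R y) \<bullet> v) * (inverse (sqrt (x \<bullet> x - f x)) / 2)) = (\<lambda>v. ((1 / d x) *\<^sub>R (x - y)) \<bullet> v)"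
          unfolding val using dx
          by (simp only: fun_eq_iff inner_scaleR_left inner_diff_left) (simp add: inner_commute field_simps)
        ultimately show ?thesis by simp
      qed
      moreover have "(\<lambda>z. sqrt (z \<bullet> z - f z)) = d" by (auto simp: f_def d_def infdist_nonneg)
      ultimately have D: "(d has_derivative (\<lambda>v. ((1 / d x) *\<^sub>R (x - y)) \<bullet> v)) (at x)" by simp
      show "(d has_derivative (\<lambda>v. grad d x \<bullet> v)) (at x) \<and> norm (grad d x) = 1"
        using D y dx unfolding grad_eqI[OF D] by simp
    qed
  qed
qed

subsection \<open>Lipschitz functions\<close>

lemma cont_lebesgue_measurable:
  "continuous_on UNIV f \<Longrightarrow> f \<in> borel_measurable lebesgue"
  by (rule measurable_completion) (unfold measurable_lborel2, rule borel_measurable_continuous_onI)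

text \<open>The exceptional null set is cut out by an indicator and put back by completeness of
  Lebesgue measure.\<close>

lemma borel_measurable_AE_LIMSEQ:
  fixes f :: "'a::euclidean_space \<Rightarrow> 'b::euclidean_space"
  assumes s: "\<And>n. s n \<in> borel_measurable lebesgue"
    and lim: "AE x in lebesgue. (\<lambda>n. s n x) \<longlonglongrightarrow> f x"
  shows "f \<in> borel_measurable lebesgue"
proof -
  obtain N where N: "N \<in> null_sets lebesgue" "\<And>x. x \<notin> N \<Longrightarrow> (\<lambda>n. s n x) \<longlonglongrightarrow> f x"
    using lim unfolding completion.AE_iff_null_sets by auto
  have "(\<lambda>x. indicator (- N) x *\<^sub>R f x) \<in> borel_measurable lebesgue"
  proof (rule borel_measurable_LIMSEQ_metric)
    show "(\<lambda>x. indicator (- N) x *\<^sub>R s n x) \<in> borel_measurable lebesgue" for n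
      by (intro borel_measurable_scaleR s borel_measurable_indicator) (use N(1) in \<open>auto simp: Compl_in_sets_lebesgue\<close>)
    show "(\<lambda>n. indicator (- N) x *\<^sub>R s n x) \<longlonglongrightarrow> indicator (- N) x *\<^sub>R f x" for x
      using N(2)[of x] by (cases "x \<in> N") simp_all
  qed
  moreover have "AE x in lebesgue. indicator (- N) x *\<^sub>R f x = f x"
    using AE_not_in[OF N(1)] by eventually_elim auto
  ultimately show ?thesis by (rule borel_measurable_AE)
qed

text \<open>Each component is an almost everywhere limit of difference quotients of a continuous
  function. The values of \<open>\<gamma>\<close> on the exceptional set are arbitrary, as those of
  \<open>grad\<close> are.\<close>

lemma AE_gradient_measurable:
  fixes f :: "'a::euclidean_space \<Rightarrow> real"
  assumes f: "continuous_on UNIV f" and D: "AE x in lebesgue. (f has_derivative (\<lambda>v. \<gamma> x \<bullet> v)) (at x)"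
  shows "\<gamma> \<in> borel_measurable lebesgue"
proof (rule borel_measurable_euclidean_space[THEN iffD2], rule ballI)
  fix b :: 'a assume "b \<in> Basis"
  define s where "s n x = (f (x + inverse (real (Suc n)) *\<^sub>R b) - f x) / inverse (real (Suc n))" for n x
  have s: "s n \<in> borel_measurable lebesgue" for n
  proof -
    have "continuous_on UNIV (\<lambda>x. f (x + c))" for c
      by (rule continuous_on_compose2[OF f]) (auto intro!: continuous_intros)
    note c = this[of "inverse (real (Suc n)) *\<^sub>R b"]
    have "continuous_on UNIV (s n)" unfolding s_def[abs_def]
      by (rule continuous_on_divide[OF continuous_on_diff[OF c f] continuous_on_const]) simp
    then show ?thesis by (rule cont_lebesgue_measurable)
  qed
  have lim: "(\<lambda>n. s n x) \<longlonglongrightarrow> \<gamma> x \<bullet> b" if D: "(f has_derivative (\<lambda>v. \<gamma> x \<bullet> v)) (at x)" for x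
  proof -
    have "((\<lambda>t. x + t *\<^sub>R b) has_derivative (\<lambda>t. t *\<^sub>R b)) (at 0)"
      by (auto intro!: derivative_eq_intros)
    from diff_chain_at[OF this, of f "\<lambda>v. \<gamma> x \<bullet> v"] D
    have "((\<lambda>t. f (x + t *\<^sub>R b)) has_derivative ((\<lambda>v. \<gamma> x \<bullet> v) \<circ> (\<lambda>t. t *\<^sub>R b))) (at 0)"
      by (simp add: o_def)
    moreover have "((\<lambda>v. \<gamma> x \<bullet> v) \<circ> (\<lambda>t. t *\<^sub>R b)) = (*) (\<gamma> x \<bullet> b)"
      by (auto simp: fun_eq_iff)
    ultimately have "((\<lambda>t. f (x + t *\<^sub>R b)) has_real_derivative (\<gamma> x \<bullet> b)) (at 0)"
      by (simp add: has_field_derivative_def)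
    then have "((\<lambda>t. (f (x + t *\<^sub>R b) - f x) / t) \<longlongrightarrow> \<gamma> x \<bullet> b) (at 0)" by (simp add: DERIV_def)
    moreover have "filterlim (\<lambda>n. inverse (real (Suc n))) (at 0) sequentially"
      unfolding filterlim_at by (intro conjI LIMSEQ_inverse_real_of_nat always_eventually allI) simp_all
    ultimately show ?thesis unfolding s_def by (rule filterlim_compose)
  qed
  have "AE x in lebesgue. (\<lambda>n. s n x) \<longlonglongrightarrow> \<gamma> x \<bullet> b"
    using D by eventually_elim (rule lim)
  then show "(\<lambda>x. \<gamma> x \<bullet> b) \<in> borel_measurable lebesgue"
    by (rule borel_measurable_AE_LIMSEQ[OF s])
qed

lemma dominated_convergence_compact:
  fixes f :: "'a::euclidean_space \<Rightarrow> 'b::euclidean_space"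
  assumes s: "\<And>n. s n \<in> borel_measurable lebesgue"
    and T: "compact T" "\<And>n. AE x in lebesgue. norm (s n x) \<le> C * indicator T x"
    and lim: "AE x in lebesgue. (\<lambda>n. s n x) \<longlonglongrightarrow> f x"
  shows "integrable lebesgue f" "(\<lambda>n. \<integral>x. s n x \<partial>lebesgue) \<longlonglongrightarrow> (\<integral>x. f x \<partial>lebesgue)"
proof -
  have m: "f \<in> borel_measurable lebesgue" by (rule borel_measurable_AE_LIMSEQ[OF s lim])
  have "integrable lebesgue (\<lambda>x. C * indicator T x :: real)"
    using lmeasurable_compact[OF T(1)] by (intro integrable_mult_right) (simp add: lmeasurable_iff_integrable)
  note dom = this lim T(2)
  show "integrable lebesgue f" by (rule integrable_dominated_convergence[OF m s dom])
  show "(\<lambda>n. \<integral>x. s n x \<partial>lebesgue) \<longlonglongrightarrow> (\<integral>x. f x \<partial>lebesgue)"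
    by (rule integral_dominated_convergence[OF m s dom])
qed

text \<open>This form is applied to X^(2/p) u, which is only Lipschitz because it depends on the
  distance function.\<close>

lemma sobolev_inequality_lipschitz:
  fixes w :: "'a::euclidean_space \<Rightarrow> real" and p :: real
  assumes p: "1 < p" "p < DIM('a)"
    and lip: "\<And>x y. \<bar>w x - w y\<bar> \<le> L * norm (x - y)"
    and S: "compact S" "\<And>x. w x \<noteq> 0 \<Longrightarrow> x \<in> S"
    and \<omega>: "AE x in lebesgue. (w has_derivative (\<lambda>v. \<omega> x \<bullet> v)) (at x)"
  defines "N \<equiv> real DIM('a)"
  shows "integrable lebesgue (\<lambda>x. \<bar>w x\<bar> powr (N * p / (N - p)))"
    and "(\<integral>x. \<bar>w x\<bar> powr (N * p / (N - p)) \<partial>lebesgue) powr ((N - p) / N)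
    \<le> (p * (N - 1) / (N - p)) powr p * (\<integral>x. norm (\<omega> x) powr p \<partial>lebesgue)"
proof -
  have UN: "open (UNIV :: 'a set)" "S \<subseteq> UNIV" by auto
  obtain f g T C where fg:
    "\<And>n x. (f n has_derivative (\<lambda>v. g n x \<bullet> v)) (at x)" "\<And>n. continuous_on UNIV (g n)"
    "compact T" "T \<subseteq> UNIV" "S \<subseteq> T" "\<And>n x. f n x \<noteq> 0 \<Longrightarrow> x \<in> T" "\<And>n x. g n x \<noteq> 0 \<Longrightarrow> x \<in> T"
    "\<And>n x. norm (g n x) \<le> C" "\<And>n x. \<bar>f n x\<bar> \<le> C" "\<And>x. (\<lambda>n. f n x) \<longlonglongrightarrow> w x"
    "\<And>x G. (w has_derivative (\<lambda>v. G \<bullet> v)) (at x) \<Longrightarrow> (\<lambda>n. g n x) \<longlonglongrightarrow> G"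
    "\<And>n x. (\<And>y. 0 \<le> w y) \<Longrightarrow> 0 \<le> f n x"
    apply (rule lipschitz_C1_approximation[OF lip S UN])
    apply assumption
    subgoal premises prems for f g T C by (rule prems(1)[OF prems(2-)])
    done
  define P where "P = N * p / (N - p)"
  have N: "p < N" using p by (simp add: N_def)
  have P: "P > 0" using p N by (simp add: P_def)
  have C: "C \<ge> 0" using fg(9)[of 0 0] by linarith
  have contf: "continuous_on UNIV (f n)" for n
    using fg(1) by (meson continuous_at_imp_continuous_on has_derivative_continuous)
  have A: "integrable lebesgue (\<lambda>x. \<bar>w x\<bar> powr P)"
    "(\<lambda>n. \<integral>x. \<bar>f n x\<bar> powr P \<partial>lebesgue) \<longlonglongrightarrow> (\<integral>x. \<bar>w x\<bar> powr P \<partial>lebesgue)"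
  proof -
    have m: "(\<lambda>x. \<bar>f n x\<bar> powr P) \<in> borel_measurable lebesgue" for n
      by (rule cont_lebesgue_measurable) (use P contf in \<open>auto intro!: continuous_intros continuous_on_powr'\<close>)
    have b: "AE x in lebesgue. norm (\<bar>f n x\<bar> powr P) \<le> C powr P * indicator T x" for n
    proof (rule AE_I2)
      fix x show "norm (\<bar>f n x\<bar> powr P) \<le> C powr P * indicator T x"
        using fg(6)[of n x] fg(9)[of n x] P by (cases "f n x = 0") (auto intro!: powr_mono2)
    qed
    have l: "AE x in lebesgue. (\<lambda>n. \<bar>f n x\<bar> powr P) \<longlonglongrightarrow> \<bar>w x\<bar> powr P"
      using fg(10) P by (intro AE_I2 tendsto_powr') (auto intro!: tendsto_rabs)
    show "integrable lebesgue (\<lambda>x. \<bar>w x\<bar> powr P)"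
      "(\<lambda>n. \<integral>x. \<bar>f n x\<bar> powr P \<partial>lebesgue) \<longlonglongrightarrow> (\<integral>x. \<bar>w x\<bar> powr P \<partial>lebesgue)"
      by (rule dominated_convergence_compact[OF m fg(3) b l])+
  qed
  then show "integrable lebesgue (\<lambda>x. \<bar>w x\<bar> powr (N * p / (N - p)))" by (simp add: P_def)
  have B: "(\<lambda>n. \<integral>x. norm (g n x) powr p \<partial>lebesgue) \<longlonglongrightarrow> (\<integral>x. norm (\<omega> x) powr p \<partial>lebesgue)"
  proof (rule dominated_convergence_compact[of "\<lambda>n x. norm (g n x) powr p" T "C powr p"])
    show "(\<lambda>x. norm (g n x) powr p) \<in> borel_measurable lebesgue" for n
      by (rule cont_lebesgue_measurable) (use p fg(2) in \<open>auto intro!: continuous_intros continuous_on_powr'\<close>)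
    show "AE x in lebesgue. norm (norm (g n x) powr p) \<le> C powr p * indicator T x" for n
    proof (rule AE_I2)
      fix x show "norm (norm (g n x) powr p) \<le> C powr p * indicator T x"
        using fg(7)[of n x] fg(8)[of n x] p by (cases "g n x = 0") (auto intro!: powr_mono2)
    qed
    show "AE x in lebesgue. (\<lambda>n. norm (g n x) powr p) \<longlonglongrightarrow> norm (\<omega> x) powr p"
      using \<omega> by eventually_elim (use fg(11) p in \<open>intro tendsto_powr'; auto intro!: tendsto_norm\<close>)
  qed (rule fg)
  have le: "(\<integral>x. \<bar>f n x\<bar> powr P \<partial>lebesgue) powr ((N - p) / N)
    \<le> (p * (N - 1) / (N - p)) powr p * (\<integral>x. norm (g n x) powr p \<partial>lebesgue)" for n
  proof -
    obtain R where "\<And>x. x \<in> T \<Longrightarrow> norm x \<le> R" using compact_imp_bounded[OF fg(3)] by (auto simp: bounded_iff)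
    then have b: "C1_bounded_support (f n) (g n) R" using fg(1,2,6) by unfold_locales auto
    have "(\<lambda>x. \<bar>f n x\<bar> powr P) \<in> borel_measurable borel" "(\<lambda>x. norm (g n x) powr p) \<in> borel_measurable borel"
      by (rule borel_measurable_continuous_onI;
          use p P contf fg(2) in \<open>auto intro!: continuous_intros continuous_on_powr'\<close>)+
    then show ?thesis
      using sobolev_inequality_C1[OF p b] by (simp add: integral_completion P_def N_def)
  qed
  show "(\<integral>x. \<bar>w x\<bar> powr (N * p / (N - p)) \<partial>lebesgue) powr ((N - p) / N)
    \<le> (p * (N - 1) / (N - p)) powr p * (\<integral>x. norm (\<omega> x) powr p \<partial>lebesgue)"
    unfolding P_def[symmetric]
  proof (rule LIMSEQ_le)
    show "(\<lambda>n. (\<integral>x. \<bar>f n x\<bar> powr P \<partial>lebesgue) powr ((N - p) / N)) \<longlonglongrightarrow> (\<integral>x. \<bar>w x\<bar> powr P \<partial>lebesgue) powr ((N - p) / N)"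
      using N p by (intro tendsto_powr' A(2) tendsto_const) auto
    show "(\<lambda>n. (p * (N - 1) / (N - p)) powr p * (\<integral>x. norm (g n x) powr p \<partial>lebesgue)) \<longlonglongrightarrow>
      (p * (N - 1) / (N - p)) powr p * (\<integral>x. norm (\<omega> x) powr p \<partial>lebesgue)"
      by (intro tendsto_mult tendsto_const B)
  qed (use le in auto)
qed

lemma C1_compact_support_lipschitz:
  fixes B :: "'a::euclidean_space \<Rightarrow> real"
  assumes B: "\<And>x. (B has_derivative (\<lambda>v. G x \<bullet> v)) (at x)" "continuous_on UNIV G"
    and S: "compact S" "\<And>x. B x \<noteq> 0 \<Longrightarrow> x \<in> S"
  obtains L where "L \<ge> 0" "\<And>x y. \<bar>B x - B y\<bar> \<le> L * norm (x - y)" "\<And>x. \<bar>B x\<bar> \<le> L"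
proof -
  have G0: "G x = 0" if "x \<notin> S" for x
  proof -
    have "closure {x. B x \<noteq> 0} \<subseteq> S" using S by (intro closure_minimal) (auto intro: compact_imp_closed)
    then show ?thesis using deriv_0_outside_support[OF B(1)] that by blast
  qed
  have cB: "continuous_on UNIV B" using B(1) by (meson continuous_at_imp_continuous_on has_derivative_continuous)
  have "bounded (G ` S)" "bounded (B ` S)"
    using S B(2) cB by (auto intro!: compact_imp_bounded compact_continuous_image intro: continuous_on_subset)
  then obtain l l' where l: "\<And>x. x \<in> S \<Longrightarrow> norm (G x) \<le> l" "\<And>x. x \<in> S \<Longrightarrow> \<bar>B x\<bar> \<le> l'"
    by (auto simp: bounded_iff)
  define L where "L = \<bar>l\<bar> + \<bar>l'\<bar>"
  have L: "norm (G x) \<le> L" "\<bar>B x\<bar> \<le> L" for x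
    using l[of x] G0[of x] S(2)[of x] by (force simp: L_def)+
  show ?thesis
  proof (rule that[of L])
    show "\<bar>B x - B y\<bar> \<le> L * norm (x - y)" for x y
    proof -
      have "norm (B x - B y) \<le> L * norm (x - y)"
      proof (rule differentiable_bound[of UNIV])
        show "(B has_derivative (\<lambda>v. G z \<bullet> v)) (at z within UNIV)" for z using B(1) by simp
        show "onorm (\<lambda>v. G z \<bullet> v) \<le> L" for z
        proof (rule onorm_le)
          fix v show "norm (G z \<bullet> v) \<le> L * norm v"
            using Cauchy_Schwarz_ineq2[of "G z" v] mult_right_mono[OF L(1)[of z] norm_ge_zero[of v]] by simp
        qed
      qed auto
      then show ?thesis by simp
    qed
  qed (use L in \<open>auto simp: L_def\<close>)
qed

text \<open>The weight \<open>F\<close> may blow up at 0 and at \<open>D\<close>, but on the compact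
  set \<open>S\<close>, which avoids \<open>K\<close>, the distance ranges over a compact part of
  the interval. Outside \<open>S\<close> the product vanishes identically.\<close>

lemma weighted_lipschitz:
  fixes F F' :: "real \<Rightarrow> real" and B :: "'a::euclidean_space \<Rightarrow> real" and K :: "'a set"
  defines "d \<equiv> (\<lambda>x. infdist x K)"
  assumes K: "closed K" "K \<noteq> {}"
    and F: "\<And>s. 0 < s \<Longrightarrow> s < D \<Longrightarrow> (F has_real_derivative F' s) (at s)" "continuous_on {0<..<D} F'"
    and B: "\<And>x. (B has_derivative (\<lambda>v. G x \<bullet> v)) (at x)" "continuous_on UNIV G"
    and S: "compact S" "\<And>x. B x \<noteq> 0 \<Longrightarrow> x \<in> S" "S \<inter> K = {}" "\<And>x. x \<in> S \<Longrightarrow> d x < D"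
  shows "\<exists>L. \<forall>x y. \<bar>F (d x) * B x - F (d y) * B y\<bar> \<le> L * norm (x - y)"
    and "AE x in lebesgue. ((\<lambda>x. F (d x) * B x) has_derivative
      (\<lambda>v. ((F' (d x) * B x) *\<^sub>R grad d x + F (d x) *\<^sub>R G x) \<bullet> v)) (at x)"
proof -
  have G0: "G x = 0" if "x \<notin> S" for x
  proof -
    have "closure {x. B x \<noteq> 0} \<subseteq> S" using S by (intro closure_minimal) (auto intro: compact_imp_closed)
    then show ?thesis using deriv_0_outside_support[OF B(1)] that by blast
  qed
  have dpos: "0 < d x" if "x \<in> S" for x
    using that S(3) K unfolding d_def by (metis disjoint_iff in_closed_iff_infdist_zero infdist_nonneg less_le)
  show "\<exists>L. \<forall>x y. \<bar>F (d x) * B x - F (d y) * B y\<bar> \<le> L * norm (x - y)"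
  proof (cases "S = {}")
    case True
    then have "B x = 0" for x using S(2) by blast
    then show ?thesis by (auto intro!: exI[of _ 0])
  next
    case False
    obtain LB where LB: "LB \<ge> 0" "\<And>x y. \<bar>B x - B y\<bar> \<le> LB * norm (x - y)" "\<And>x. \<bar>B x\<bar> \<le> LB"
      using C1_compact_support_lipschitz[OF B S(1,2)] by metis
    have cd: "continuous_on S d" unfolding d_def by (intro continuous_intros)
    obtain x0 x1 where x: "x0 \<in> S" "x1 \<in> S" "\<And>x. x \<in> S \<Longrightarrow> d x0 \<le> d x" "\<And>x. x \<in> S \<Longrightarrow> d x \<le> d x1"
      using continuous_attains_inf[OF S(1) False cd] continuous_attains_sup[OF S(1) False cd] by blast
    define a b where "a = d x0" and "b = d x1"
    have ab: "0 < a" "a \<le> b" "b < D" using x dpos S(4) by (auto simp: a_def b_def)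
    \<comment> \<open>Clamping d to its range on \<open>S\<close> changes nothing where
      \<open>B\<close> is nonzero and makes \<open>F\<close> of it bounded and Lipschitz on the
      whole space.\<close>
    define cl where "cl s = max a (min s b)" for s
    have cl: "cl s \<in> {a..b}" "\<bar>cl s - cl t\<bar> \<le> \<bar>s - t\<bar>" for s t using ab by (auto simp: cl_def)
    have "bounded (F' ` {a..b})" using ab
      by (intro compact_imp_bounded compact_continuous_image continuous_on_subset[OF F(2)]) auto
    then obtain M where M: "\<And>s. s \<in> {a..b} \<Longrightarrow> \<bar>F' s\<bar> \<le> M"
      unfolding bounded_iff real_norm_def by blast
    have M0: "M \<ge> 0" using M[of a] ab by auto
    have FL: "\<bar>F s - F t\<bar> \<le> M * \<bar>s - t\<bar>" if "s \<in> {a..b}" "t \<in> {a..b}" for s t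
    proof -
      have "norm (F s - F t) \<le> M * norm (s - t)"
      proof (rule field_differentiable_bound[of "{a..b}" F F'])
        show "(F has_field_derivative F' z) (at z within {a..b})" if "z \<in> {a..b}" for z
          using that ab by (intro has_field_derivative_at_within[OF F(1)]) auto
      qed (use that M in auto)
      then show ?thesis by simp
    qed
    define M' where "M' = \<bar>F a\<bar> + M * (b - a)"
    have M': "\<bar>F s\<bar> \<le> M'" if "s \<in> {a..b}" for s
    proof -
      have "\<bar>F s - F a\<bar> \<le> M * \<bar>s - a\<bar>" using FL[of s a] that ab by auto
      also have "\<dots> \<le> M * (b - a)" using that M0 by (intro mult_left_mono) auto
      finally show ?thesis by (simp add: M'_def)
    qed
    have eq: "F (d x) * B x = F (cl (d x)) * B x" for x
    proof (cases "B x = 0")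
      case False
      then have "x \<in> S" by (rule S(2))
      then show ?thesis using x by (auto simp: cl_def a_def b_def max_def min_def)
    qed simp
    have "\<bar>F (d x) * B x - F (d y) * B y\<bar> \<le> (M' * LB + M * LB) * norm (x - y)" for x y
    proof -
      have "F (d x) * B x - F (d y) * B y = F (cl (d x)) * (B x - B y) + (F (cl (d x)) - F (cl (d y))) * B y"
        unfolding eq by (simp add: algebra_simps)
      also have "\<bar>\<dots>\<bar> \<le> \<bar>F (cl (d x))\<bar> * \<bar>B x - B y\<bar> + \<bar>F (cl (d x)) - F (cl (d y))\<bar> * \<bar>B y\<bar>"
        using abs_triangle_ineq by (simp add: abs_mult[symmetric])
      also have "\<dots> \<le> M' * (LB * norm (x - y)) + (M * norm (x - y)) * LB"
      proof (intro add_mono mult_mono M' LB cl)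
        have "\<bar>F (cl (d x)) - F (cl (d y))\<bar> \<le> M * \<bar>cl (d x) - cl (d y)\<bar>" by (rule FL[OF cl(1) cl(1)])
        also have "\<dots> \<le> M * norm (x - y)"
          using M0 cl(2)[of "d x" "d y"] infdist_lipschitz[of x K y] by (intro mult_left_mono) (auto simp: d_def)
        finally show "\<bar>F (cl (d x)) - F (cl (d y))\<bar> \<le> M * norm (x - y)" .
        show "0 \<le> M'" using M'[of a] ab by auto
      qed (use M0 in auto)
      finally show ?thesis by (simp add: algebra_simps)
    qed
    then show ?thesis by blast
  qed
  have "AE x in lebesgue. x \<notin> K \<longrightarrow> (d has_derivative (\<lambda>v. grad d x \<bullet> v)) (at x) \<and> norm (grad d x) = 1"
    using AE_infdist_differentiable[OF K] unfolding d_def by (rule AE_completion)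
  then show "AE x in lebesgue. ((\<lambda>x. F (d x) * B x) has_derivative
      (\<lambda>v. ((F' (d x) * B x) *\<^sub>R grad d x + F (d x) *\<^sub>R G x) \<bullet> v)) (at x)"
  proof eventually_elim
    fix x assume A: "x \<notin> K \<longrightarrow> (d has_derivative (\<lambda>v. grad d x \<bullet> v)) (at x) \<and> norm (grad d x) = 1"
    show "((\<lambda>x. F (d x) * B x) has_derivative
      (\<lambda>v. ((F' (d x) * B x) *\<^sub>R grad d x + F (d x) *\<^sub>R G x) \<bullet> v)) (at x)"
    proof (cases "x \<in> S")
      case True
      then have dx: "0 < d x" "d x < D" and D: "(d has_derivative (\<lambda>v. grad d x \<bullet> v)) (at x)"
        using dpos S A by auto
      have "(F has_derivative (\<lambda>s. F' (d x) * s)) (at (d x))" using F(1)[OF dx] by (simp add: has_field_derivative_def)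
      from diff_chain_at[OF D this] have "((\<lambda>x. F (d x)) has_derivative (\<lambda>v. F' (d x) * (grad d x \<bullet> v))) (at x)"
        by (simp add: o_def)
      from has_derivative_mult[OF this B(1)] show ?thesis
        by (simp add: inner_add_left mult_ac add.commute)
    next
      case False
      then have B0: "B x = 0" using S by blast
      have "((\<lambda>x. F (d x) * B x) has_derivative (\<lambda>v. 0)) (at x)"
        by (rule has_derivative_transform_within_open[of "\<lambda>_. 0" _ _ _ "- S"])
          (use False S compact_imp_closed[of S] in \<open>auto intro!: open_Compl\<close>)
      then show ?thesis by (simp add: B0 G0[OF False])
    qed
  qed
qed

subsection \<open>The improved Hardy inequality\<close>

lemma exp_le_quadratic:
  fixes z :: real
  assumes "\<bar>z\<bar> \<le> 1" shows "exp z \<le> 1 + z + z\<^sup>2"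
proof (cases "z \<ge> 0")
  case True then show ?thesis using assms exp_bound[of z] by simp
next
  case False
  define w where "w = - z"
  have w: "0 < w" using False by (simp add: w_def)
  have "1 \<le> (1 - w + w\<^sup>2) * (1 + w + w\<^sup>2 / 2)"
  proof -
    have "(1 - w + w\<^sup>2) * (1 + w + w\<^sup>2 / 2) = 1 + (w\<^sup>2 / 2 + w ^ 3 / 2 + w ^ 4 / 2)"
      by (simp add: field_simps power2_eq_square power3_eq_cube power4_eq_xxxx)
    then show ?thesis using w by simp
  qed
  also have "\<dots> \<le> (1 - w + w\<^sup>2) * exp w"
  proof (rule mult_left_mono)
    show "1 + w + w\<^sup>2 / 2 \<le> exp w" using exp_lower_Taylor_quadratic[of w] w by simp
    have "1 - w + w\<^sup>2 = (w - 1/2)\<^sup>2 + 3/4" by (simp add: power2_eq_square field_simps)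
    then show "0 \<le> 1 - w + w\<^sup>2" by simp
  qed
  finally have "exp (- w) \<le> 1 - w + w\<^sup>2" by (simp add: exp_minus field_simps)
  then show ?thesis by (simp add: w_def)
qed

text \<open>Young's inequality with the factor c^(1/p) moved onto B. Taking c slightly below 1
  leaves part of the p-th power of the gradient for the remainder.\<close>

lemma weighted_young:
  fixes A B c g p :: real
  assumes p: "p > 1" and "0 \<le> A" "0 \<le> B" "0 < c" "0 < g"
  shows "p * g * A powr (p - 1) * B \<le> c * B powr p + (p - 1) * (g powr (p / (p - 1)) * c powr (- 1 / (p - 1))) * A powr p"
proof -
  define r where "r = p / (p - 1)"
  have r: "r > 1" "1 / p + 1 / r = 1" "p / r = p - 1" using p by (auto simp: r_def field_simps)
  have "(c powr (1/p) * B) * (g * A powr (p - 1) * c powr (- 1/p))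
    \<le> (c powr (1/p) * B) powr p / p + (g * A powr (p - 1) * c powr (- 1/p)) powr r / r"
    using assms r by (intro Youngs_inequality) auto
  moreover have "(c powr (1/p) * B) * (g * A powr (p - 1) * c powr (- 1/p)) = g * A powr (p - 1) * B"
  proof -
    have "c powr (1/p) * c powr (- 1/p) = 1" using assms by (simp flip: powr_add)
    then show ?thesis by (simp add: mult_ac)
  qed
  moreover have "(c powr (1/p) * B) powr p = c * B powr p"
    using assms p by (simp add: powr_mult powr_powr)
  moreover have "(g * A powr (p - 1) * c powr (- 1/p)) powr r = g powr r * A powr p * c powr (- 1 / (p - 1))"
    using assms p by (simp add: powr_mult powr_powr r_def)
  ultimately have "g * A powr (p - 1) * B \<le> c * B powr p / p + g powr r * A powr p * c powr (- 1 / (p - 1)) / r"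
    by (simp only:)
  then have "p * (g * A powr (p - 1) * B) \<le> p * (c * B powr p / p + g powr r * A powr p * c powr (- 1 / (p - 1)) / r)"
    using p by (intro mult_left_mono) auto
  also have "\<dots> = c * B powr p + (p / r) * (g powr r * A powr p * c powr (- 1 / (p - 1)))"
    using p by (simp add: distrib_left)
  finally show ?thesis unfolding r(3) by (simp add: r_def mult_ac)
qed

text \<open>To be read with y = X(d/D), A = |H| |u| / d and B the norm of the gradient of u. After
  Young's inequality the coefficient of A^p is (p - 1) exp(z) at most, with z = O(delta y); its
  linear term p H delta y cancels against that of p (1 + H delta y), because (p - 1) r = p, and only
  terms in y^2 have to be compared.\<close>

lemma hardy_constants:
  fixes p H M :: real
  assumes p: "p > 1" and H: "H \<noteq> 0" and M: "M \<ge> 0"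
  obtains \<delta> \<epsilon> where "\<delta> > 0" "\<epsilon> > 0"
    "\<And>y A B. 0 \<le> y \<Longrightarrow> y \<le> M \<Longrightarrow> 0 \<le> A \<Longrightarrow> 0 \<le> B \<Longrightarrow>
      p * (1 + H * \<delta> * y) * A powr (p - 1) * B \<le>
        (1 - \<epsilon> * y\<^sup>2) * B powr p + A powr p * (p * (1 + H * \<delta> * y) + \<delta> * y\<^sup>2 - 1 - \<epsilon> * y\<^sup>2)"
    "\<And>y. 0 \<le> y \<Longrightarrow> y \<le> M \<Longrightarrow> 1 + H * \<delta> * y > 0"
proof -
  define r s where "r = p / (p - 1)" and "s = 1 / (p - 1)"
  have rs: "r > 1" "s > 0" "(p - 1) * r = p" "(p - 1) * s = 1" using p by (auto simp: r_def s_def field_simps)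
  \<comment> \<open>Chosen so that the exponent \<open>z\<close> below satisfies |z| <= delta y Q;
    the part s M / 4 comes from 2 epsilon y^2 = delta y^2 / 4.\<close>
  define Q where "Q = r * \<bar>H\<bar> + s * M / 4"
  have Q: "Q > 0" using rs H M by (auto simp: Q_def intro!: add_pos_nonneg)
  \<comment> \<open>As delta = 1/T, the four entries force, in this order: |z| <= 1, quadratic error
    (p - 1) (delta y Q)^2 <= delta y^2 / 2, |H delta y| <= 1/2, and delta y^2 <= 1. The summand 1
    keeps \<open>T\<close> positive for M = 0.\<close>
  define T where "T = max (max (M * Q) (2 * (p - 1) * Q\<^sup>2)) (max (2 * \<bar>H\<bar> * M) (M\<^sup>2)) + 1"
  have T: "M * Q \<le> T" "2 * (p - 1) * Q\<^sup>2 \<le> T" "2 * \<bar>H\<bar> * M \<le> T" "M\<^sup>2 \<le> T" by (auto simp: T_def)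
  have T0: "T > 0" using M Q T(1) by (auto simp: T_def add_nonneg_pos le_max_iff_disj)
  define \<delta> \<epsilon> where "\<delta> = 1 / T" and "\<epsilon> = \<delta> / 8"
  have \<delta>: "\<delta> > 0" "\<epsilon> > 0" using T0 by (auto simp: \<delta>_def \<epsilon>_def)
  have \<delta>': "\<delta> * (M * Q) \<le> 1" "\<delta> * (2 * (p - 1) * Q\<^sup>2) \<le> 1" "\<delta> * (2 * \<bar>H\<bar> * M) \<le> 1" "\<delta> * M\<^sup>2 \<le> 1"
    using T T0 by (auto simp: \<delta>_def)
  have gpos: "\<bar>H * \<delta> * y\<bar> \<le> 1/2" if "0 \<le> y" "y \<le> M" for y
  proof -
    have "\<delta> * (2 * \<bar>H\<bar> * y) \<le> \<delta> * (2 * \<bar>H\<bar> * M)" using \<delta> that by (intro mult_left_mono) auto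
    moreover have "\<delta> * (2 * \<bar>H\<bar> * y) = 2 * \<bar>H * \<delta> * y\<bar>" using \<delta>(1) that by (simp add: abs_mult)
    ultimately show ?thesis using \<delta>'(3) by linarith
  qed
  show ?thesis
  proof (rule that[OF \<delta>])
    show "1 + H * \<delta> * y > 0" if "0 \<le> y" "y \<le> M" for y using gpos[OF that] by linarith
  next
    fix y A B :: real
    assume y: "0 \<le> y" "y \<le> M" and AB: "0 \<le> A" "0 \<le> B"
    define g c where "g = 1 + H * \<delta> * y" and "c = 1 - \<epsilon> * y\<^sup>2"
    have g: "g > 0" using gpos[OF y] unfolding g_def by linarith
    have y2: "y\<^sup>2 \<le> M\<^sup>2" using y by (intro power_mono) auto
    have t: "0 \<le> \<epsilon> * y\<^sup>2" "\<epsilon> * y\<^sup>2 \<le> 1/2"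
    proof -
      have "\<delta> * y\<^sup>2 \<le> \<delta> * M\<^sup>2" using \<delta> y2 by (intro mult_left_mono) auto
      then have "\<delta> * y\<^sup>2 \<le> 1" using \<delta>'(4) by linarith
      then show "0 \<le> \<epsilon> * y\<^sup>2" "\<epsilon> * y\<^sup>2 \<le> 1/2" using \<delta> by (auto simp: \<epsilon>_def)
    qed
    have c: "c > 0" using t by (simp add: c_def)
    \<comment> \<open>An upper bound for r ln g - s ln c, from ln (1 + t) <= t for the first term
      and -ln (1 - t) <= 2 t, valid for t <= 1/2, for the second.\<close>
    define z where "z = r * (H * \<delta> * y) + s * (2 * (\<epsilon> * y\<^sup>2))"
    have zb: "\<bar>z\<bar> \<le> \<delta> * y * Q"
    proof -
      have "\<bar>z\<bar> \<le> r * (\<bar>H\<bar> * \<delta> * y) + s * (2 * (\<epsilon> * y\<^sup>2))"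
        unfolding z_def using rs \<delta> y t by (intro order_trans[OF abs_triangle_ineq]) (auto simp: abs_mult)
      also have "s * (2 * (\<epsilon> * y\<^sup>2)) \<le> s * (\<delta> * y * M / 4)"
      proof (rule mult_left_mono)
        have "\<delta> * y * y \<le> \<delta> * y * M" using \<delta> y by (intro mult_left_mono) auto
        then show "2 * (\<epsilon> * y\<^sup>2) \<le> \<delta> * y * M / 4" by (simp add: \<epsilon>_def power2_eq_square)
      qed (use rs in auto)
      finally show ?thesis by (simp add: Q_def algebra_simps)
    qed
    have z1: "\<bar>z\<bar> \<le> 1"
    proof -
      have "\<delta> * y * Q \<le> \<delta> * (M * Q)" using \<delta> y Q by (simp add: mult.assoc mult_left_mono mult_right_mono)
      then show ?thesis using zb \<delta>'(1) by linarith
    qed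
    have "g powr r * c powr (- s) = exp (r * ln g - s * ln c)"
      using g c by (simp add: powr_def exp_diff exp_minus field_simps exp_add[symmetric])
    also have "\<dots> \<le> exp z"
    proof -
      have "ln g \<le> H * \<delta> * y" using ln_add_one_self_le_self2[of "H * \<delta> * y"] g by (simp add: g_def)
      then have 1: "r * ln g \<le> r * (H * \<delta> * y)" using rs by (intro mult_left_mono) auto
      have "- (\<epsilon> * y\<^sup>2) - 2 * (\<epsilon> * y\<^sup>2)\<^sup>2 \<le> ln c" unfolding c_def
        using ln_one_minus_pos_lower_bound[OF t] by simp
      moreover have "2 * (\<epsilon> * y\<^sup>2)\<^sup>2 \<le> \<epsilon> * y\<^sup>2" using t mult_left_mono[OF t(2) t(1)] by (simp add: power2_eq_square)
      ultimately have "- ln c \<le> 2 * (\<epsilon> * y\<^sup>2)" by linarith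
      then have 2: "s * (- ln c) \<le> s * (2 * (\<epsilon> * y\<^sup>2))" using rs by (intro mult_left_mono) auto
      show ?thesis using 1 2 by (simp add: z_def)
    qed
    also have "\<dots> \<le> 1 + z + z\<^sup>2" by (rule exp_le_quadratic[OF z1])
    also have "\<dots> \<le> 1 + z + (\<delta> * y * Q)\<^sup>2" using zb by (simp add: abs_le_square_iff[symmetric] abs_le_iff)
    finally have E: "g powr r * c powr (- s) \<le> 1 + z + (\<delta> * y * Q)\<^sup>2" .
    have "(p - 1) * (g powr r * c powr (- s)) \<le> (p - 1) * (1 + z + (\<delta> * y * Q)\<^sup>2)"
      using E p by (intro mult_left_mono) auto
    also have "\<dots> = (p - 1) + ((p - 1) * r) * (H * \<delta> * y) + ((p - 1) * s) * (2 * (\<epsilon> * y\<^sup>2)) + (\<delta> * (2 * (p - 1) * Q\<^sup>2)) * (\<delta> * y\<^sup>2) / 2"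
      by (simp add: z_def field_simps power2_eq_square)
    also have "\<dots> \<le> (p - 1) + p * (H * \<delta> * y) + 2 * (\<epsilon> * y\<^sup>2) + 1 * (\<delta> * y\<^sup>2) / 2"
    proof -
      have "(\<delta> * (2 * (p - 1) * Q\<^sup>2)) * (\<delta> * y\<^sup>2) \<le> 1 * (\<delta> * y\<^sup>2)"
        using \<delta>'(2) \<delta>(1) by (intro mult_right_mono) auto
      then show ?thesis unfolding rs(3,4) by linarith
    qed
    \<comment> \<open>The balance of the y^2 terms: 2 epsilon + delta/2 = 3 delta/4 on the left
      against delta - epsilon = 7 delta/8 on the right.\<close>
    also have "\<dots> \<le> p * g + \<delta> * y\<^sup>2 - 1 - \<epsilon> * y\<^sup>2" using \<delta> by (simp add: g_def \<epsilon>_def algebra_simps)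
    finally have S: "(p - 1) * (g powr r * c powr (- s)) \<le> p * g + \<delta> * y\<^sup>2 - 1 - \<epsilon> * y\<^sup>2" .
    have "p * g * A powr (p - 1) * B \<le> c * B powr p + (p - 1) * (g powr r * c powr (- s)) * A powr p"
      using weighted_young[OF p AB c g] by (simp add: r_def s_def)
    also have "\<dots> \<le> c * B powr p + (p * g + \<delta> * y\<^sup>2 - 1 - \<epsilon> * y\<^sup>2) * A powr p"
      by (intro add_left_mono mult_right_mono S) auto
    finally show "p * (1 + H * \<delta> * y) * A powr (p - 1) * B \<le>
        (1 - \<epsilon> * y\<^sup>2) * B powr p + A powr p * (p * (1 + H * \<delta> * y) + \<delta> * y\<^sup>2 - 1 - \<epsilon> * y\<^sup>2)"
      by (simp add: g_def c_def mult.commute)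
  qed
qed

text \<open>The identity s X' = X^2 is the source of the X^2 in the Hardy remainder and of the extra
  power of X in the gradient of X^(2/p).\<close>

lemma X_deriv:
  assumes "0 < s" "s < D"
  shows "((\<lambda>s. X (s / D)) has_real_derivative (X (s / D))\<^sup>2 / s) (at s)"
proof -
  have "ln (s / D) < 0" using assms by (simp add: ln_less_zero)
  then show ?thesis unfolding X_def using assms
    by (auto intro!: derivative_eq_intros simp: field_simps power2_eq_square)
qed

lemma X_pos: "0 < s \<Longrightarrow> s < D \<Longrightarrow> 0 < X (s / D)"
  unfolding X_def using ln_less_zero[of "s / D"] by (simp add: divide_neg_neg)

lemma X_mono:
  assumes "0 < s" "s \<le> t" "t < D" shows "X (s / D) \<le> X (t / D)"
proof -
  have "ln (s / D) \<le> ln (t / D)" "ln (t / D) < 0" using assms by (auto simp: ln_less_zero divide_right_mono)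
  then show ?thesis unfolding X_def by (simp add: divide_simps)
qed

lemma continuous_on_X: "continuous_on {0<..<D} (\<lambda>s. X (s / D))"
  by (rule DERIV_continuous_on[of _ _ "\<lambda>s. (X (s / D))\<^sup>2 / s"])
    (use X_deriv in \<open>auto intro: has_field_derivative_at_within\<close>)

section \<open>Inequalities for continuously differentiable functions of compact support\<close>

lemma integrable_cont_on_compact:
  fixes f :: "'a::euclidean_space \<Rightarrow> 'b::{banach, second_countable_topology}"
  assumes "compact S" "continuous_on S f" "\<And>x. x \<notin> S \<Longrightarrow> f x = 0"
  shows "integrable lebesgue f"
proof -
  have "integrable lborel (\<lambda>x. indicator S x *\<^sub>R f x)" by (rule borel_integrable_compact[OF assms(1,2)])
  also have "(\<lambda>x. indicator S x *\<^sub>R f x) = f" using assms(3) by (force simp: indicator_def)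
  finally have "integrable lborel f" .
  then show ?thesis using integrable_completion[of f lborel] by (meson borel_measurable_integrable)
qed

lemma Ck_c_1_E:
  assumes "u \<in> Ck_c 1 U"
  obtains S where "compact S" "S \<subseteq> U" "\<And>x. u x \<noteq> 0 \<Longrightarrow> x \<in> S" "\<And>x. grad u x \<noteq> 0 \<Longrightarrow> x \<in> S"
    "\<And>x. (u has_derivative (\<lambda>v. grad u x \<bullet> v)) (at x)" "continuous_on UNIV (grad u)" "continuous_on UNIV u"
proof (rule that[of "closure {x. u x \<noteq> 0}"])
  show D: "(u has_derivative (\<lambda>v. grad u x \<bullet> v)) (at x)" for x using assms Ck_c_1_iff by blast
  show "continuous_on UNIV (grad u)" "compact (closure {x. u x \<noteq> 0})" "closure {x. u x \<noteq> 0} \<subseteq> U"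
    using assms Ck_c_1_iff by blast+
  show "continuous_on UNIV u" using D by (meson continuous_at_imp_continuous_on has_derivative_continuous)
  show "u x \<noteq> 0 \<Longrightarrow> x \<in> closure {x. u x \<noteq> 0}" for x using closure_subset[of "{x. u x \<noteq> 0}"] by blast
  show "grad u x \<noteq> 0 \<Longrightarrow> x \<in> closure {x. u x \<noteq> 0}" for x using deriv_0_outside_support[OF D] by blast
qed

text \<open>The number \<open>s1\<close> bounds the distance strictly below \<open>D\<close>, which
  bounds X(d/D) by \<open>X (s1 / D)\<close>. The surface enters as a closed null set, as supplied
  by \<open>hardy_surface_null\<close>.\<close>

locale hardy_setting =
  fixes \<Omega> K :: "'a::euclidean_space set" and k :: nat and p D s1 :: real
  assumes open_\<Omega>: "open \<Omega>" and K: "closed K" "K \<noteq> {}" and null_K: "K \<in> null_sets lebesgue"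
    and p: "1 < p" and p_neq_k: "p \<noteq> real k"
    and superharmonic: "\<forall>\<phi>\<in>Ck_c 1 (\<Omega> - K). (\<forall>x. 0 \<le> \<phi> x) \<longrightarrow> (p - real k) * A_fun \<Omega> k K \<phi> \<le> 0"
    and s1: "0 < s1" "s1 < D" "\<And>x. x \<in> \<Omega> \<Longrightarrow> infdist x K \<le> s1"
begin

definition d :: "'a \<Rightarrow> real" where "d x = infdist x K"

definition Xd :: "'a \<Rightarrow> real" where "Xd x = X (d x / D)"

definition H :: real where "H = (real k - p) / p"

lemma H_nonzero: "H \<noteq> 0" using p p_neq_k by (simp add: H_def)

lemma d_eq: "d = (\<lambda>x. infdist x K)" by (simp add: d_def fun_eq_iff)

lemma cont_d: "continuous_on T d" unfolding d_eq by (intro continuous_intros)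

lemma d_pos: "x \<notin> K \<Longrightarrow> 0 < d x"
  using K unfolding d_def by (metis in_closed_iff_infdist_zero infdist_nonneg less_le)

lemma d_lt: "x \<in> \<Omega> \<Longrightarrow> d x < D" using s1 unfolding d_def by force

lemma open_domain: "open (\<Omega> - K)" using open_\<Omega> K by auto

lemma AE_d: "AE x in lebesgue. (d has_derivative (\<lambda>v. grad d x \<bullet> v)) (at x) \<and> norm (grad d x) = 1"
proof -
  have "AE x in lebesgue. x \<notin> K \<longrightarrow> (d has_derivative (\<lambda>v. grad d x \<bullet> v)) (at x) \<and> norm (grad d x) = 1"
    using AE_infdist_differentiable[OF K] unfolding d_eq by (rule AE_completion)
  with AE_not_in[OF null_K] show ?thesis by eventually_elim auto
qed

lemma grad_d_measurable: "grad d \<in> borel_measurable lebesgue"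
  by (rule AE_gradient_measurable[OF cont_d]) (use AE_d in auto)

lemma Xd_bounds:
  assumes "x \<in> \<Omega> - K" shows "0 < Xd x" "Xd x \<le> X (s1 / D)"
  using assms d_pos[of x] d_lt[of x] s1 X_pos X_mono[of "d x" s1 D] by (auto simp: Xd_def d_def)

lemma cont_Xd: "S \<subseteq> \<Omega> - K \<Longrightarrow> continuous_on S Xd"
  unfolding Xd_def[abs_def] using d_pos d_lt
  by (intro continuous_on_compose2[OF continuous_on_X cont_d]) auto

text \<open>The functions to be tested contain d and are therefore only Lipschitz. Their
  mollifications are nonnegative test functions, and both integrals in \<open>A_fun\<close> pass to
  the limit because d and its gradient are bounded on the domain.\<close>

lemma superharmonic_lipschitz:
  assumes lip: "\<And>x y. \<bar>\<phi> x - \<phi> y\<bar> \<le> L * norm (x - y)"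
    and S: "compact S" "\<And>x. \<phi> x \<noteq> 0 \<Longrightarrow> x \<in> S" "S \<subseteq> \<Omega> - K"
    and nonneg: "\<And>x. 0 \<le> \<phi> x"
    and \<gamma>: "AE x in lebesgue. (\<phi> has_derivative (\<lambda>v. \<gamma> x \<bullet> v)) (at x)"
  shows "integrable lebesgue (\<lambda>x. d x * (grad d x \<bullet> \<gamma> x))" "integrable lebesgue \<phi>"
    "0 \<le> (p - real k) * ((\<integral>x. d x * (grad d x \<bullet> \<gamma> x) \<partial>lebesgue) + real k * (\<integral>x. \<phi> x \<partial>lebesgue))"
proof -
  obtain f g T C where fg:
    "\<And>n x. (f n has_derivative (\<lambda>v. g n x \<bullet> v)) (at x)" "\<And>n. continuous_on UNIV (g n)"
    "compact T" "T \<subseteq> \<Omega> - K" "S \<subseteq> T" "\<And>n x. f n x \<noteq> 0 \<Longrightarrow> x \<in> T" "\<And>n x. g n x \<noteq> 0 \<Longrightarrow> x \<in> T"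
    "\<And>n x. norm (g n x) \<le> C" "\<And>n x. \<bar>f n x\<bar> \<le> C" "\<And>x. (\<lambda>n. f n x) \<longlonglongrightarrow> \<phi> x"
    "\<And>x G. (\<phi> has_derivative (\<lambda>v. G \<bullet> v)) (at x) \<Longrightarrow> (\<lambda>n. g n x) \<longlonglongrightarrow> G"
    "\<And>n x. (\<And>y. 0 \<le> \<phi> y) \<Longrightarrow> 0 \<le> f n x"
    apply (rule lipschitz_C1_approximation[OF lip S(1,2) open_domain S(3)])
    apply assumption
    subgoal premises prems for f g T C by (rule prems(1)[OF prems(2-)])
    done
  have contf: "continuous_on UNIV (f n)" for n
    using fg(1) by (meson continuous_at_imp_continuous_on has_derivative_continuous)
  have C: "0 \<le> C" using fg(9)[of 0 0] by linarith
  have f1: "integrable lebesgue \<phi> \<and> (\<lambda>n. \<integral>x. f n x \<partial>lebesgue) \<longlonglongrightarrow> (\<integral>x. \<phi> x \<partial>lebesgue)"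
  proof -
    have m: "f n \<in> borel_measurable lebesgue" for n by (rule cont_lebesgue_measurable[OF contf])
    have b: "AE x in lebesgue. norm (f n x) \<le> C * indicator T x" for n
    proof (rule AE_I2)
      fix x show "norm (f n x) \<le> C * indicator T x"
        using fg(6)[of n x] fg(9)[of n x] by (cases "f n x = 0") (auto simp: C)
    qed
    have l: "AE x in lebesgue. (\<lambda>n. f n x) \<longlonglongrightarrow> \<phi> x" using fg(10) by auto
    show ?thesis using dominated_convergence_compact[OF m fg(3) b l] by blast
  qed
  have f2: "integrable lebesgue (\<lambda>x. d x * (grad d x \<bullet> \<gamma> x)) \<and>
    (\<lambda>n. \<integral>x. d x * (grad d x \<bullet> g n x) \<partial>lebesgue) \<longlonglongrightarrow> (\<integral>x. d x * (grad d x \<bullet> \<gamma> x) \<partial>lebesgue)"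
  proof -
    have m: "(\<lambda>x. d x * (grad d x \<bullet> g n x)) \<in> borel_measurable lebesgue" for n
      by (intro borel_measurable_times borel_measurable_inner grad_d_measurable cont_lebesgue_measurable cont_d fg(2))
    have b: "AE x in lebesgue. norm (d x * (grad d x \<bullet> g n x)) \<le> (s1 * C) * indicator T x" for n
      using AE_d
    proof eventually_elim
      fix x assume A: "(d has_derivative (\<lambda>v. grad d x \<bullet> v)) (at x) \<and> norm (grad d x) = 1"
      show "norm (d x * (grad d x \<bullet> g n x)) \<le> (s1 * C) * indicator T x"
      proof (cases "g n x = 0")
        case False
        then have x: "x \<in> T" by (rule fg(7))
        then have "\<bar>d x\<bar> \<le> s1" using fg(4) s1 infdist_nonneg[of x K] by (auto simp: d_def)
        moreover have "\<bar>grad d x \<bullet> g n x\<bar> \<le> C"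
          using Cauchy_Schwarz_ineq2[of "grad d x" "g n x"] A fg(8)[of n x] by simp
        ultimately show ?thesis using x s1 by (auto simp: abs_mult intro!: mult_mono)
      qed (use s1 C in auto)
    qed
    have l: "AE x in lebesgue. (\<lambda>n. d x * (grad d x \<bullet> g n x)) \<longlonglongrightarrow> d x * (grad d x \<bullet> \<gamma> x)"
      using \<gamma> by eventually_elim (intro tendsto_intros fg(11))
    show ?thesis using dominated_convergence_compact[OF m fg(3) b l] by blast
  qed
  show "integrable lebesgue (\<lambda>x. d x * (grad d x \<bullet> \<gamma> x))" "integrable lebesgue \<phi>" using f1 f2 by auto
  have le: "0 \<le> (p - real k) * ((\<integral>x. d x * (grad d x \<bullet> g n x) \<partial>lebesgue) + real k * (\<integral>x. f n x \<partial>lebesgue))" for n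
  proof -
    have gr: "grad (f n) = g n" using grad_eqI[OF fg(1)] by (simp add: fun_eq_iff)
    have cl: "closure {x. f n x \<noteq> 0} \<subseteq> T"
      using fg(3,6) by (intro closure_minimal) (auto intro: compact_imp_closed)
    then have "compact (closure {x. f n x \<noteq> 0})"
      using fg(3) by (meson closed_closure compact_imp_bounded bounded_subset compact_eq_bounded_closed)
    then have "f n \<in> Ck_c 1 (\<Omega> - K)"
      unfolding Ck_c_1_iff gr using fg(1,2,4) cl by blast
    then have "(p - real k) * A_fun \<Omega> k K (f n) \<le> 0"
      using superharmonic fg(12)[OF nonneg] by blast
    moreover have "A_fun \<Omega> k K (f n) = - (\<integral>x. d x * (grad d x \<bullet> g n x) \<partial>lebesgue) - real k * (\<integral>x. f n x \<partial>lebesgue)"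
    proof -
      have "(LINT x:\<Omega>|lebesgue. d x * (grad d x \<bullet> g n x)) = (\<integral>x. d x * (grad d x \<bullet> g n x) \<partial>lebesgue)"
        unfolding set_lebesgue_integral_def
      proof (rule Bochner_Integration.integral_cong)
        fix x show "indicator \<Omega> x *\<^sub>R (d x * (grad d x \<bullet> g n x)) = d x * (grad d x \<bullet> g n x)"
          using fg(4) fg(7)[of n x] by (cases "g n x = 0") (auto simp: indicator_def)
      qed simp
      moreover have "(LINT x:\<Omega>|lebesgue. f n x) = (\<integral>x. f n x \<partial>lebesgue)"
        unfolding set_lebesgue_integral_def
      proof (rule Bochner_Integration.integral_cong)
        fix x show "indicator \<Omega> x *\<^sub>R f n x = f n x"
          using fg(4) fg(6)[of n x] by (cases "f n x = 0") (auto simp: indicator_def)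
      qed simp
      ultimately show ?thesis by (simp add: A_fun_def gr d_eq)
    qed
    ultimately show ?thesis by (simp add: algebra_simps)
  qed
  show "0 \<le> (p - real k) * ((\<integral>x. d x * (grad d x \<bullet> \<gamma> x) \<partial>lebesgue) + real k * (\<integral>x. \<phi> x \<partial>lebesgue))"
  proof (rule LIMSEQ_le_const)
    show "(\<lambda>n. (p - real k) * ((\<integral>x. d x * (grad d x \<bullet> g n x) \<partial>lebesgue) + real k * (\<integral>x. f n x \<partial>lebesgue))) \<longlonglongrightarrow>
      (p - real k) * ((\<integral>x. d x * (grad d x \<bullet> \<gamma> x) \<partial>lebesgue) + real k * (\<integral>x. \<phi> x \<partial>lebesgue))"
      using f1 f2 by (intro tendsto_intros) auto
  qed (use le in auto)
qed

lemma test_integrable: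
  assumes u: "u \<in> Ck_c 1 (\<Omega> - K)"
  shows "integrable lebesgue (\<lambda>x. norm (grad u x) powr p)" "integrable lebesgue (\<lambda>x. \<bar>u x\<bar> powr p / d x powr p)"
    "integrable lebesgue (\<lambda>x. (Xd x)\<^sup>2 * norm (grad u x) powr p)"
    "integrable lebesgue (\<lambda>x. (Xd x)\<^sup>2 * (\<bar>u x\<bar> powr p / d x powr p))"
proof -
  obtain S where S: "compact S" "S \<subseteq> \<Omega> - K" "\<And>x. u x \<noteq> 0 \<Longrightarrow> x \<in> S" "\<And>x. grad u x \<noteq> 0 \<Longrightarrow> x \<in> S"
    and cont: "continuous_on UNIV (grad u)" "continuous_on UNIV u"
    using Ck_c_1_E[OF u] by metis
  have c: "continuous_on S (grad u)" "continuous_on S u" using cont by (auto intro: continuous_on_subset)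
  have dS: "d x > 0" if "x \<in> S" for x using that S(2) d_pos by blast
  show "integrable lebesgue (\<lambda>x. norm (grad u x) powr p)" "integrable lebesgue (\<lambda>x. \<bar>u x\<bar> powr p / d x powr p)"
    "integrable lebesgue (\<lambda>x. (Xd x)\<^sup>2 * norm (grad u x) powr p)"
    "integrable lebesgue (\<lambda>x. (Xd x)\<^sup>2 * (\<bar>u x\<bar> powr p / d x powr p))"
    by (rule integrable_cont_on_compact[OF S(1)];
        use c cont_Xd[OF S(2)] S(3,4) dS p in \<open>force intro!: continuous_intros continuous_on_powr' cont_d\<close>)+
qed

lemma weight_quotient:
  assumes "0 < s" "s < D"
  shows "((\<lambda>s. s powr (- p) * (1 + H * \<delta> * X (s / D))) has_real_derivative
    s powr (- p) * (- p * (1 + H * \<delta> * X (s / D)) + H * \<delta> * (X (s / D))\<^sup>2) / s) (at s)"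
proof -
  have "((\<lambda>s. s powr (- p)) has_real_derivative - p * s powr (- p - 1)) (at s)"
    using assms by (intro has_real_derivative_powr)
  moreover have "((\<lambda>s. 1 + H * \<delta> * X (s / D)) has_real_derivative 0 + H * \<delta> * ((X (s / D))\<^sup>2 / s)) (at s)"
    by (intro DERIV_add DERIV_const DERIV_cmult X_deriv assms)
  ultimately have "((\<lambda>s. s powr (- p) * (1 + H * \<delta> * X (s / D))) has_real_derivative
    - p * s powr (- p - 1) * (1 + H * \<delta> * X (s / D)) + (0 + H * \<delta> * ((X (s / D))\<^sup>2 / s)) * s powr (- p)) (at s)"
    by (rule DERIV_mult)
  moreover have "s powr (- p - 1) = s powr (- p) / s" using assms by (simp add: powr_diff)
  ultimately show ?thesis using assms by (simp add: field_simps)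
qed

text \<open>Reduced to an inequality of integrands: superharmonicity gives a nonnegative integral of
  \<open>\<Theta>\<close>, and \<open>hardy_constants\<close> bounds a positive multiple of
  \<open>\<Theta>\<close> almost everywhere by \<open>\<Psi>\<close>, whose integral is the Hardy
  difference minus the remainder.\<close>

lemma improved_hardy_C1:
  "\<exists>\<epsilon>>0. \<forall>u\<in>Ck_c 1 (\<Omega> - K).
    \<epsilon> * ((\<integral>x. (Xd x)\<^sup>2 * norm (grad u x) powr p \<partial>lebesgue) + (\<integral>x. (Xd x)\<^sup>2 * (\<bar>u x\<bar> powr p / d x powr p) \<partial>lebesgue))
      \<le> (\<integral>x. norm (grad u x) powr p \<partial>lebesgue) - \<bar>H\<bar> powr p * (\<integral>x. \<bar>u x\<bar> powr p / d x powr p \<partial>lebesgue)"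
proof -
  define M where "M = X (s1 / D)"
  have M: "M > 0" unfolding M_def by (rule X_pos[OF s1(1,2)])
  obtain \<delta> \<epsilon> where c: "\<delta> > 0" "\<epsilon> > 0"
    "\<And>y A B. 0 \<le> y \<Longrightarrow> y \<le> M \<Longrightarrow> 0 \<le> A \<Longrightarrow> 0 \<le> B \<Longrightarrow>
      p * (1 + H * \<delta> * y) * A powr (p - 1) * B \<le>
        (1 - \<epsilon> * y\<^sup>2) * B powr p + A powr p * (p * (1 + H * \<delta> * y) + \<delta> * y\<^sup>2 - 1 - \<epsilon> * y\<^sup>2)"
    "\<And>y. 0 \<le> y \<Longrightarrow> y \<le> M \<Longrightarrow> 1 + H * \<delta> * y > 0"
    by (rule hardy_constants[OF p H_nonzero, of M]) (use M in auto)
  \<comment> \<open>The second remainder integral comes with the factor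
    \<open>\<bar>H\<bar> powr p\<close>, which the minimum absorbs.\<close>
  define \<epsilon>' where "\<epsilon>' = \<epsilon> * min 1 (\<bar>H\<bar> powr p)"
  have \<epsilon>': "\<epsilon>' > 0" "\<epsilon>' \<le> \<epsilon>" "\<epsilon>' \<le> \<epsilon> * \<bar>H\<bar> powr p"
    using c H_nonzero by (auto simp: \<epsilon>'_def min_def)
  have "\<epsilon>' * ((\<integral>x. (Xd x)\<^sup>2 * norm (grad u x) powr p \<partial>lebesgue) + (\<integral>x. (Xd x)\<^sup>2 * (\<bar>u x\<bar> powr p / d x powr p) \<partial>lebesgue))
      \<le> (\<integral>x. norm (grad u x) powr p \<partial>lebesgue) - \<bar>H\<bar> powr p * (\<integral>x. \<bar>u x\<bar> powr p / d x powr p \<partial>lebesgue)"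
    if u: "u \<in> Ck_c 1 (\<Omega> - K)" for u
  proof -
    obtain S where S: "compact S" "S \<subseteq> \<Omega> - K" "\<And>x. u x \<noteq> 0 \<Longrightarrow> x \<in> S" "\<And>x. grad u x \<noteq> 0 \<Longrightarrow> x \<in> S"
      and D: "\<And>x. (u has_derivative (\<lambda>v. grad u x \<bullet> v)) (at x)" and cont: "continuous_on UNIV (grad u)" "continuous_on UNIV u"
      using Ck_c_1_E[OF u] by metis
    have dS: "d x > 0" if "x \<in> S" for x using that S(2) d_pos by blast
    define i1 where "i1 x = norm (grad u x) powr p" for x
    define i2 where "i2 x = \<bar>u x\<bar> powr p / d x powr p" for x
    have int: "integrable lebesgue i1" "integrable lebesgue i2" "integrable lebesgue (\<lambda>x. (Xd x)\<^sup>2 * i1 x)" "integrable lebesgue (\<lambda>x. (Xd x)\<^sup>2 * i2 x)"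
      unfolding i1_def[abs_def] i2_def[abs_def] by (rule test_integrable[OF u])+
    define B where "B x = \<bar>u x\<bar> powr p" for x
    define G where "G x = (p * (\<bar>u x\<bar> powr (p - 1) * sgn (u x))) *\<^sub>R grad u x" for x
    have BD: "(B has_derivative (\<lambda>v. G x \<bullet> v)) (at x)" for x
    proof -
      have "((\<lambda>s. \<bar>s\<bar> powr p) has_derivative (*) (p * (\<bar>u x\<bar> powr (p - 1) * sgn (u x)))) (at (u x))"
        using has_real_derivative_abs_powr[OF p] by (simp add: has_field_derivative_def)
      from diff_chain_at[OF D this] show ?thesis by (simp add: o_def B_def[abs_def] G_def)
    qed
    have cG: "continuous_on UNIV G"
      unfolding G_def[abs_def] using cont p
      by (auto intro!: continuous_intros continuous_on_compose2[OF continuous_on_abs_powr_sgn cont(2)])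
    define F where "F s = s powr (- p) * (1 + H * \<delta> * X (s / D))" for s
    define F' where "F' s = s powr (- p) * (- p * (1 + H * \<delta> * X (s / D)) + H * \<delta> * (X (s / D))\<^sup>2) / s" for s
    define \<phi> where "\<phi> x = F (d x) * B x" for x
    define \<gamma> where "\<gamma> x = (F' (d x) * B x) *\<^sub>R grad d x + F (d x) *\<^sub>R G x" for x
    have FD: "(F has_real_derivative F' s) (at s)" if "0 < s" "s < D" for s
      unfolding F_def[abs_def] F'_def by (rule weight_quotient[OF that])
    have F'c: "continuous_on {0<..<D} F'"
      unfolding F'_def[abs_def] by (auto intro!: continuous_intros continuous_on_X)
    have BS: "B x \<noteq> 0 \<Longrightarrow> x \<in> S" for x using S(3) by (auto simp: B_def)
    have Sd: "S \<inter> K = {}" "\<And>x. x \<in> S \<Longrightarrow> d x < D" using S(2) d_lt by auto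
    have "\<exists>L. \<forall>x y. \<bar>\<phi> x - \<phi> y\<bar> \<le> L * norm (x - y)"
      using weighted_lipschitz(1)[OF K FD F'c BD cG S(1) BS Sd(1) Sd(2)[unfolded d_eq]] by (simp add: \<phi>_def d_def)
    then obtain L where L: "\<And>x y. \<bar>\<phi> x - \<phi> y\<bar> \<le> L * norm (x - y)" by blast
    have \<gamma>: "AE x in lebesgue. (\<phi> has_derivative (\<lambda>v. \<gamma> x \<bullet> v)) (at x)"
      using weighted_lipschitz(2)[OF K FD F'c BD cG S(1) BS Sd(1) Sd(2)[unfolded d_eq]]
      by (simp add: \<phi>_def[abs_def] \<gamma>_def d_eq)
    have XM: "0 \<le> Xd x" "Xd x \<le> M" if "x \<in> S" for x using Xd_bounds[of x] that S(2) by (auto simp: M_def)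
    have gp: "1 + H * \<delta> * Xd x > 0" if "x \<in> S" for x using c(4) XM[OF that] by blast
    have \<phi>S: "\<phi> x \<noteq> 0 \<Longrightarrow> x \<in> S" for x using BS by (auto simp: \<phi>_def)
    have \<phi>0: "0 \<le> \<phi> x" for x
    proof (cases "x \<in> S")
      case True
      then show ?thesis using gp[of x] by (simp add: \<phi>_def F_def B_def Xd_def)
    next
      case False
      then have "\<phi> x = 0" using \<phi>S by blast
      then show ?thesis by simp
    qed
    note sl = superharmonic_lipschitz[OF L S(1) \<phi>S S(2) \<phi>0 \<gamma>]
    define \<Theta> where "\<Theta> x = (p - real k) * (d x * (grad d x \<bullet> \<gamma> x) + real k * \<phi> x)" for x
    have \<Theta>: "integrable lebesgue \<Theta>" "0 \<le> (\<integral>x. \<Theta> x \<partial>lebesgue)"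
      using sl unfolding \<Theta>_def[abs_def] by auto
    define \<Psi> where "\<Psi> x = i1 x - \<epsilon> * ((Xd x)\<^sup>2 * i1 x) - \<bar>H\<bar> powr p * i2 x - \<epsilon> * \<bar>H\<bar> powr p * ((Xd x)\<^sup>2 * i2 x)" for x
    have \<Psi>: "integrable lebesgue \<Psi>" unfolding \<Psi>_def[abs_def] using int by auto
    \<comment> \<open>The factor turns the coefficient p H^2 of |u|^p / d^p in
      \<open>\<Theta>\<close> into |H|^p, so that the term becomes a^p with a = |H| |u| / d.\<close>
    have "(\<integral>x. \<bar>H\<bar> powr (p - 2) / p * \<Theta> x \<partial>lebesgue) \<le> (\<integral>x. \<Psi> x \<partial>lebesgue)"
    proof (rule integral_mono_AE[OF _ \<Psi>])
      show "integrable lebesgue (\<lambda>x. \<bar>H\<bar> powr (p - 2) / p * \<Theta> x)" using \<Theta>(1) by simp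
      show "AE x in lebesgue. \<bar>H\<bar> powr (p - 2) / p * \<Theta> x \<le> \<Psi> x"
        using AE_d
      proof eventually_elim
        fix x assume A: "(d has_derivative (\<lambda>v. grad d x \<bullet> v)) (at x) \<and> norm (grad d x) = 1"
        show "\<bar>H\<bar> powr (p - 2) / p * \<Theta> x \<le> \<Psi> x"
        proof (cases "x \<in> S")
          case False
          then have "u x = 0" "grad u x = 0" using S(3,4) by blast+
          then show ?thesis by (simp add: \<Theta>_def \<Psi>_def \<phi>_def \<gamma>_def B_def G_def i1_def i2_def)
        next
          case True
          define \<tau> where "\<tau> = d x"
          define g where "g = 1 + H * \<delta> * Xd x"
          define y where "y = Xd x"
          define m where "m = grad d x \<bullet> G x"
          have \<tau>: "\<tau> > 0" using dS[OF True] by (simp add: \<tau>_def)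
          have g0: "g > 0" using gp[OF True] by (simp add: g_def)
          have nn: "grad d x \<bullet> grad d x = 1" using A by (simp add: norm_eq_1)
          have F1: "F (d x) = \<tau> powr (- p) * g" by (simp add: F_def \<tau>_def g_def Xd_def)
          have F2: "\<tau> * F' (d x) = \<tau> powr (- p) * (- p * g + H * \<delta> * y\<^sup>2)"
            using \<tau> by (simp add: F'_def \<tau>_def g_def Xd_def y_def)
          \<comment> \<open>Adding k to the -p produced by differentiating d^(-p) leaves p H; the
            outer factor -p H then makes the coefficient a multiple of H^2, independent of the sign
            of H.\<close>
          have pk: "p - real k = - (p * H)" "real k = p + p * H" using p by (auto simp: H_def field_simps)
          have "\<Theta> x = (p - real k) * ((\<tau> * F' (d x)) * B x + \<tau> * F (d x) * m + real k * (F (d x) * B x))"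
            by (simp add: \<Theta>_def \<gamma>_def \<phi>_def inner_add_right nn m_def \<tau>_def algebra_simps)
          also have "\<dots> = - (p * H) * (\<tau> powr (- p) * B x * (p * H * g + H * \<delta> * y\<^sup>2) + \<tau> * \<tau> powr (- p) * g * m)"
            unfolding F1 F2 pk by (simp add: algebra_simps)
          also have "\<dots> = p * (- (H\<^sup>2) * (\<tau> powr (- p) * B x) * (p * g + \<delta> * y\<^sup>2) + (\<tau> * \<tau> powr (- p)) * g * (- H * m))"
            by (simp add: algebra_simps power2_eq_square)
          finally have T0: "\<Theta> x = p * (- (H\<^sup>2) * (\<tau> powr (- p) * B x) * (p * g + \<delta> * y\<^sup>2) + (\<tau> * \<tau> powr (- p)) * g * (- H * m))" .
          have pull: "h / p * (p * (- e * b * f + t * g * n)) = - (h * e) * b * f + h * t * g * n" for h e b f t n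
            using p by (simp add: algebra_simps)
          have T: "\<bar>H\<bar> powr (p - 2) / p * \<Theta> x = - (\<bar>H\<bar> powr (p - 2) * H\<^sup>2) * (\<tau> powr (- p) * B x) * (p * g + \<delta> * y\<^sup>2)
             + \<bar>H\<bar> powr (p - 2) * (\<tau> * \<tau> powr (- p)) * g * (- H * m)"
            unfolding T0 by (rule pull)
          define a where "a = \<bar>H\<bar> * \<bar>u x\<bar> / \<tau>"
          have hp: "\<bar>H\<bar> powr (p - 2) * H\<^sup>2 = \<bar>H\<bar> powr p" "\<bar>H\<bar> powr (p - 2) * \<bar>H\<bar> = \<bar>H\<bar> powr (p - 1)"
          proof -
            have "H\<^sup>2 = \<bar>H\<bar> powr 2" using H_nonzero by simp
            then have "\<bar>H\<bar> powr (p - 2) * H\<^sup>2 = \<bar>H\<bar> powr (p - 2) * \<bar>H\<bar> powr 2" by (simp only:)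
            also have "\<dots> = \<bar>H\<bar> powr p" unfolding powr_add[symmetric] by simp
            finally show "\<bar>H\<bar> powr (p - 2) * H\<^sup>2 = \<bar>H\<bar> powr p" .
            have "\<bar>H\<bar> = \<bar>H\<bar> powr 1" using H_nonzero by simp
            then have "\<bar>H\<bar> powr (p - 2) * \<bar>H\<bar> = \<bar>H\<bar> powr (p - 2) * \<bar>H\<bar> powr 1" by simp
            also have "\<dots> = \<bar>H\<bar> powr (p - 1)" unfolding powr_add[symmetric] by simp
            finally show "\<bar>H\<bar> powr (p - 2) * \<bar>H\<bar> = \<bar>H\<bar> powr (p - 1)" .
          qed
          have tp: "\<tau> * \<tau> powr (- p) = \<tau> powr (1 - p)" using \<tau> by (simp add: powr_diff powr_minus field_simps)
          have ap: "a powr p = \<bar>H\<bar> powr p * (\<tau> powr (- p) * B x)"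
            using \<tau> by (simp add: a_def B_def powr_divide powr_mult powr_minus field_simps)
          have ap': "a powr p = \<bar>H\<bar> powr p * i2 x"
            using \<tau> by (simp add: a_def i2_def \<tau>_def powr_divide powr_mult)
          have ap1: "a powr (p - 1) = \<bar>H\<bar> powr (p - 1) * (\<tau> powr (1 - p)) * \<bar>u x\<bar> powr (p - 1)"
          proof -
            have "\<tau> powr (1 - p) = inverse (\<tau> powr (p - 1))" by (simp flip: powr_minus)
            then show ?thesis using \<tau> by (simp add: a_def powr_divide powr_mult field_simps)
          qed
          have mb: "- H * m \<le> \<bar>H\<bar> * (p * \<bar>u x\<bar> powr (p - 1) * norm (grad u x))"
          proof -
            have "\<bar>m\<bar> \<le> norm (G x)" using Cauchy_Schwarz_ineq2[of "grad d x" "G x"] A by (simp add: m_def)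
            also have "\<dots> \<le> p * \<bar>u x\<bar> powr (p - 1) * norm (grad u x)"
              using p by (auto simp: G_def abs_mult sgn_if)
            finally have "\<bar>H\<bar> * \<bar>m\<bar> \<le> \<bar>H\<bar> * (p * \<bar>u x\<bar> powr (p - 1) * norm (grad u x))" by (rule mult_left_mono) simp
            then show ?thesis by (simp add: abs_mult[symmetric])
          qed
          have "\<bar>H\<bar> powr (p - 2) / p * \<Theta> x \<le> - (a powr p) * (p * g + \<delta> * y\<^sup>2)
             + \<bar>H\<bar> powr (p - 2) * \<tau> powr (1 - p) * g * (\<bar>H\<bar> * (p * \<bar>u x\<bar> powr (p - 1) * norm (grad u x)))"
            unfolding T hp(1) tp ap using g0 by (intro add_mono mult_left_mono mb) auto
          also have "\<dots> = - (a powr p) * (p * g + \<delta> * y\<^sup>2) + p * g * a powr (p - 1) * norm (grad u x)"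
            unfolding ap1 hp(2)[symmetric] by (simp add: algebra_simps)
          also have "\<dots> \<le> - (a powr p) * (p * g + \<delta> * y\<^sup>2) + ((1 - \<epsilon> * y\<^sup>2) * norm (grad u x) powr p + a powr p * (p * g + \<delta> * y\<^sup>2 - 1 - \<epsilon> * y\<^sup>2))"
            unfolding g_def y_def using XM[OF True] \<tau> by (intro add_left_mono c(3)) (auto simp: a_def)
          also have "\<dots> = \<Psi> x" unfolding \<Psi>_def ap' i1_def y_def by (simp add: algebra_simps)
          finally show ?thesis .
        qed
      qed
    qed
    moreover have "0 \<le> \<bar>H\<bar> powr (p - 2) / p * (\<integral>x. \<Theta> x \<partial>lebesgue)"
      using \<Theta>(2) p by (intro mult_nonneg_nonneg divide_nonneg_pos) auto
    ultimately have "0 \<le> (\<integral>x. \<Psi> x \<partial>lebesgue)" by simp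
    also have "\<dots> = (\<integral>x. i1 x \<partial>lebesgue) - \<epsilon> * (\<integral>x. (Xd x)\<^sup>2 * i1 x \<partial>lebesgue) - \<bar>H\<bar> powr p * (\<integral>x. i2 x \<partial>lebesgue)
      - \<epsilon> * \<bar>H\<bar> powr p * (\<integral>x. (Xd x)\<^sup>2 * i2 x \<partial>lebesgue)"
      unfolding \<Psi>_def[abs_def] using int by simp
    finally have fin: "\<epsilon> * (\<integral>x. (Xd x)\<^sup>2 * i1 x \<partial>lebesgue) + \<epsilon> * \<bar>H\<bar> powr p * (\<integral>x. (Xd x)\<^sup>2 * i2 x \<partial>lebesgue)
      \<le> (\<integral>x. i1 x \<partial>lebesgue) - \<bar>H\<bar> powr p * (\<integral>x. i2 x \<partial>lebesgue)" by simp
    have "0 \<le> (\<integral>x. (Xd x)\<^sup>2 * i1 x \<partial>lebesgue)" "0 \<le> (\<integral>x. (Xd x)\<^sup>2 * i2 x \<partial>lebesgue)"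
      by (auto intro!: Bochner_Integration.integral_nonneg simp: i1_def i2_def)
    then have "\<epsilon>' * (\<integral>x. (Xd x)\<^sup>2 * i1 x \<partial>lebesgue) + \<epsilon>' * (\<integral>x. (Xd x)\<^sup>2 * i2 x \<partial>lebesgue)
      \<le> \<epsilon> * (\<integral>x. (Xd x)\<^sup>2 * i1 x \<partial>lebesgue) + \<epsilon> * \<bar>H\<bar> powr p * (\<integral>x. (Xd x)\<^sup>2 * i2 x \<partial>lebesgue)"
      using \<epsilon>' by (intro add_mono mult_right_mono) auto
    with fin show ?thesis unfolding i1_def i2_def by (simp add: distrib_left)
  qed
  then show ?thesis using \<epsilon>'(1) by blast
qed

text \<open>Sobolev's inequality for X^(2/p) u. The p-th powers of the two parts of its gradient are
  X^2 |grad u|^p and a constant times X^(2+p) |u|^p / d^p; since X is bounded, both are controlled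
  by the remainder of the Hardy inequality.\<close>

lemma weighted_sobolev_C1:
  assumes pN: "p < DIM('a)"
  defines "N \<equiv> real DIM('a)"
  shows "\<exists>C\<ge>0. \<forall>u\<in>Ck_c 1 (\<Omega> - K).
    integrable lebesgue (\<lambda>x. \<bar>Xd x powr (2 / p) * u x\<bar> powr (N * p / (N - p))) \<and>
    (\<integral>x. \<bar>Xd x powr (2 / p) * u x\<bar> powr (N * p / (N - p)) \<partial>lebesgue) powr ((N - p) / N)
    \<le> C * ((\<integral>x. (Xd x)\<^sup>2 * norm (grad u x) powr p \<partial>lebesgue) + (\<integral>x. (Xd x)\<^sup>2 * (\<bar>u x\<bar> powr p / d x powr p) \<partial>lebesgue))"
proof -
  define M where "M = X (s1 / D)"
  have M: "M > 0" unfolding M_def by (rule X_pos[OF s1(1,2)])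
  define C0 where "C0 = (p * (N - 1) / (N - p)) powr p"
  \<comment> \<open>The 2^p comes from (a + b)^p <= 2^p (a^p + b^p), and the second entry of the
    maximum bounds the coefficient (2/p)^p X^p of the term with u/d.\<close>
  define C1 where "C1 = 2 powr p * max 1 ((2 / p) powr p * M powr p)"
  have C: "0 \<le> C0" "0 \<le> C1" by (auto simp: C0_def C1_def)
  have "integrable lebesgue (\<lambda>x. \<bar>Xd x powr (2 / p) * u x\<bar> powr (N * p / (N - p))) \<and>
    (\<integral>x. \<bar>Xd x powr (2 / p) * u x\<bar> powr (N * p / (N - p)) \<partial>lebesgue) powr ((N - p) / N)
    \<le> C0 * C1 * ((\<integral>x. (Xd x)\<^sup>2 * norm (grad u x) powr p \<partial>lebesgue) + (\<integral>x. (Xd x)\<^sup>2 * (\<bar>u x\<bar> powr p / d x powr p) \<partial>lebesgue))"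
    if u: "u \<in> Ck_c 1 (\<Omega> - K)" for u
  proof -
    obtain S where S: "compact S" "S \<subseteq> \<Omega> - K" "\<And>x. u x \<noteq> 0 \<Longrightarrow> x \<in> S" "\<And>x. grad u x \<noteq> 0 \<Longrightarrow> x \<in> S"
      and D: "\<And>x. (u has_derivative (\<lambda>v. grad u x \<bullet> v)) (at x)" and cont: "continuous_on UNIV (grad u)" "continuous_on UNIV u"
      using Ck_c_1_E[OF u] by metis
    have dS: "d x > 0" if "x \<in> S" for x using that S(2) d_pos by blast
    define i1 where "i1 x = norm (grad u x) powr p" for x
    define i2 where "i2 x = \<bar>u x\<bar> powr p / d x powr p" for x
    have int: "integrable lebesgue (\<lambda>x. (Xd x)\<^sup>2 * i1 x)" "integrable lebesgue (\<lambda>x. (Xd x)\<^sup>2 * i2 x)"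
      unfolding i1_def[abs_def] i2_def[abs_def] by (rule test_integrable[OF u])+
    define F where "F s = X (s / D) powr (2 / p)" for s
    define F' where "F' s = 2 / p * X (s / D) powr (2 / p - 1) * ((X (s / D))\<^sup>2 / s)" for s
    define w where "w x = F (d x) * u x" for x
    define \<omega> where "\<omega> x = (F' (d x) * u x) *\<^sub>R grad d x + F (d x) *\<^sub>R grad u x" for x
    have FD: "(F has_real_derivative F' s) (at s)" if "0 < s" "s < D" for s
    proof -
      have "((\<lambda>x. x powr (2 / p)) has_real_derivative 2 / p * X (s / D) powr (2 / p - 1)) (at (X (s / D)))"
        using X_pos[OF that] by (intro has_real_derivative_powr)
      from DERIV_chain2[OF this X_deriv[OF that]] show ?thesis by (simp add: F_def[abs_def] F'_def)
    qed
    have F'c: "continuous_on {0<..<D} F'"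
    proof -
      have nz: "\<forall>s\<in>{0<..<D}. X (s / D) \<noteq> 0" using X_pos by (metis greaterThanLessThan_iff less_irrefl)
      show ?thesis unfolding F'_def[abs_def]
        by (intro continuous_intros continuous_on_X) (use nz in auto)
    qed
    have Sd: "S \<inter> K = {}" "\<And>x. x \<in> S \<Longrightarrow> d x < D" using S(2) d_lt by auto
    have "\<exists>L. \<forall>x y. \<bar>w x - w y\<bar> \<le> L * norm (x - y)"
      using weighted_lipschitz(1)[OF K FD F'c D cont(1) S(1,3) Sd(1) Sd(2)[unfolded d_eq]] by (simp add: w_def d_def)
    then obtain L where L: "\<And>x y. \<bar>w x - w y\<bar> \<le> L * norm (x - y)" by blast
    have \<omega>: "AE x in lebesgue. (w has_derivative (\<lambda>v. \<omega> x \<bullet> v)) (at x)"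
      using weighted_lipschitz(2)[OF K FD F'c D cont(1) S(1,3) Sd(1) Sd(2)[unfolded d_eq]]
      by (simp add: w_def[abs_def] \<omega>_def d_eq)
    have wS: "w x \<noteq> 0 \<Longrightarrow> x \<in> S" for x using S(3) by (auto simp: w_def)
    note sob = sobolev_inequality_lipschitz[OF p pN L S(1) wS \<omega>]
    have "(\<integral>x. norm (\<omega> x) powr p \<partial>lebesgue) \<le> (\<integral>x. C1 * ((Xd x)\<^sup>2 * i1 x + (Xd x)\<^sup>2 * i2 x) \<partial>lebesgue)"
    proof (rule integral_mono_AE')
      show "integrable lebesgue (\<lambda>x. C1 * ((Xd x)\<^sup>2 * i1 x + (Xd x)\<^sup>2 * i2 x))" using int by auto
      show "AE x in lebesgue. 0 \<le> C1 * ((Xd x)\<^sup>2 * i1 x + (Xd x)\<^sup>2 * i2 x)"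
        using C by (intro AE_I2 mult_nonneg_nonneg add_nonneg_nonneg) (auto simp: i1_def i2_def)
      show "AE x in lebesgue. norm (\<omega> x) powr p \<le> C1 * ((Xd x)\<^sup>2 * i1 x + (Xd x)\<^sup>2 * i2 x)"
        using AE_d
      proof eventually_elim
        fix x assume A: "(d has_derivative (\<lambda>v. grad d x \<bullet> v)) (at x) \<and> norm (grad d x) = 1"
        show "norm (\<omega> x) powr p \<le> C1 * ((Xd x)\<^sup>2 * i1 x + (Xd x)\<^sup>2 * i2 x)"
        proof (cases "x \<in> S")
          case False
          then have "u x = 0" "grad u x = 0" using S(3,4) by blast+
          then show ?thesis by (simp add: \<omega>_def i1_def i2_def)
        next
          case True
          define y where "y = Xd x"
          have y: "0 < y" "y \<le> M" using Xd_bounds[of x] True S(2) by (auto simp: M_def y_def)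
          define a b where "a = y powr (2 / p) * norm (grad u x)" and "b = 2 / p * y powr (2 / p + 1) * (\<bar>u x\<bar> / d x)"
          have dx: "d x > 0" by (rule dS[OF True])
          have ab: "0 \<le> a" "0 \<le> b" using p dx by (auto simp: a_def b_def)
          have "F' (d x) = 2 / p * y powr (2 / p + 1) / d x"
          proof -
            have "y\<^sup>2 = y powr 2" using y by simp
            then have "y powr (2 / p - 1) * y\<^sup>2 = y powr (2 / p + 1)" by (simp add: add.commute flip: powr_add)
            then show ?thesis by (simp add: F'_def y_def Xd_def)
          qed
          then have "\<bar>F' (d x) * u x\<bar> = b" using p dx by (simp add: b_def abs_mult)
          moreover have "\<bar>F (d x)\<bar> = y powr (2 / p)" by (simp add: F_def y_def Xd_def)
          ultimately have "norm (\<omega> x) \<le> b + a"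
            using A by (auto simp: \<omega>_def a_def intro!: order_trans[OF norm_triangle_ineq])
          also have "\<dots> \<le> 2 * max a b" by simp
          finally have "norm (\<omega> x) powr p \<le> (2 * max a b) powr p" using p by (intro powr_mono2) auto
          also have "\<dots> = 2 powr p * max a b powr p" using ab by (simp add: powr_mult)
          also have "\<dots> \<le> 2 powr p * (a powr p + b powr p)" by (intro mult_left_mono) (auto simp: max_def)
          also have "a powr p = y\<^sup>2 * i1 x"
            using p y by (simp add: a_def i1_def powr_mult powr_powr)
          also have "b powr p = (2 / p) powr p * y powr p * (y\<^sup>2 * i2 x)"
          proof -
            have ex: "(2 / p + 1) * p = 2 + p" using p by (simp add: field_simps)
            have "(y powr (2 / p + 1)) powr p = y powr (2 + p)" unfolding powr_powr ex ..
            also have "\<dots> = y\<^sup>2 * y powr p" using y by (simp add: powr_add)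
            finally show ?thesis using p dx y by (simp add: b_def i2_def powr_mult powr_divide)
          qed
          also have "2 powr p * (y\<^sup>2 * i1 x + (2 / p) powr p * y powr p * (y\<^sup>2 * i2 x))
            \<le> 2 powr p * (max 1 ((2 / p) powr p * M powr p) * (y\<^sup>2 * i1 x) + max 1 ((2 / p) powr p * M powr p) * (y\<^sup>2 * i2 x))"
          proof (intro mult_left_mono add_mono)
            have "(2 / p) powr p * y powr p \<le> (2 / p) powr p * M powr p"
              using y p by (intro mult_left_mono powr_mono2) auto
            then show "(2 / p) powr p * y powr p * (y\<^sup>2 * i2 x) \<le> max 1 ((2 / p) powr p * M powr p) * (y\<^sup>2 * i2 x)"
              by (intro mult_right_mono) (auto simp: i2_def)
            have "1 * (y\<^sup>2 * i1 x) \<le> max 1 ((2 / p) powr p * M powr p) * (y\<^sup>2 * i1 x)"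
              by (intro mult_right_mono) (auto simp: i1_def)
            then show "y\<^sup>2 * i1 x \<le> max 1 ((2 / p) powr p * M powr p) * (y\<^sup>2 * i1 x)" by simp
          qed auto
          finally show ?thesis by (simp add: C1_def y_def distrib_left mult.assoc)
        qed
      qed
    qed
    also have "\<dots> = C1 * ((\<integral>x. (Xd x)\<^sup>2 * i1 x \<partial>lebesgue) + (\<integral>x. (Xd x)\<^sup>2 * i2 x \<partial>lebesgue))"
      using int by simp
    finally have "C0 * (\<integral>x. norm (\<omega> x) powr p \<partial>lebesgue) \<le> C0 * (C1 * ((\<integral>x. (Xd x)\<^sup>2 * i1 x \<partial>lebesgue) + (\<integral>x. (Xd x)\<^sup>2 * i2 x \<partial>lebesgue)))"
      using C by (intro mult_left_mono)
    with sob show ?thesis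
      unfolding C0_def[symmetric] N_def[symmetric] by (auto simp: w_def F_def Xd_def i1_def i2_def mult.assoc)
  qed
  then show ?thesis using C by (intro exI[of _ "C0 * C1"]) auto
qed

text \<open>The weight \<open>d\<^sup>-\<^sup>q\<^sup>-\<^sup>N\<^sup>+\<^sup>N\<^sup>q\<^sup>/\<^sup>p X\<^sup>2\<^sup>q\<^sup>/\<^sup>p\<close> interpolates between the weights \<open>X\<^sup>2 d\<^sup>-\<^sup>p\<close> at \<open>q = p\<close>
  and \<open>X\<^sup>2\<^sup>q\<^sup>/\<^sup>p\<close> at the critical exponent \<open>q = Np/(N-p)\<close>.\<close>

lemma hardy_sobolev_C1:
  assumes pN: "p < DIM('a)" and q: "p < q" "q \<le> real DIM('a) * p / (real DIM('a) - p)"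
  shows "\<exists>c>0. \<forall>u\<in>Ck_c 1 (\<Omega> - K).
    integrable lebesgue (\<lambda>x. norm (grad u x) powr p) \<and>
    integrable lebesgue (\<lambda>x. \<bar>u x\<bar> powr p / d x powr p) \<and>
    integrable lebesgue (\<lambda>x. \<bar>u x\<bar> powr q * d x powr (- q - real DIM('a) + real DIM('a) * q / p) * Xd x powr (2 * q / p)) \<and>
    c * (\<integral>x. \<bar>u x\<bar> powr q * d x powr (- q - real DIM('a) + real DIM('a) * q / p) * Xd x powr (2 * q / p) \<partial>lebesgue) powr (p / q)
      \<le> (\<integral>x. norm (grad u x) powr p \<partial>lebesgue) - \<bar>H\<bar> powr p * (\<integral>x. \<bar>u x\<bar> powr p / d x powr p \<partial>lebesgue)"
proof -
  define N where "N = real DIM('a)"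
  define P where "P = N * p / (N - p)"
  have N: "p < N" using pN by (simp add: N_def)
  have P: "p < P" "P * (N - p) = N * p" "p / P = (N - p) / N" "P - p = p * p / (N - p)"
    using N p by (auto simp: P_def field_simps)
  \<comment> \<open>Solves (1 - theta) p + theta P = q. The exponent of d in the target is then -p
    (1 - theta), and that of X is 2 (1 - theta) + 2 theta P/p = 2 q/p.\<close>
  define \<theta> where "\<theta> = (q - p) / (P - p)"
  have qP: "q \<le> P" using q by (simp add: P_def N_def)
  have \<theta>: "0 < \<theta>" "\<theta> \<le> 1" "(1 - \<theta>) * p + \<theta> * P = q"
  proof -
    show "0 < \<theta>" "\<theta> \<le> 1" using q qP P(1) by (auto simp: \<theta>_def)
    have "\<theta> * (P - p) = q - p" using P(1) by (simp add: \<theta>_def)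
    then show "(1 - \<theta>) * p + \<theta> * P = q" by (simp add: algebra_simps)
  qed
  define e where "e = - q - N + N * q / p"
  have e: "e = - (p * (1 - \<theta>))"
  proof -
    have "\<theta> * (P - p) = q - p" using P(1) by (simp add: \<theta>_def)
    then have "\<theta> * (p * p) = (q - p) * (N - p)" unfolding P(4) using N by (simp add: field_simps)
    then have "\<theta> * p = (q - p) * (N - p) / p" using p by (simp add: field_simps)
    then show ?thesis using p by (simp add: e_def field_simps)
  qed
  obtain \<epsilon> where \<epsilon>: "\<epsilon> > 0" and hardy: "\<And>u. u \<in> Ck_c 1 (\<Omega> - K) \<Longrightarrow>
    \<epsilon> * ((\<integral>x. (Xd x)\<^sup>2 * norm (grad u x) powr p \<partial>lebesgue) + (\<integral>x. (Xd x)\<^sup>2 * (\<bar>u x\<bar> powr p / d x powr p) \<partial>lebesgue))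
      \<le> (\<integral>x. norm (grad u x) powr p \<partial>lebesgue) - \<bar>H\<bar> powr p * (\<integral>x. \<bar>u x\<bar> powr p / d x powr p \<partial>lebesgue)"
    using improved_hardy_C1 by blast
  obtain C where C: "C \<ge> 0" and sob: "\<And>u. u \<in> Ck_c 1 (\<Omega> - K) \<Longrightarrow>
    integrable lebesgue (\<lambda>x. \<bar>Xd x powr (2 / p) * u x\<bar> powr P) \<and>
    (\<integral>x. \<bar>Xd x powr (2 / p) * u x\<bar> powr P \<partial>lebesgue) powr ((N - p) / N)
    \<le> C * ((\<integral>x. (Xd x)\<^sup>2 * norm (grad u x) powr p \<partial>lebesgue) + (\<integral>x. (Xd x)\<^sup>2 * (\<bar>u x\<bar> powr p / d x powr p) \<partial>lebesgue))"
    using weighted_sobolev_C1[OF pN] unfolding P_def N_def by blast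
  \<comment> \<open>One constant for both end points: the integral of f and the p/P-th power of the
    integral of g are each at most C2 times the Hardy difference.\<close>
  define C2 where "C2 = max 1 C / \<epsilon>"
  have C2: "C2 > 0" "1 / \<epsilon> \<le> C2" "C / \<epsilon> \<le> C2" using \<epsilon> by (auto simp: C2_def divide_right_mono)
  have "integrable lebesgue (\<lambda>x. norm (grad u x) powr p) \<and>
    integrable lebesgue (\<lambda>x. \<bar>u x\<bar> powr p / d x powr p) \<and>
    integrable lebesgue (\<lambda>x. \<bar>u x\<bar> powr q * d x powr e * Xd x powr (2 * q / p)) \<and>
    (1 / C2) * (\<integral>x. \<bar>u x\<bar> powr q * d x powr e * Xd x powr (2 * q / p) \<partial>lebesgue) powr (p / q)
      \<le> (\<integral>x. norm (grad u x) powr p \<partial>lebesgue) - \<bar>H\<bar> powr p * (\<integral>x. \<bar>u x\<bar> powr p / d x powr p \<partial>lebesgue)"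
    if u: "u \<in> Ck_c 1 (\<Omega> - K)" for u
  proof -
    obtain S where S: "compact S" "S \<subseteq> \<Omega> - K" "\<And>x. u x \<noteq> 0 \<Longrightarrow> x \<in> S" "\<And>x. grad u x \<noteq> 0 \<Longrightarrow> x \<in> S"
      and D: "\<And>x. (u has_derivative (\<lambda>v. grad u x \<bullet> v)) (at x)" and cont: "continuous_on UNIV (grad u)" "continuous_on UNIV u"
      using Ck_c_1_E[OF u] by metis
    have dS: "d x > 0" if "x \<in> S" for x using that S(2) d_pos by blast
    define i1 where "i1 x = norm (grad u x) powr p" for x
    define i2 where "i2 x = \<bar>u x\<bar> powr p / d x powr p" for x
    have int: "integrable lebesgue (\<lambda>x. (Xd x)\<^sup>2 * i2 x)"
      unfolding i1_def[abs_def] i2_def[abs_def] by (rule test_integrable[OF u])+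
    define f where "f x = (Xd x)\<^sup>2 * i2 x" for x
    define g where "g x = \<bar>Xd x powr (2 / p) * u x\<bar> powr P" for x
    define I where "I = (\<integral>x. i1 x \<partial>lebesgue) - \<bar>H\<bar> powr p * (\<integral>x. i2 x \<partial>lebesgue)"
    define E where "E = (\<integral>x. (Xd x)\<^sup>2 * i1 x \<partial>lebesgue) + (\<integral>x. f x \<partial>lebesgue)"
    have fg: "integrable lebesgue f" "integrable lebesgue g" "\<And>x. 0 \<le> f x" "\<And>x. 0 \<le> g x"
      using int sob[OF u] by (auto simp: f_def[abs_def] g_def[abs_def] i2_def)
    have 0: "0 \<le> (\<integral>x. (Xd x)\<^sup>2 * i1 x \<partial>lebesgue)" "0 \<le> (\<integral>x. f x \<partial>lebesgue)" "0 \<le> (\<integral>x. g x \<partial>lebesgue)"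
      using fg(3,4) by (auto intro!: Bochner_Integration.integral_nonneg simp: i1_def)
    have EI: "\<epsilon> * E \<le> I" using hardy[OF u] by (simp add: E_def I_def i1_def i2_def f_def)
    have E0: "0 \<le> E" using 0 by (simp add: E_def)
    have I0: "0 \<le> I" using EI E0 \<epsilon> by (meson mult_nonneg_nonneg less_imp_le order_trans)
    have EI': "E \<le> I / \<epsilon>" using EI \<epsilon> by (simp add: field_simps)
    have fI: "(\<integral>x. f x \<partial>lebesgue) \<le> C2 * I"
    proof -
      have "(\<integral>x. f x \<partial>lebesgue) \<le> 1 / \<epsilon> * I" using EI' 0 by (simp add: E_def)
      also have "\<dots> \<le> C2 * I" using C2 I0 by (intro mult_right_mono)
      finally show ?thesis .
    qed
    have gI: "(\<integral>x. g x \<partial>lebesgue) \<le> (C2 * I) powr (P / p)"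
    proof -
      have "(\<integral>x. g x \<partial>lebesgue) powr (p / P) \<le> C * E"
        using sob[OF u] by (simp add: g_def E_def i1_def i2_def f_def P(3))
      also have "\<dots> \<le> C * (I / \<epsilon>)" using EI' C by (rule mult_left_mono)
      also have "\<dots> = C / \<epsilon> * I" by simp
      also have "\<dots> \<le> C2 * I" using C2 I0 by (intro mult_right_mono)
      finally have "((\<integral>x. g x \<partial>lebesgue) powr (p / P)) powr (P / p) \<le> (C2 * I) powr (P / p)"
        using p P(1) by (intro powr_mono2) auto
      then show ?thesis using 0(3) p P(1) by (simp add: powr_powr)
    qed
    have point: "\<bar>u x\<bar> powr q * d x powr e * Xd x powr (2 * q / p) = f x powr (1 - \<theta>) * g x powr \<theta>" for x
    proof (cases "x \<in> S")
      case False
      then have "u x = 0" using S(3) by blast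
      then show ?thesis using \<theta>(1) by (simp add: g_def)
    next
      case True
      have y: "Xd x > 0" using Xd_bounds[of x] True S(2) by auto
      have dx: "d x > 0" by (rule dS[OF True])
      have y2: "(Xd x)\<^sup>2 = Xd x powr 2" using y by simp
      have fx: "f x powr (1 - \<theta>) = Xd x powr (2 * (1 - \<theta>)) * \<bar>u x\<bar> powr (p * (1 - \<theta>)) * d x powr e"
      proof -
        have "f x = Xd x powr 2 * \<bar>u x\<bar> powr p * d x powr (- p)"
          by (simp add: f_def i2_def y2 powr_minus divide_inverse)
        then show ?thesis by (simp add: powr_mult powr_powr e)
      qed
      have gx: "g x powr \<theta> = Xd x powr (2 / p * P * \<theta>) * \<bar>u x\<bar> powr (P * \<theta>)"
        unfolding g_def by (simp add: abs_mult powr_mult powr_powr)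
      have e1: "2 * (1 - \<theta>) + 2 / p * P * \<theta> = 2 * q / p"
      proof -
        have "2 * q / p = 2 * ((1 - \<theta>) * p + \<theta> * P) / p" using \<theta>(3) by simp
        then show ?thesis using p by (simp add: field_simps)
      qed
      have e2: "p * (1 - \<theta>) + P * \<theta> = q" using \<theta>(3) by (simp add: mult.commute)
      have "f x powr (1 - \<theta>) * g x powr \<theta> = (\<bar>u x\<bar> powr (p * (1 - \<theta>)) * \<bar>u x\<bar> powr (P * \<theta>)) * d x powr e
        * (Xd x powr (2 * (1 - \<theta>)) * Xd x powr (2 / p * P * \<theta>))"
        unfolding fx gx by (simp add: mult_ac)
      also have "\<dots> = \<bar>u x\<bar> powr q * d x powr e * Xd x powr (2 * q / p)"
        unfolding powr_add[symmetric] e1 e2 ..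
      finally show ?thesis by simp
    qed
    have main: "integrable lebesgue (\<lambda>x. f x powr (1 - \<theta>) * g x powr \<theta>) \<and>
      (\<integral>x. f x powr (1 - \<theta>) * g x powr \<theta> \<partial>lebesgue) \<le> (C2 * I) powr (q / p)"
    proof (cases "\<theta> = 1")
      case True
      then have "q = P" using \<theta>(3) by simp
      \<comment> \<open>Because \<open>0 powr 0 = 0\<close>, the factor \<open>f x powr 0\<close> is
        1 only where \<open>f x\<close> is nonzero; this holds wherever \<open>g x\<close> is
        nonzero.\<close>
      have "f x powr (1 - \<theta>) * g x powr \<theta> = g x" for x
      proof (cases "g x = 0")
        case False
        then have "u x \<noteq> 0" by (auto simp: g_def)
        then have "x \<in> S" by (rule S(3))
        then have "f x \<noteq> 0" using \<open>u x \<noteq> 0\<close> dS[of x] Xd_bounds[of x] S(2) by (auto simp: f_def i2_def)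
        then show ?thesis using fg(4)[of x] by (simp add: True)
      qed (simp add: True)
      then show ?thesis using fg gI \<open>q = P\<close> by simp
    next
      case False
      then have \<theta>1: "\<theta> < 1" using \<theta>(2) by simp
      note ho = Holder_integral[OF fg(1,3,2,4) \<theta>(1) \<theta>1]
      have "(\<integral>x. f x powr (1 - \<theta>) * g x powr \<theta> \<partial>lebesgue) \<le> (\<integral>x. f x \<partial>lebesgue) powr (1 - \<theta>) * (\<integral>x. g x \<partial>lebesgue) powr \<theta>"
        by (rule ho(2))
      also have "\<dots> \<le> (C2 * I) powr (1 - \<theta>) * ((C2 * I) powr (P / p)) powr \<theta>"
        using 0 fI gI \<theta>(1) \<theta>1 by (intro mult_mono powr_mono2) auto
      also have "\<dots> = (C2 * I) powr (1 - \<theta> + P / p * \<theta>)" by (simp add: powr_powr powr_add)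
      also have "1 - \<theta> + P / p * \<theta> = q / p"
      proof -
        have "q / p = ((1 - \<theta>) * p + \<theta> * P) / p" using \<theta>(3) by simp
        then show ?thesis using p by (simp add: field_simps)
      qed
      finally show ?thesis using ho(1) by blast
    qed
    define J where "J = (\<integral>x. f x powr (1 - \<theta>) * g x powr \<theta> \<partial>lebesgue)"
    have J0: "0 \<le> J" unfolding J_def by (auto intro!: Bochner_Integration.integral_nonneg)
    have "J powr (p / q) \<le> ((C2 * I) powr (q / p)) powr (p / q)"
      using main J0 p q by (intro powr_mono2) (auto simp: J_def)
    also have "\<dots> = C2 * I" using p q C2 I0 by (simp add: powr_powr)
    finally have "1 / C2 * J powr (p / q) \<le> I" using C2 by (simp add: field_simps)
    then show ?thesis using test_integrable[OF u] main unfolding point J_def[symmetric] by (simp add: I_def i1_def i2_def)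
  qed
  then show ?thesis using C2(1) unfolding e_def N_def by (intro exI[of _ "1 / C2"]) auto
qed

end

subsection \<open>Weak gradients and the passage to the limit\<close>

text \<open>Fatou's lemma for real integrals: the bound \<open>M\<close> makes the limit integrable.
  The lower bound is stated with a loss \<open>\<eta>\<close> for all large n, so that several
  sequences can be evaluated at a common index.\<close>

lemma fatou_bounded:
  fixes f :: "nat \<Rightarrow> 'a::euclidean_space \<Rightarrow> real"
  assumes f: "\<And>n. integrable lebesgue (f n)" "\<And>n x. 0 \<le> f n x" and g: "\<And>x. 0 \<le> g x"
    and lim: "AE x in lebesgue. (\<lambda>n. f n x) \<longlonglongrightarrow> g x"
    and M: "\<forall>\<^sub>F n in sequentially. (\<integral>x. f n x \<partial>lebesgue) \<le> M"
  shows "integrable lebesgue g"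
    and "\<eta> > 0 \<Longrightarrow> \<forall>\<^sub>F n in sequentially. (\<integral>x. g x \<partial>lebesgue) - \<eta> \<le> (\<integral>x. f n x \<partial>lebesgue)"
proof -
  have fm: "f n \<in> borel_measurable lebesgue" for n using f(1) by (rule borel_measurable_integrable)
  have gm: "g \<in> borel_measurable lebesgue" by (rule borel_measurable_AE_LIMSEQ[OF fm lim])
  have fi: "(\<integral>\<^sup>+x. ennreal (f n x) \<partial>lebesgue) = ennreal (\<integral>x. f n x \<partial>lebesgue)" for n
    by (rule nn_integral_eq_integral[OF f(1)]) (simp add: f(2))
  have "(\<integral>\<^sup>+x. ennreal (g x) \<partial>lebesgue) = (\<integral>\<^sup>+x. liminf (\<lambda>n. ennreal (f n x)) \<partial>lebesgue)"
  proof (rule nn_integral_cong_AE)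
    show "AE x in lebesgue. ennreal (g x) = liminf (\<lambda>n. ennreal (f n x))"
      using lim
    proof eventually_elim
      fix x assume "(\<lambda>n. f n x) \<longlonglongrightarrow> g x"
      then have "(\<lambda>n. ennreal (f n x)) \<longlonglongrightarrow> ennreal (g x)" by (rule tendsto_ennrealI)
      then show "ennreal (g x) = liminf (\<lambda>n. ennreal (f n x))"
        by (intro lim_imp_Liminf[symmetric]) auto
    qed
  qed
  also have "\<dots> \<le> liminf (\<lambda>n. \<integral>\<^sup>+x. ennreal (f n x) \<partial>lebesgue)"
    by (rule nn_integral_liminf) (intro measurable_compose[OF fm measurable_ennreal])
  finally have le: "(\<integral>\<^sup>+x. ennreal (g x) \<partial>lebesgue) \<le> liminf (\<lambda>n. ennreal (\<integral>x. f n x \<partial>lebesgue))" by (simp add: fi)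
  have "liminf (\<lambda>n. ennreal (\<integral>x. f n x \<partial>lebesgue)) \<le> ennreal M"
  proof (rule ccontr)
    assume "\<not> ?thesis"
    then have "ennreal M < liminf (\<lambda>n. ennreal (\<integral>x. f n x \<partial>lebesgue))" by simp
    then have "\<forall>\<^sub>F n in sequentially. ennreal M < ennreal (\<integral>x. f n x \<partial>lebesgue)" by (rule less_LiminfD)
    with M have "\<forall>\<^sub>F n in sequentially. False"
      by eventually_elim (use ennreal_leI leD in blast)
    then show False by simp
  qed
  with le have "(\<integral>\<^sup>+x. ennreal (g x) \<partial>lebesgue) < \<infinity>"
    using ennreal_less_top[of M] by (simp add: order.strict_trans1 order_trans)
  then show gi: "integrable lebesgue g"
    using gm g by (intro integrableI_nonneg) auto
  show "\<forall>\<^sub>F n in sequentially. (\<integral>x. g x \<partial>lebesgue) - \<eta> \<le> (\<integral>x. f n x \<partial>lebesgue)" if \<eta>: "\<eta> > 0"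
  proof (cases "(\<integral>x. g x \<partial>lebesgue) - \<eta> < 0")
    case True
    have "0 \<le> (\<integral>x. f n x \<partial>lebesgue)" for n using f(2) by (intro Bochner_Integration.integral_nonneg) auto
    then show ?thesis using True by (intro always_eventually allI) (meson less_imp_le order_trans)
  next
    case False
    have "(\<integral>\<^sup>+x. ennreal (g x) \<partial>lebesgue) = ennreal (\<integral>x. g x \<partial>lebesgue)"
      by (rule nn_integral_eq_integral[OF gi]) (simp add: g)
    then have "ennreal ((\<integral>x. g x \<partial>lebesgue) - \<eta>) < liminf (\<lambda>n. ennreal (\<integral>x. f n x \<partial>lebesgue))"
      using le False \<eta> by (intro order.strict_trans2[OF _ le]) (simp add: ennreal_less_iff)
    then have "\<forall>\<^sub>F n in sequentially. ennreal ((\<integral>x. g x \<partial>lebesgue) - \<eta>) < ennreal (\<integral>x. f n x \<partial>lebesgue)" by (rule less_LiminfD)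
    then show ?thesis
      by eventually_elim (use False in \<open>simp add: ennreal_less_iff\<close>)
  qed
qed

text \<open>Either y is small compared with x, and the first term absorbs it, or conversely. As
  \<open>\<tau>\<close> tends to 0 the coefficient of the power of \<open>norm x\<close> tends to 1,
  which makes this a substitute for Minkowski's inequality.\<close>

lemma norm_add_powr_le:
  fixes x y :: "'a::real_normed_vector"
  assumes "p > 0" "\<tau> > 0"
  shows "norm (x + y) powr p \<le> (1 + \<tau>) powr p * norm x powr p + (1 + 1 / \<tau>) powr p * norm y powr p"
proof (cases "norm y \<le> \<tau> * norm x")
  case True
  have "norm (x + y) \<le> (1 + \<tau>) * norm x" using norm_triangle_ineq[of x y] True by (simp add: algebra_simps)
  then have "norm (x + y) powr p \<le> ((1 + \<tau>) * norm x) powr p" using assms by (intro powr_mono2) auto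
  also have "\<dots> = (1 + \<tau>) powr p * norm x powr p" using assms by (simp add: powr_mult)
  finally show ?thesis by (simp add: add_increasing2)
next
  case False
  then have "norm x \<le> norm y / \<tau>" using assms by (simp add: field_simps)
  then have "norm (x + y) \<le> (1 + 1 / \<tau>) * norm y" using norm_triangle_ineq[of x y] by (simp add: algebra_simps)
  then have "norm (x + y) powr p \<le> ((1 + 1 / \<tau>) * norm y) powr p" using assms by (intro powr_mono2) auto
  also have "\<dots> = (1 + 1 / \<tau>) powr p * norm y powr p" using assms by (simp add: powr_mult)
  finally show ?thesis by (simp add: add_increasing)
qed

lemma integrable_norm_diff_powr:
  fixes f g :: "'a::euclidean_space \<Rightarrow> 'b::euclidean_space"
  assumes f: "f \<in> borel_measurable lebesgue" "integrable lebesgue (\<lambda>x. norm (f x) powr p)"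
    and g: "g \<in> borel_measurable lebesgue" "integrable lebesgue (\<lambda>x. norm (g x) powr p)" and p: "p > 0"
  shows "integrable lebesgue (\<lambda>x. norm (f x - g x) powr p)"
proof (rule Bochner_Integration.integrable_bound)
  show "integrable lebesgue (\<lambda>x. 2 powr p * norm (f x) powr p + 2 powr p * norm (g x) powr p)"
    using f g by simp
  show "(\<lambda>x. norm (f x - g x) powr p) \<in> borel_measurable lebesgue"
    using f(1) g(1) by measurable
  show "AE x in lebesgue. norm (norm (f x - g x) powr p) \<le> norm (2 powr p * norm (f x) powr p + 2 powr p * norm (g x) powr p)"
    using norm_add_powr_le[OF p zero_less_one, of "f x" "- g x" for x] by (intro AE_I2) simp
qed

text \<open>Upper half of the convergence of p-th powers under convergence in L^p. It is the half
  needed for the gradients, which stand on the larger side of the inequality.\<close>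

lemma eventually_powr_norm_le:
  fixes f :: "nat \<Rightarrow> 'a::euclidean_space \<Rightarrow> 'b::euclidean_space"
  assumes f: "\<And>n. f n \<in> borel_measurable lebesgue" "\<And>n. integrable lebesgue (\<lambda>x. norm (f n x) powr p)"
    and v: "v \<in> borel_measurable lebesgue" "integrable lebesgue (\<lambda>x. norm (v x) powr p)" and p: "p > 0"
    and lim: "(\<lambda>n. \<integral>x. norm (v x - f n x) powr p \<partial>lebesgue) \<longlonglongrightarrow> 0" and \<eta>: "\<eta> > 0"
  shows "\<forall>\<^sub>F n in sequentially. (\<integral>x. norm (f n x) powr p \<partial>lebesgue) \<le> (\<integral>x. norm (v x) powr p \<partial>lebesgue) + \<eta>"
proof -
  define V where "V = (\<integral>x. norm (v x) powr p \<partial>lebesgue)"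
  have "((\<lambda>\<tau>. (1 + \<tau>) powr p * V) \<longlongrightarrow> (1 + 0) powr p * V) (at_right 0)"
    by (intro tendsto_intros) auto
  then have "\<forall>\<^sub>F \<tau> in at_right 0. (1 + \<tau>) powr p * V < V + \<eta> / 2"
    by (rule order_tendstoD) (use \<eta> in simp)
  moreover have "\<forall>\<^sub>F \<tau> in at_right (0::real). 0 < \<tau>" by (rule eventually_at_right_less)
  ultimately have "\<forall>\<^sub>F \<tau> in at_right 0. 0 < \<tau> \<and> (1 + \<tau>) powr p * V < V + \<eta> / 2"
    by eventually_elim simp
  then obtain \<tau> where \<tau>: "\<tau> > 0" "(1 + \<tau>) powr p * V < V + \<eta> / 2"
    using eventually_happens[of _ "at_right (0::real)"] by (auto simp: trivial_limit_at_right_real)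
  define b where "b n = (\<integral>x. norm (v x - f n x) powr p \<partial>lebesgue)" for n
  have le: "(\<integral>x. norm (f n x) powr p \<partial>lebesgue) \<le> (1 + \<tau>) powr p * V + (1 + 1 / \<tau>) powr p * b n" for n
  proof -
    have i: "integrable lebesgue (\<lambda>x. norm (v x - f n x) powr p)"
      by (rule integrable_norm_diff_powr[OF v f p])
    have "(\<integral>x. norm (f n x) powr p \<partial>lebesgue) \<le> (\<integral>x. (1 + \<tau>) powr p * norm (v x) powr p + (1 + 1 / \<tau>) powr p * norm (v x - f n x) powr p \<partial>lebesgue)"
    proof (rule Bochner_Integration.integral_mono[OF f(2)])
      show "integrable lebesgue (\<lambda>x. (1 + \<tau>) powr p * norm (v x) powr p + (1 + 1 / \<tau>) powr p * norm (v x - f n x) powr p)"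
        using v i by simp
      fix x
      show "norm (f n x) powr p \<le> (1 + \<tau>) powr p * norm (v x) powr p + (1 + 1 / \<tau>) powr p * norm (v x - f n x) powr p"
        using norm_add_powr_le[OF p \<tau>(1), of "v x" "f n x - v x"] by (simp add: norm_minus_commute)
    qed
    then show ?thesis using v i by (simp add: V_def b_def)
  qed
  have "(\<lambda>n. (1 + 1 / \<tau>) powr p * b n) \<longlonglongrightarrow> (1 + 1 / \<tau>) powr p * 0"
    unfolding b_def by (intro tendsto_mult tendsto_const lim)
  then have "\<forall>\<^sub>F n in sequentially. (1 + 1 / \<tau>) powr p * b n < \<eta> / 2"
    by (rule order_tendstoD) (use \<eta> in simp)
  then show ?thesis
    unfolding V_def[symmetric]
  proof eventually_elim
    fix n assume "(1 + 1 / \<tau>) powr p * b n < \<eta> / 2"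
    then show "(\<integral>x. norm (f n x) powr p \<partial>lebesgue) \<le> V + \<eta>" using le[of n] \<tau>(2) by linarith
  qed
qed

section \<open>The fundamental lemma of the calculus of variations\<close>

lemma set_integral_lebesgue_zero_of_test:
  fixes f :: "'a::euclidean_space \<Rightarrow> 'b::euclidean_space"
  assumes ac: "cbox a c \<subseteq> U" and f: "set_integrable lebesgue (cbox a c) f"
    and zero: "\<And>\<phi>. \<phi> \<in> Cinf_c U \<Longrightarrow> (LINT x:U|lebesgue. \<phi> x *\<^sub>R f x) = 0"
  shows "(\<integral>x. indicator (box a c) x *\<^sub>R f x \<partial>lebesgue) = 0"
proof -
  define F where "F x = indicator (cbox a c) x *\<^sub>R f x" for x
  have F: "integrable lebesgue F" using f by (simp add: set_integrable_def F_def[abs_def])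
  define \<beta> where "\<beta> n = box_bump (real (Suc n)) a c" for n
  have out: "\<beta> n x = 0" if "x \<notin> cbox a c" for n x
    using that box_bump_eq_0[of "real (Suc n)" a c x] box_subset_cbox[of a c] by (auto simp: \<beta>_def)
  \<comment> \<open>The bumps take values in [0, 1] and converge to the indicator of the open box,
    so the norm of \<open>F\<close> dominates.\<close>
  have lim: "(\<lambda>n. \<integral>x. \<beta> n x *\<^sub>R F x \<partial>lebesgue) \<longlonglongrightarrow> (\<integral>x. indicator (box a c) x *\<^sub>R F x \<partial>lebesgue)"
  proof (rule integral_dominated_convergence[where w="\<lambda>x. norm (F x)"])
    show "(\<lambda>x. indicator (box a c) x *\<^sub>R F x) \<in> borel_measurable lebesgue"
      using F by (intro borel_measurable_scaleR borel_measurable_indicator) auto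
    have "continuous_on UNIV (\<beta> n)" for n
      using Ck_on_box_bump[of 0 "real (Suc n)" a c] by (simp add: \<beta>_def)
    then show "(\<lambda>x. \<beta> n x *\<^sub>R F x) \<in> borel_measurable lebesgue" for n
      using borel_measurable_scaleR[OF cont_lebesgue_measurable borel_measurable_integrable[OF F]] by blast
    show "integrable lebesgue (\<lambda>x. norm (F x))" using F by simp
    have "(\<lambda>n. \<beta> n x) \<longlonglongrightarrow> indicator (box a c) x" for x
      using LIMSEQ_Suc[OF box_bump_tendsto[of a c x]] by (simp add: \<beta>_def)
    then show "AE x in lebesgue. (\<lambda>n. \<beta> n x *\<^sub>R F x) \<longlonglongrightarrow> indicator (box a c) x *\<^sub>R F x"
      by (intro AE_I2 tendsto_scaleR tendsto_const)
    show "AE x in lebesgue. norm (\<beta> n x *\<^sub>R F x) \<le> norm (F x)" for n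
      using box_bump_range[of "real (Suc n)" a c] by (intro AE_I2) (auto simp: \<beta>_def intro!: mult_left_le_one_le)
  qed
  have "(\<integral>x. \<beta> n x *\<^sub>R F x \<partial>lebesgue) = 0" for n
  proof -
    have "(\<integral>x. \<beta> n x *\<^sub>R F x \<partial>lebesgue) = (LINT x:U|lebesgue. \<beta> n x *\<^sub>R f x)"
      unfolding set_lebesgue_integral_def
    proof (rule Bochner_Integration.integral_cong)
      fix x show "\<beta> n x *\<^sub>R F x = indicator U x *\<^sub>R \<beta> n x *\<^sub>R f x"
        using ac out[of x n] by (cases "x \<in> cbox a c") (auto simp: F_def indicator_def)
    qed simp
    also have "\<dots> = 0" unfolding \<beta>_def using ac by (intro zero box_bump_Cinf_c) auto
    finally show ?thesis .
  qed
  with lim have "(\<integral>x. indicator (box a c) x *\<^sub>R F x \<partial>lebesgue) = 0"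
    by (simp add: LIMSEQ_const_iff)
  moreover have "(\<lambda>x. indicator (box a c) x *\<^sub>R F x) = (\<lambda>x. indicator (box a c) x *\<^sub>R f x)"
    using box_subset_cbox[of a c] by (auto simp: F_def indicator_def fun_eq_iff)
  ultimately show ?thesis by simp
qed

lemma sigma_finite_lebesgue: "sigma_finite_measure (lebesgue :: 'a::euclidean_space measure)"
proof
  obtain A :: "'a set set" where A: "countable A" "A \<subseteq> sets lborel" "\<Union>A = space lborel" "\<forall>a\<in>A. emeasure lborel a \<noteq> \<infinity>"
    using lborel.sigma_finite_countable by metis
  have "emeasure lebesgue a \<noteq> \<infinity>" if "a \<in> A" for a
  proof -
    have a: "a \<in> sets lborel" using A(2) that by blast
    have "emeasure lebesgue a = emeasure lborel a"
      using a by simp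
    then show ?thesis using A(4) that by (simp only:) blast
  qed
  moreover have "A \<subseteq> sets lebesgue" using A(2) sets_completionI_sets by blast
  ultimately show "\<exists>A. countable A \<and> A \<subseteq> sets lebesgue \<and> \<Union>A = space (lebesgue :: 'a measure) \<and> (\<forall>a\<in>A. emeasure lebesgue a \<noteq> \<infinity>)"
    using A(1,3) by (intro exI[of _ A]) simp
qed

text \<open>Boxes are stable under intersection and generate the Borel sets, so a function whose
  integral vanishes over every box has vanishing integral over every Borel set, hence over every
  Lebesgue set, and is zero almost everywhere.\<close>

lemma AE_zero_on_box:
  fixes f :: "'a::euclidean_space \<Rightarrow> 'b::euclidean_space"
  assumes ac: "cbox a c \<subseteq> U" and f: "set_integrable lebesgue (cbox a c) f"
    and zero: "\<And>\<phi>. \<phi> \<in> Cinf_c U \<Longrightarrow> (LINT x:U|lebesgue. \<phi> x *\<^sub>R f x) = 0"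
  shows "AE x in lebesgue. x \<in> box a c \<longrightarrow> f x = 0"
proof -
  define F where "F x = indicator (box a c) x *\<^sub>R f x" for x
  have F: "integrable lebesgue F"
    using set_integrable_subset[OF f, of "box a c"] box_subset_cbox[of a c]
    by (simp add: set_integrable_def F_def[abs_def])
  have ind: "integrable lebesgue (\<lambda>x. indicator A x *\<^sub>R F x)" if "A \<in> sets lebesgue" for A
    by (rule integrable_mult_indicator[OF that F])
  define G where "G = range (\<lambda>(a, b). box a b :: 'a set)"
  have box: "(\<integral>x. indicator (box a' c') x *\<^sub>R F x \<partial>lebesgue) = 0" for a' c'
  proof -
    define l u where "l = (\<Sum>i\<in>Basis. max (a' \<bullet> i) (a \<bullet> i) *\<^sub>R i)" and "u = (\<Sum>i\<in>Basis. min (c' \<bullet> i) (c \<bullet> i) *\<^sub>R i)"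
    have lu: "box a' c' \<inter> box a c = box l u" "cbox l u \<subseteq> cbox a c"
      by (auto simp: l_def u_def mem_box)
    have "(\<integral>x. indicator (box l u) x *\<^sub>R f x \<partial>lebesgue) = 0"
      by (rule set_integral_lebesgue_zero_of_test[OF _ _ zero])
        (use ac lu set_integrable_subset[OF f, of "cbox l u"] in auto)
    moreover have "(\<lambda>x. indicator (box l u) x *\<^sub>R f x) = (\<lambda>x. indicator (box a' c') x *\<^sub>R F x)"
      unfolding lu(1)[symmetric] F_def by (auto simp: indicator_def fun_eq_iff)
    ultimately show ?thesis by simp
  qed
  have int_UNIV: "(\<integral>x. F x \<partial>lebesgue) = 0"
  proof -
    have "(\<lambda>x. indicator (box a c) x *\<^sub>R F x) = F" by (auto simp: F_def indicator_def fun_eq_iff)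
    then show ?thesis using box[of a c] by simp
  qed
  have sig: "A \<in> sets lebesgue" if "A \<in> sigma_sets UNIV G" for A
    using that by (metis G_def borel_eq_box sets_completionI_sets sets_lborel sets_measure_of Pow_UNIV subset_UNIV)
  have borel: "(\<integral>x. indicator A x *\<^sub>R F x \<partial>lebesgue) = 0" if "A \<in> sets borel" for A
  proof -
    have "Int_stable G" unfolding G_def
    proof (rule Int_stableI_image)
      fix i j :: "'a \<times> 'a"
      show "\<exists>k\<in>UNIV. (case i of (a, b) \<Rightarrow> box a b) \<inter> (case j of (a, b) \<Rightarrow> box a b) = (case k of (a, b) \<Rightarrow> box a b)"
        by (auto simp: box_Int_box split: prod.split)
    qed
    moreover have "G \<subseteq> Pow UNIV" by simp
    moreover have "A \<in> sigma_sets UNIV G" using that unfolding borel_eq_box G_def by simp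
    ultimately show ?thesis
    proof (induction rule: sigma_sets_induct_disjoint)
      case (basic A)
      then show ?case using box by (auto simp: G_def)
    next
      case empty
      then show ?case by simp
    next
      case (compl A)
      then have A: "A \<in> sets lebesgue" by (intro sig)
      have "(\<lambda>x. indicator (UNIV - A) x *\<^sub>R F x) = (\<lambda>x. F x - indicator A x *\<^sub>R F x)"
        by (auto simp: indicator_def fun_eq_iff)
      then show ?case using compl(2) F ind[OF A] int_UNIV by simp
    next
      case (union A)
      have A: "A i \<in> sets lebesgue" for i using union(2) by (intro sig) blast
      have "set_lebesgue_integral lebesgue (\<Union>(range A)) F = (\<Sum>i. set_lebesgue_integral lebesgue (A i) F)"
        by (rule lebesgue_integral_countable_add)
          (use union(1) A F ind[of "\<Union>(range A)"] in \<open>auto simp: set_integrable_def disjoint_family_on_def\<close>)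
      then show ?case using union(3) by (simp add: set_lebesgue_integral_def)
    qed
  qed
  have "AE x in lebesgue. F x = 0"
  proof (rule sigma_finite_measure.density_zero[OF sigma_finite_lebesgue F])
    fix A :: "'a set" assume A: "A \<in> sets lebesgue"
    \<comment> \<open>A Lebesgue set differs from a Borel set by a subset of a null set, which does
      not affect the integral.\<close>
    then obtain S N N' where S: "A = S \<union> N" "N \<subseteq> N'" "N' \<in> null_sets lborel" "S \<in> sets lborel"
      by (rule sets_completionE)
    have "AE x in lebesgue. x \<notin> N'" using S(3) by (intro AE_not_in null_sets_completionI)
    then have "AE x in lebesgue. indicator A x *\<^sub>R F x = indicator S x *\<^sub>R F x"
      by eventually_elim (use S in \<open>auto simp: indicator_def\<close>)
    moreover have "S \<in> sets lebesgue" using S(4) by (rule sets_completionI_sets)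
    ultimately have "(\<integral>x. indicator A x *\<^sub>R F x \<partial>lebesgue) = (\<integral>x. indicator S x *\<^sub>R F x \<partial>lebesgue)"
      using ind A by (intro integral_cong_AE) (auto intro: borel_measurable_integrable)
    also have "\<dots> = 0" using S(4) by (intro borel) simp
    finally show "set_lebesgue_integral lebesgue A F = 0" by (simp add: set_lebesgue_integral_def)
  qed
  then show ?thesis by eventually_elim (auto simp: F_def indicator_def split: if_splits)
qed

text \<open>An open set is a countable union of closed boxes, and the faces lost by passing to their
  interiors are null.\<close>

lemma AE_zero_of_test_functions:
  fixes f :: "'a::euclidean_space \<Rightarrow> 'b::euclidean_space"
  assumes U: "open U" and f: "\<And>C. compact C \<Longrightarrow> C \<subseteq> U \<Longrightarrow> set_integrable lebesgue C f"
    and zero: "\<And>\<phi>. \<phi> \<in> Cinf_c U \<Longrightarrow> (LINT x:U|lebesgue. \<phi> x *\<^sub>R f x) = 0"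
  shows "AE x in lebesgue. x \<in> U \<longrightarrow> f x = 0"
proof -
  obtain \<D> where D: "countable \<D>" "\<D> \<subseteq> Pow U" "\<And>X. X \<in> \<D> \<Longrightarrow> \<exists>a b. X = cbox a b" "\<Union>\<D> = U"
    using open_countable_Union_open_cbox[OF U] by metis
  have "AE x in lebesgue. x \<in> X \<longrightarrow> f x = 0" if XD: "X \<in> \<D>" for X
  proof -
    obtain a b where X: "X = cbox a b" using D(3)[OF XD] by blast
    have sub: "cbox a b \<subseteq> U" using D(2) XD X by auto
    have "AE x in lebesgue. x \<in> box a b \<longrightarrow> f x = 0"
      by (rule AE_zero_on_box[OF sub f zero]) (use sub in auto)
    moreover have "AE x in lebesgue. x \<notin> cbox a b - box a b"
      by (intro AE_not_in) (simp add: negligible_frontier_interval flip: negligible_iff_null_sets)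
    ultimately show ?thesis by eventually_elim (auto simp: X)
  qed
  then have "AE x in lebesgue. \<forall>X\<in>\<D>. x \<in> X \<longrightarrow> f x = 0"
    by (subst AE_ball_countable[OF D(1)]) blast
  then show ?thesis by eventually_elim (use D(4) in auto)
qed

text \<open>The product is an arbitrary bilinear \<open>m\<close>, so that one proof covers u times
  the gradient of a test function and a test function times a weak gradient.\<close>

lemma integrable_local_mult:
  fixes f :: "'a::euclidean_space \<Rightarrow> 'b::{banach, second_countable_topology}" and \<zeta> :: "'a \<Rightarrow> 'c::{banach, second_countable_topology}"
  assumes f: "set_integrable lebesgue C f" and C: "compact C" and \<zeta>: "continuous_on UNIV \<zeta>" "\<And>x. \<zeta> x \<noteq> 0 \<Longrightarrow> x \<in> C"
    and m: "\<And>y z. norm (m y z) \<le> norm y * norm z" "bounded_bilinear (m :: 'b \<Rightarrow> 'c \<Rightarrow> 'e::{banach, second_countable_topology})"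
  shows "integrable lebesgue (\<lambda>x. m (f x) (\<zeta> x))"
proof -
  have "bounded (\<zeta> ` C)" using C \<zeta> by (intro compact_imp_bounded compact_continuous_image) (auto intro: continuous_on_subset)
  then obtain B where B: "\<And>x. x \<in> C \<Longrightarrow> norm (\<zeta> x) \<le> B" by (auto simp: bounded_iff)
  have eq: "m (f x) (\<zeta> x) = m (indicator C x *\<^sub>R f x) (\<zeta> x)" for x
  proof (cases "x \<in> C")
    case False
    then have "\<zeta> x = 0" using \<zeta>(2) by blast
    then show ?thesis by (simp add: bounded_bilinear.zero_right[OF m(2)])
  qed simp
  have fi: "integrable lebesgue (\<lambda>x. indicator C x *\<^sub>R f x)" using f by (simp add: set_integrable_def)
  have "continuous_on UNIV (\<lambda>(y, z). m y z)"
    using bounded_bilinear.continuous_on[OF m(2) continuous_on_fst[OF continuous_on_id] continuous_on_snd[OF continuous_on_id]]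
    by (simp add: case_prod_beta')
  then have mm: "(\<lambda>(y, z). m y z) \<in> borel_measurable borel" by (rule borel_measurable_continuous_onI)
  have "(\<lambda>x. (indicator C x *\<^sub>R f x, \<zeta> x)) \<in> borel_measurable lebesgue"
    using fi cont_lebesgue_measurable[OF \<zeta>(1)] by (intro borel_measurable_Pair) auto
  from measurable_compose[OF this mm]
  have "(\<lambda>x. m (indicator C x *\<^sub>R f x) (\<zeta> x)) \<in> borel_measurable lebesgue" by simp
  then have "integrable lebesgue (\<lambda>x. m (indicator C x *\<^sub>R f x) (\<zeta> x))"
  proof (rule Bochner_Integration.integrable_bound[of _ "\<lambda>x. \<bar>B\<bar> * norm (indicator C x *\<^sub>R f x)", rotated])
    show "AE x in lebesgue. norm (m (indicator C x *\<^sub>R f x) (\<zeta> x)) \<le> norm (\<bar>B\<bar> * norm (indicator C x *\<^sub>R f x))"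
    proof (rule AE_I2)
      fix x
      show "norm (m (indicator C x *\<^sub>R f x) (\<zeta> x)) \<le> norm (\<bar>B\<bar> * norm (indicator C x *\<^sub>R f x))"
      proof (cases "x \<in> C")
        case True
        have "norm (m (f x) (\<zeta> x)) \<le> norm (f x) * norm (\<zeta> x)" by (rule m(1))
        also have "\<dots> \<le> norm (f x) * \<bar>B\<bar>" using B[OF True] by (intro mult_left_mono) auto
        finally show ?thesis using True by (simp add: mult.commute)
      qed (simp add: bounded_bilinear.zero_left[OF m(2)])
    qed
  qed (intro integrable_mult_right integrable_norm fi)
  then show ?thesis by (simp add: eq)
qed

section \<open>Weak gradients: existence for test functions, uniqueness, differences\<close>

lemma set_integral_eq_integral_of_support:
  "(\<And>x. f x \<noteq> 0 \<Longrightarrow> x \<in> U) \<Longrightarrow> set_lebesgue_integral M U f = integral\<^sup>L M f"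
  unfolding set_lebesgue_integral_def by (rule arg_cong[where f="integral\<^sup>L M"]) (auto simp: indicator_def fun_eq_iff)

lemma set_integrable_compact_cont:
  fixes f :: "'a::euclidean_space \<Rightarrow> 'b::{banach, second_countable_topology}"
  assumes "compact C" "continuous_on UNIV f" shows "set_integrable lebesgue C f"
  unfolding set_integrable_def
  using integrable_completion[of "\<lambda>x. indicator C x *\<^sub>R f x" lborel]
    borel_integrable_compact[OF assms(1) continuous_on_subset[OF assms(2) subset_UNIV]]
  by (meson borel_measurable_integrable)

text \<open>The product of two test functions is continuously differentiable with bounded support,
  so its gradient has integral 0.\<close>

lemma is_weak_grad_test:
  assumes \<phi>: "\<phi> \<in> Cinf_c U"
  shows "is_weak_grad U \<phi> (grad \<phi>)"
  unfolding is_weak_grad_def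
proof (intro conjI allI ballI impI)
  obtain C where C: "compact C" "C \<subseteq> U" "\<And>x. \<phi> x \<noteq> 0 \<Longrightarrow> x \<in> C" "\<And>x. grad \<phi> x \<noteq> 0 \<Longrightarrow> x \<in> C"
    "\<And>x. (\<phi> has_derivative (\<lambda>v. grad \<phi> x \<bullet> v)) (at x)" "continuous_on UNIV (grad \<phi>)" "continuous_on UNIV \<phi>"
    using Ck_c_1_E[OF subsetD[OF Cinf_c_subset \<phi>]] by metis
  show "set_integrable lebesgue B \<phi>" "set_integrable lebesgue B (grad \<phi>)" if "compact B \<and> B \<subseteq> U" for B
    using set_integrable_compact_cont C that by blast+
  fix \<psi> :: "'a \<Rightarrow> real" assume \<psi>: "\<psi> \<in> Cinf_c U"
  obtain E where E: "compact E" "E \<subseteq> U" "\<And>x. \<psi> x \<noteq> 0 \<Longrightarrow> x \<in> E" "\<And>x. grad \<psi> x \<noteq> 0 \<Longrightarrow> x \<in> E"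
    "\<And>x. (\<psi> has_derivative (\<lambda>v. grad \<psi> x \<bullet> v)) (at x)" "continuous_on UNIV (grad \<psi>)" "continuous_on UNIV \<psi>"
    using Ck_c_1_E[OF subsetD[OF Cinf_c_subset \<psi>]] by metis
  obtain R where R: "\<And>x. x \<in> C \<Longrightarrow> norm x \<le> R" using compact_imp_bounded[OF C(1)] by (auto simp: bounded_iff)
  interpret C1_bounded_support "\<lambda>x. \<phi> x * \<psi> x" "\<lambda>x. \<phi> x *\<^sub>R grad \<psi> x + \<psi> x *\<^sub>R grad \<phi> x" R
  proof unfold_locales
    show "((\<lambda>x. \<phi> x * \<psi> x) has_derivative (\<lambda>v. (\<phi> x *\<^sub>R grad \<psi> x + \<psi> x *\<^sub>R grad \<phi> x) \<bullet> v)) (at x)" for x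
      using has_derivative_mult[OF C(5) E(5)] by (simp add: inner_add_left mult.commute)
    show "continuous_on UNIV (\<lambda>x. \<phi> x *\<^sub>R grad \<psi> x + \<psi> x *\<^sub>R grad \<phi> x)"
      using C E by (intro continuous_intros) auto
    show "\<phi> x * \<psi> x \<noteq> 0 \<Longrightarrow> norm x \<le> R" for x using C R by auto
  qed
  have i: "integrable lborel (\<lambda>x. \<phi> x *\<^sub>R grad \<psi> x)" "integrable lborel (\<lambda>x. \<psi> x *\<^sub>R grad \<phi> x)"
    by (rule integrable_cont_bounded_support;
        use C E in \<open>auto intro!: continuous_intros intro: bounded_subset[OF compact_imp_bounded[OF C(1)]]\<close>)+
  have "(\<integral>x. \<phi> x *\<^sub>R grad \<psi> x \<partial>lborel) + (\<integral>x. \<psi> x *\<^sub>R grad \<phi> x \<partial>lborel) = 0"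
    using integral_gradient i by simp
  moreover have "(\<integral>x. \<phi> x *\<^sub>R grad \<psi> x \<partial>lebesgue) = (\<integral>x. \<phi> x *\<^sub>R grad \<psi> x \<partial>lborel)"
    "(\<integral>x. \<psi> x *\<^sub>R grad \<phi> x \<partial>lebesgue) = (\<integral>x. \<psi> x *\<^sub>R grad \<phi> x \<partial>lborel)"
    using i by (auto intro!: integral_completion dest: borel_measurable_integrable)
  ultimately show "(LINT x:U|lebesgue. \<phi> x *\<^sub>R grad \<psi> x) = - (LINT x:U|lebesgue. \<psi> x *\<^sub>R grad \<phi> x)"
    using C(2,3) E(2,3)
    by (subst (1 2) set_integral_eq_integral_of_support) (auto simp: eq_neg_iff_add_eq_0)
qed

lemma weak_grad_split:
  assumes g: "is_weak_grad U u g" and \<phi>: "\<phi> \<in> Cinf_c U"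
  shows "integrable lebesgue (\<lambda>x. u x *\<^sub>R grad \<phi> x)" "integrable lebesgue (\<lambda>x. \<phi> x *\<^sub>R g x)"
    "(\<integral>x. u x *\<^sub>R grad \<phi> x \<partial>lebesgue) = - (\<integral>x. \<phi> x *\<^sub>R g x \<partial>lebesgue)"
proof -
  obtain C where C: "compact C" "C \<subseteq> U" "\<And>x. \<phi> x \<noteq> 0 \<Longrightarrow> x \<in> C" "\<And>x. grad \<phi> x \<noteq> 0 \<Longrightarrow> x \<in> C"
    "\<And>x. (\<phi> has_derivative (\<lambda>v. grad \<phi> x \<bullet> v)) (at x)" "continuous_on UNIV (grad \<phi>)" "continuous_on UNIV \<phi>"
    using Ck_c_1_E[OF subsetD[OF Cinf_c_subset \<phi>]] by metis
  have l: "set_integrable lebesgue C u" "set_integrable lebesgue C g"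
    using g C(1,2) unfolding is_weak_grad_def by blast+
  show "integrable lebesgue (\<lambda>x. u x *\<^sub>R grad \<phi> x)"
    by (rule integrable_local_mult[OF l(1) C(1,6,4) _ bounded_bilinear_scaleR]) auto
  show "integrable lebesgue (\<lambda>x. \<phi> x *\<^sub>R g x)"
    by (rule integrable_local_mult[OF l(2) C(1,7,3) _ bounded_bilinear.flip[OF bounded_bilinear_scaleR]]) auto
  have "(LINT x:U|lebesgue. u x *\<^sub>R grad \<phi> x) = - (LINT x:U|lebesgue. \<phi> x *\<^sub>R g x)"
    using g \<phi> unfolding is_weak_grad_def by blast
  then show "(\<integral>x. u x *\<^sub>R grad \<phi> x \<partial>lebesgue) = - (\<integral>x. \<phi> x *\<^sub>R g x \<partial>lebesgue)"
    using C(2,3,4) by (subst (asm) (1 2) set_integral_eq_integral_of_support) auto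
qed

lemma is_weak_grad_unique:
  fixes U :: "'a::euclidean_space set"
  assumes U: "open U" and g: "is_weak_grad U u g" and h: "is_weak_grad U u h"
  shows "AE x in lebesgue. x \<in> U \<longrightarrow> g x = h x"
proof -
  have "AE x in lebesgue. x \<in> U \<longrightarrow> g x - h x = 0"
  proof (rule AE_zero_of_test_functions[OF U])
    show "set_integrable lebesgue C (\<lambda>x. g x - h x)" if "compact C" "C \<subseteq> U" for C
      using g h that unfolding is_weak_grad_def by (intro set_integral_diff(1)) blast+
    fix \<phi> :: "'a \<Rightarrow> real" assume \<phi>: "\<phi> \<in> Cinf_c U"
    obtain C where C: "C \<subseteq> U" "\<And>x. \<phi> x \<noteq> 0 \<Longrightarrow> x \<in> C" using Ck_c_1_E[OF subsetD[OF Cinf_c_subset \<phi>]] by metis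
    have "(LINT x:U|lebesgue. \<phi> x *\<^sub>R (g x - h x)) = (\<integral>x. \<phi> x *\<^sub>R g x - \<phi> x *\<^sub>R h x \<partial>lebesgue)"
      using C by (subst set_integral_eq_integral_of_support) (auto simp: scaleR_diff_right)
    also have "\<dots> = 0"
      using weak_grad_split[OF g \<phi>] weak_grad_split[OF h \<phi>] by simp
    finally show "(LINT x:U|lebesgue. \<phi> x *\<^sub>R (g x - h x)) = 0" .
  qed
  then show ?thesis by eventually_elim auto
qed

lemma is_weak_grad_diff:
  assumes u: "is_weak_grad U u g" and w: "is_weak_grad U w h"
  shows "is_weak_grad U (\<lambda>x. u x - w x) (\<lambda>x. g x - h x)"
  unfolding is_weak_grad_def
proof (intro conjI allI ballI impI)
  show "set_integrable lebesgue C (\<lambda>x. u x - w x)" "set_integrable lebesgue C (\<lambda>x. g x - h x)" if "compact C \<and> C \<subseteq> U" for C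
    using u w that unfolding is_weak_grad_def by (intro set_integral_diff(1); blast)+
  fix \<phi> :: "'a \<Rightarrow> real" assume \<phi>: "\<phi> \<in> Cinf_c U"
  obtain C where C: "C \<subseteq> U" "\<And>x. \<phi> x \<noteq> 0 \<Longrightarrow> x \<in> C" "\<And>x. grad \<phi> x \<noteq> 0 \<Longrightarrow> x \<in> C" using Ck_c_1_E[OF subsetD[OF Cinf_c_subset \<phi>]] by metis
  have "(\<integral>x. (u x - w x) *\<^sub>R grad \<phi> x \<partial>lebesgue) = - (\<integral>x. \<phi> x *\<^sub>R (g x - h x) \<partial>lebesgue)"
    using weak_grad_split[OF u \<phi>] weak_grad_split[OF w \<phi>] by (simp add: scaleR_diff_left scaleR_diff_right)
  then show "(LINT x:U|lebesgue. (u x - w x) *\<^sub>R grad \<phi> x) = - (LINT x:U|lebesgue. \<phi> x *\<^sub>R (g x - h x))"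
    using C by (subst (1 2) set_integral_eq_integral_of_support) auto
qed

text \<open>Since \<open>wgrad\<close> selects some weak gradient, it is not literally linear;
  uniqueness gives linearity almost everywhere, which the integrals in \<open>W1p_norm\<close>
  cannot distinguish.\<close>

lemma AE_wgrad_diff_test:
  fixes U :: "'a::euclidean_space set"
  assumes U: "open U" and u: "\<exists>g. is_weak_grad U u g" and \<phi>: "\<phi> \<in> Cinf_c U"
  shows "AE x in lebesgue. x \<in> U \<longrightarrow> wgrad U (\<lambda>x. u x - \<phi> x) x = wgrad U u x - grad \<phi> x"
proof -
  have "is_weak_grad U u (wgrad U u)" using u unfolding wgrad_def by (rule someI_ex)
  from is_weak_grad_diff[OF this is_weak_grad_test[OF \<phi>]]
  have *: "is_weak_grad U (\<lambda>x. u x - \<phi> x) (\<lambda>x. wgrad U u x - grad \<phi> x)" .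
  then have "is_weak_grad U (\<lambda>x. u x - \<phi> x) (wgrad U (\<lambda>x. u x - \<phi> x))"
    unfolding wgrad_def[of U "\<lambda>x. u x - \<phi> x"] by (rule someI[of "is_weak_grad U (\<lambda>x. u x - \<phi> x)"])
  from is_weak_grad_unique[OF U this *] show ?thesis .
qed

text \<open>A polytope of dimension below that of the space has empty interior and is null by
  convexity. Differentiable maps of the space into itself preserve null sets, and the pieces are
  indexed by natural numbers.\<close>

lemma hardy_surface_null:
  fixes K :: "'a::euclidean_space set"
  assumes "hardy_surface \<Omega> k K" "DIM('a) \<ge> 2"
  shows "closed K" "K \<noteq> {}" "K \<in> null_sets lebesgue"
proof -
  have pw: "K \<noteq> {} \<and> negligible K" if surf: "piecewise_smooth_surface m K" and m: "m < DIM('a)" for m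
  proof -
    obtain I :: "nat set" and P :: "nat \<Rightarrow> 'a set" and \<phi> :: "nat \<Rightarrow> 'a \<Rightarrow> 'a" where
      K: "K \<noteq> {}" "K = (\<Union>i\<in>I. \<phi> i ` P i)"
      and P: "\<And>i. i \<in> I \<Longrightarrow> polytope (P i) \<and> aff_dim (P i) = int m \<and> (\<exists>U. open U \<and> P i \<subseteq> U \<and> smooth_on (\<phi> i) U)"
      using surf unfolding piecewise_smooth_surface_def by blast
    have "negligible (\<phi> i ` P i)" if i: "i \<in> I" for i
    proof (rule negligible_differentiable_image_negligible)
      have "interior (P i) = {}"
        using P[OF i] m aff_dim_nonempty_interior[of "P i"] by fastforce
      then show "negligible (P i)"
        using P[OF i] negligible_convex_interior[of "P i"] polytope_imp_convex by blast
      obtain U where U: "P i \<subseteq> U" "smooth_on (\<phi> i) U" using P[OF i] by blast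
      have "Ck_on (Suc 0) (\<phi> i) U" using U(2) unfolding smooth_on_def by blast
      then show "\<phi> i differentiable_on P i" using U(1) by (auto intro: differentiable_on_subset)
    qed simp
    then have "negligible K" unfolding K(2)
      by (intro negligible_countable_Union countable_image) auto
    then show ?thesis using K by blast
  qed
  have "closed K \<and> K \<noteq> {} \<and> negligible K"
  proof (cases "k = DIM('a)")
    case True
    then show ?thesis using assms unfolding hardy_surface_def by auto
  next
    case False
    then show ?thesis
      using assms pw[of "DIM('a) - k"] unfolding hardy_surface_def
      by (cases "k = 1") (auto simp: frontier_closed)
  qed
  then show "closed K" "K \<noteq> {}" "K \<in> null_sets lebesgue" by (auto simp: negligible_iff_null_sets)
qed

section \<open>Passage from test functions to the Sobolev space\<close>

context hardy_setting
begin

lemma d_zero: "x \<in> K \<Longrightarrow> d x = 0"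
  by (simp add: d_def)

text \<open>The two weighted integrals of u stand on the smaller side after the Hardy term is moved
  there, so Fatou's lemma suffices for them; the weights need not be bounded. Only the gradient term
  requires convergence in norm.\<close>

lemma hardy_sobolev_W1p0:
  assumes pN: "p < DIM('a)" and q: "p < q" "q \<le> real DIM('a) * p / (real DIM('a) - p)"
  shows "\<exists>c>0. \<forall>u\<in>W1p0 p (\<Omega> - K).
    set_integrable lebesgue \<Omega> (\<lambda>x. \<bar>u x\<bar> powr p / d x powr p) \<and>
    set_integrable lebesgue \<Omega> (\<lambda>x. \<bar>u x\<bar> powr q * d x powr (- q - real DIM('a) + real DIM('a) * q / p) * Xd x powr (2 * q / p)) \<and>
    c * (LINT x:\<Omega>|lebesgue. \<bar>u x\<bar> powr q * d x powr (- q - real DIM('a) + real DIM('a) * q / p) * Xd x powr (2 * q / p)) powr (p / q)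
      \<le> (LINT x:\<Omega>|lebesgue. norm (wgrad (\<Omega> - K) u x) powr p) - \<bar>H\<bar> powr p * (LINT x:\<Omega>|lebesgue. \<bar>u x\<bar> powr p / d x powr p)"
proof -
  define U where "U = \<Omega> - K"
  have U: "open U" unfolding U_def by (rule open_domain)
  have U_sets: "U \<in> sets lebesgue" using U by auto
  define e where "e = - q - real DIM('a) + real DIM('a) * q / p"
  define W where "W x = d x powr e * Xd x powr (2 * q / p)" for x
  obtain c where c: "c > 0" and test: "\<And>w. w \<in> Ck_c 1 U \<Longrightarrow>
    integrable lebesgue (\<lambda>x. norm (grad w x) powr p) \<and>
    integrable lebesgue (\<lambda>x. \<bar>w x\<bar> powr p / d x powr p) \<and>
    integrable lebesgue (\<lambda>x. \<bar>w x\<bar> powr q * W x) \<and>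
    c * (\<integral>x. \<bar>w x\<bar> powr q * W x \<partial>lebesgue) powr (p / q)
      \<le> (\<integral>x. norm (grad w x) powr p \<partial>lebesgue) - \<bar>H\<bar> powr p * (\<integral>x. \<bar>w x\<bar> powr p / d x powr p \<partial>lebesgue)"
    using hardy_sobolev_C1[OF pN q] unfolding U_def e_def W_def mult.assoc[symmetric] by blast
  define h where "h = \<bar>H\<bar> powr p"
  have h: "h > 0" using H_nonzero by (simp add: h_def)
  have "set_integrable lebesgue \<Omega> (\<lambda>x. \<bar>u x\<bar> powr p / d x powr p) \<and>
    set_integrable lebesgue \<Omega> (\<lambda>x. \<bar>u x\<bar> powr q * W x) \<and>
    c * (LINT x:\<Omega>|lebesgue. \<bar>u x\<bar> powr q * W x) powr (p / q)
      \<le> (LINT x:\<Omega>|lebesgue. norm (wgrad U u x) powr p) - h * (LINT x:\<Omega>|lebesgue. \<bar>u x\<bar> powr p / d x powr p)"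
    if u: "u \<in> W1p0 p U" for u
  proof -
    obtain \<phi> where \<phi>: "\<And>n. \<phi> n \<in> Cinf_c U" and lim0: "(\<lambda>n. W1p_norm p U (\<lambda>x. u x - \<phi> n x)) \<longlonglongrightarrow> 0"
      and uW: "u \<in> W1p p U"
      using u unfolding W1p0_def by auto
    have \<phi>C: "\<phi> n \<in> Ck_c 1 U" for n using \<phi> Cinf_c_subset by blast
    have weak: "\<exists>g. is_weak_grad U u g" and Lu: "Lp_on p U u" and Lv: "Lp_on p U (wgrad U u)"
      using uW unfolding W1p_def by auto
    \<comment> \<open>Extension by 0 from \<open>U\<close>: the values of \<open>u\<close> and
      \<open>wgrad U u\<close> elsewhere are arbitrary, while the test functions and their gradients
      vanish there.\<close>
    define u' where "u' x = indicator U x *\<^sub>R u x" for x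
    define v where "v x = indicator U x *\<^sub>R wgrad U u x" for x
    have p0: "p > 0" using p by simp
    have u'm: "u' \<in> borel_measurable lebesgue" and u'i: "integrable lebesgue (\<lambda>x. norm (u' x) powr p)"
    proof -
      show "u' \<in> borel_measurable lebesgue" using Lu by (simp add: Lp_on_def set_borel_measurable_def u'_def[abs_def])
      have "(\<lambda>x. norm (u' x) powr p) = (\<lambda>x. indicator U x *\<^sub>R (norm (u x) powr p))"
        by (auto simp: u'_def indicator_def fun_eq_iff)
      then show "integrable lebesgue (\<lambda>x. norm (u' x) powr p)" using Lu by (simp add: Lp_on_def set_integrable_def)
    qed
    have vm: "v \<in> borel_measurable lebesgue" and vi: "integrable lebesgue (\<lambda>x. norm (v x) powr p)"
    proof -
      show "v \<in> borel_measurable lebesgue" using Lv by (simp add: Lp_on_def set_borel_measurable_def v_def[abs_def])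
      have "(\<lambda>x. norm (v x) powr p) = (\<lambda>x. indicator U x *\<^sub>R (norm (wgrad U u x) powr p))"
        by (auto simp: v_def indicator_def fun_eq_iff)
      then show "integrable lebesgue (\<lambda>x. norm (v x) powr p)" using Lv by (simp add: Lp_on_def set_integrable_def)
    qed
    have supp: "x \<in> U" if "\<phi> n x \<noteq> 0 \<or> grad (\<phi> n) x \<noteq> 0" for n x
      using Ck_c_1_E[OF \<phi>C[of n]] that by (metis subsetD)
    have cont: "continuous_on UNIV (\<phi> n)" "continuous_on UNIV (grad (\<phi> n))" for n
      using Ck_c_1_E[OF \<phi>C[of n]] by metis+
    have \<phi>m: "\<phi> n \<in> borel_measurable lebesgue" "grad (\<phi> n) \<in> borel_measurable lebesgue" for n
      by (rule cont_lebesgue_measurable, rule cont)+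
    have \<phi>i: "integrable lebesgue (\<lambda>x. norm (\<phi> n x) powr p)" "integrable lebesgue (\<lambda>x. norm (grad (\<phi> n) x) powr p)" for n
    proof -
      show "integrable lebesgue (\<lambda>x. norm (grad (\<phi> n) x) powr p)" using test[OF \<phi>C] by blast
      obtain C where C: "compact C" "\<And>x. \<phi> n x \<noteq> 0 \<Longrightarrow> x \<in> C" using Ck_c_1_E[OF \<phi>C[of n]] by metis
      show "integrable lebesgue (\<lambda>x. norm (\<phi> n x) powr p)"
      proof (rule integrable_cont_on_compact[OF C(1)])
        show "continuous_on C (\<lambda>x. norm (\<phi> n x) powr p)"
          using continuous_on_subset[OF cont(1)[of n] subset_UNIV[of C]] p0
          by (auto intro!: continuous_intros continuous_on_powr')
      qed (use C(2) in force)
    qed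
    define a where "a n = (\<integral>x. norm (u' x - \<phi> n x) powr p \<partial>lebesgue)" for n
    define b where "b n = (\<integral>x. norm (v x - grad (\<phi> n) x) powr p \<partial>lebesgue)" for n
    have ab0: "0 \<le> a n" "0 \<le> b n" for n by (auto simp: a_def b_def)
    have norm_eq: "W1p_norm p U (\<lambda>x. u x - \<phi> n x) = (a n + b n) powr (1 / p)" for n
    proof -
      have "(LINT x:U|lebesgue. \<bar>u x - \<phi> n x\<bar> powr p) = a n"
        unfolding set_lebesgue_integral_def a_def
      proof (rule Bochner_Integration.integral_cong)
        fix x show "indicator U x *\<^sub>R \<bar>u x - \<phi> n x\<bar> powr p = norm (u' x - \<phi> n x) powr p"
          using supp[of n x] by (cases "x \<in> U") (auto simp: u'_def)
      qed simp
      moreover have "(LINT x:U|lebesgue. norm (wgrad U (\<lambda>x. u x - \<phi> n x) x) powr p) = b n"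
      proof -
        \<comment> \<open>The norm contains \<open>wgrad\<close> of the difference, a separate
          choice, which agrees only almost everywhere with the difference of the gradients.\<close>
        have ae: "AE x in lebesgue. norm (v x - grad (\<phi> n) x) powr p = indicator U x *\<^sub>R norm (wgrad U (\<lambda>x. u x - \<phi> n x) x) powr p"
          using AE_wgrad_diff_test[OF U weak \<phi>[of n]]
        proof eventually_elim
          fix x assume "x \<in> U \<longrightarrow> wgrad U (\<lambda>x. u x - \<phi> n x) x = wgrad U u x - grad (\<phi> n) x"
          then show "norm (v x - grad (\<phi> n) x) powr p = indicator U x *\<^sub>R norm (wgrad U (\<lambda>x. u x - \<phi> n x) x) powr p"
            using supp[of n x] by (cases "x \<in> U") (auto simp: v_def)
        qed
        have m: "(\<lambda>x. norm (v x - grad (\<phi> n) x) powr p) \<in> borel_measurable lebesgue"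
          by (rule borel_measurable_integrable[OF integrable_norm_diff_powr[OF vm vi \<phi>m(2) \<phi>i(2) p0]])
        show ?thesis unfolding set_lebesgue_integral_def b_def
          by (rule integral_cong_AE[symmetric, OF m borel_measurable_AE[OF m ae] ae])
      qed
      ultimately show ?thesis by (simp add: W1p_norm_def)
    qed
    have "(\<lambda>n. ((a n + b n) powr (1 / p)) powr p) \<longlonglongrightarrow> 0 powr p"
      using lim0 p0 unfolding norm_eq by (intro tendsto_powr' tendsto_const) auto
    then have ab: "(\<lambda>n. a n + b n) \<longlonglongrightarrow> 0" using p0 ab0 by (simp add: powr_powr)
    have a_lim: "a \<longlonglongrightarrow> 0" and b_lim: "b \<longlonglongrightarrow> 0"
      by (rule Lim_null_comparison[OF _ ab]; use ab0 in simp)+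
    \<comment> \<open>Convergence in L^p gives almost everywhere convergence along a subsequence, as
      Fatou's lemma requires.\<close>
    obtain r :: "nat \<Rightarrow> nat" where r: "strict_mono r" "AE x in lebesgue. (\<lambda>n. norm (u' x - \<phi> (r n) x) powr p) \<longlonglongrightarrow> 0"
      using tendsto_L1_AE_subseq[of lebesgue "\<lambda>n x. norm (u' x - \<phi> n x) powr p"]
        integrable_norm_diff_powr[OF u'm u'i \<phi>m(1) \<phi>i(1) p0] a_lim
      by (auto simp: a_def[abs_def])
    define \<psi> where "\<psi> n = \<phi> (r n)" for n
    have \<psi>C: "\<psi> n \<in> Ck_c 1 U" for n using \<phi>C by (simp add: \<psi>_def)
    have \<psi>_lim: "AE x in lebesgue. (\<lambda>n. \<psi> n x) \<longlonglongrightarrow> u' x"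
      using r(2)
    proof eventually_elim
      fix x assume "(\<lambda>n. norm (u' x - \<phi> (r n) x) powr p) \<longlonglongrightarrow> 0"
      then have "(\<lambda>n. (norm (u' x - \<phi> (r n) x) powr p) powr (1 / p)) \<longlonglongrightarrow> 0 powr (1 / p)"
        using p0 by (intro tendsto_powr' tendsto_const) auto
      then have "(\<lambda>n. norm (u' x - \<psi> n x)) \<longlonglongrightarrow> 0" using p0 by (simp add: powr_powr \<psi>_def)
      then have "(\<lambda>n. u' x - \<psi> n x) \<longlonglongrightarrow> 0" by (rule tendsto_norm_zero_cancel)
      then have "(\<lambda>n. u' x - (u' x - \<psi> n x)) \<longlonglongrightarrow> u' x - 0" by (intro tendsto_diff tendsto_const)
      then show "(\<lambda>n. \<psi> n x) \<longlonglongrightarrow> u' x" by simp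
    qed
    define V where "V = (\<integral>x. norm (v x) powr p \<partial>lebesgue)"
    define A where "A n = (\<integral>x. \<bar>\<psi> n x\<bar> powr q * W x \<partial>lebesgue)" for n
    define B where "B n = (\<integral>x. \<bar>\<psi> n x\<bar> powr p / d x powr p \<partial>lebesgue)" for n
    define E where "E n = (\<integral>x. norm (grad (\<psi> n) x) powr p \<partial>lebesgue)" for n
    have W0: "0 \<le> W x" for x by (simp add: W_def)
    have AB0: "0 \<le> A n" "0 \<le> B n" for n using W0 by (auto simp: A_def B_def)
    have ineq: "c * A n powr (p / q) + h * B n \<le> E n" for n
      using test[OF \<psi>C[of n]] by (simp add: A_def B_def E_def h_def)
    have EV: "\<forall>\<^sub>F n in sequentially. E n \<le> V + \<eta>" if \<eta>: "\<eta> > 0" for \<eta>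
    proof -
      have "\<forall>\<^sub>F n in sequentially. (\<integral>x. norm (grad (\<phi> n) x) powr p \<partial>lebesgue) \<le> V + \<eta>"
        unfolding V_def using b_lim
        by (intro eventually_powr_norm_le[OF \<phi>m(2) \<phi>i(2) vm vi p0 _ \<eta>]) (simp add: b_def[abs_def])
      then show ?thesis
        using eventually_subseq[OF r(1)] by (simp add: E_def \<psi>_def)
    qed
    have V1: "0 \<le> V" by (simp add: V_def)
    \<comment> \<open>The bounds required by \<open>fatou_bounded\<close> come from the inequality
      for test functions itself, as both summands on its left are nonnegative.\<close>
    have Abd: "\<forall>\<^sub>F n in sequentially. A n \<le> ((V + 1) / c) powr (q / p)"
      using EV[OF zero_less_one]
    proof eventually_elim
      fix n assume "E n \<le> V + 1"
      then have "c * A n powr (p / q) \<le> V + 1" using ineq[of n] mult_nonneg_nonneg[OF less_imp_le[OF h] AB0(2)[of n]] by linarith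
      then have "A n powr (p / q) \<le> (V + 1) / c" using c by (simp add: field_simps)
      then have "(A n powr (p / q)) powr (q / p) \<le> ((V + 1) / c) powr (q / p)" using p q by (intro powr_mono2) auto
      then show "A n \<le> ((V + 1) / c) powr (q / p)" using p q AB0 by (simp add: powr_powr)
    qed
    have Bbd: "\<forall>\<^sub>F n in sequentially. B n \<le> (V + 1) / h"
      using EV[OF zero_less_one]
    proof eventually_elim
      fix n assume "E n \<le> V + 1"
      then have "h * B n \<le> V + 1" using ineq[of n] mult_nonneg_nonneg[OF less_imp_le[OF c] powr_ge_zero[of "A n" "p / q"]] by linarith
      then show "B n \<le> (V + 1) / h" using h by (simp add: field_simps)
    qed
    have q0: "q > 0" using p q by simp
    have fA: "integrable lebesgue (\<lambda>x. \<bar>u' x\<bar> powr q * W x)"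
      "\<And>\<eta>. \<eta> > 0 \<Longrightarrow> \<forall>\<^sub>F n in sequentially. (\<integral>x. \<bar>u' x\<bar> powr q * W x \<partial>lebesgue) - \<eta> \<le> A n"
    proof -
      have l: "AE x in lebesgue. (\<lambda>n. \<bar>\<psi> n x\<bar> powr q * W x) \<longlonglongrightarrow> \<bar>u' x\<bar> powr q * W x"
        using \<psi>_lim by eventually_elim (use q0 in \<open>auto intro!: tendsto_mult tendsto_powr' tendsto_rabs\<close>)
      have i: "integrable lebesgue (\<lambda>x. \<bar>\<psi> n x\<bar> powr q * W x)" for n using test[OF \<psi>C] by blast
      have n: "0 \<le> \<bar>w\<bar> powr q * W x" for w x using W0 by simp
      note F = fatou_bounded[OF i n n l Abd[unfolded A_def]]
      show "integrable lebesgue (\<lambda>x. \<bar>u' x\<bar> powr q * W x)" by (rule F(1))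
      show "\<forall>\<^sub>F n in sequentially. (\<integral>x. \<bar>u' x\<bar> powr q * W x \<partial>lebesgue) - \<eta> \<le> A n" if "\<eta> > 0" for \<eta>
        unfolding A_def by (rule F(2)[OF that])
    qed
    have fB: "integrable lebesgue (\<lambda>x. \<bar>u' x\<bar> powr p / d x powr p)"
      "\<And>\<eta>. \<eta> > 0 \<Longrightarrow> \<forall>\<^sub>F n in sequentially. (\<integral>x. \<bar>u' x\<bar> powr p / d x powr p \<partial>lebesgue) - \<eta> \<le> B n"
    proof -
      have l: "AE x in lebesgue. (\<lambda>n. \<bar>\<psi> n x\<bar> powr p / d x powr p) \<longlonglongrightarrow> \<bar>u' x\<bar> powr p / d x powr p"
        using \<psi>_lim by eventually_elim
          (use p0 in \<open>auto simp: divide_inverse intro!: tendsto_mult tendsto_powr' tendsto_rabs\<close>)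
      have i: "integrable lebesgue (\<lambda>x. \<bar>\<psi> n x\<bar> powr p / d x powr p)" for n using test[OF \<psi>C] by blast
      have n: "0 \<le> \<bar>w\<bar> powr p / d x powr p" for w x by simp
      note F = fatou_bounded[OF i n n l Bbd[unfolded B_def]]
      show "integrable lebesgue (\<lambda>x. \<bar>u' x\<bar> powr p / d x powr p)" by (rule F(1))
      show "\<forall>\<^sub>F n in sequentially. (\<integral>x. \<bar>u' x\<bar> powr p / d x powr p \<partial>lebesgue) - \<eta> \<le> B n" if "\<eta> > 0" for \<eta>
        unfolding B_def by (rule F(2)[OF that])
    qed
    define A' B' where "A' = (\<integral>x. \<bar>u' x\<bar> powr q * W x \<partial>lebesgue)" and "B' = (\<integral>x. \<bar>u' x\<bar> powr p / d x powr p \<partial>lebesgue)"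
    have A'0: "0 \<le> A'" using W0 by (auto simp: A'_def)
    \<comment> \<open>All three estimates are taken at one index n. The maximum is there because
      \<open>powr\<close> is monotone on nonnegative reals and \<open>A' - \<eta>\<close> may be
      negative.\<close>
    have step: "c * max 0 (A' - \<eta>) powr (p / q) + h * (B' - \<eta>) \<le> V + \<eta>" if \<eta>: "\<eta> > 0" for \<eta>
    proof -
      have "\<forall>\<^sub>F n in sequentially. A' - \<eta> \<le> A n \<and> B' - \<eta> \<le> B n \<and> E n \<le> V + \<eta>"
        using fA(2)[OF \<eta>] fB(2)[OF \<eta>] EV[OF \<eta>] unfolding A'_def B'_def by eventually_elim auto
      then obtain n where n: "A' - \<eta> \<le> A n" "B' - \<eta> \<le> B n" "E n \<le> V + \<eta>"
        using eventually_happens[of _ sequentially] by auto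
      have "max 0 (A' - \<eta>) powr (p / q) \<le> A n powr (p / q)"
        using n(1) AB0 p0 q0 by (intro powr_mono2) auto
      then have "c * max 0 (A' - \<eta>) powr (p / q) \<le> c * A n powr (p / q)" using c by (intro mult_left_mono) auto
      moreover have "h * (B' - \<eta>) \<le> h * B n" using h n(2) by (intro mult_left_mono) auto
      ultimately show ?thesis using ineq[of n] n(3) by linarith
    qed
    have main: "c * A' powr (p / q) + h * B' \<le> V"
    proof (rule LIMSEQ_le)
      have i0: "(\<lambda>n. inverse (real (Suc n))) \<longlonglongrightarrow> 0" by (rule LIMSEQ_inverse_real_of_nat)
      have "(\<lambda>n. max 0 (A' - inverse (real (Suc n)))) \<longlonglongrightarrow> max 0 (A' - 0)"
        by (intro tendsto_max tendsto_diff tendsto_const i0)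
      then have "(\<lambda>n. max 0 (A' - inverse (real (Suc n)))) \<longlonglongrightarrow> A'" using A'0 by simp
      then have m1: "(\<lambda>n. max 0 (A' - inverse (real (Suc n))) powr (p / q)) \<longlonglongrightarrow> A' powr (p / q)"
        using p0 q0 by (intro tendsto_powr' tendsto_const) auto
      have m2: "(\<lambda>n. h * (B' - inverse (real (Suc n)))) \<longlonglongrightarrow> h * (B' - 0)"
        by (intro tendsto_mult tendsto_diff tendsto_const i0)
      show "(\<lambda>n. c * max 0 (A' - inverse (real (Suc n))) powr (p / q) + h * (B' - inverse (real (Suc n))))
        \<longlonglongrightarrow> c * A' powr (p / q) + h * B'"
        using tendsto_add[OF tendsto_mult[OF tendsto_const[of c] m1] m2] by simp
      have "(\<lambda>n. V + inverse (real (Suc n))) \<longlonglongrightarrow> V + 0" by (intro tendsto_add tendsto_const i0)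
      then show "(\<lambda>n. V + inverse (real (Suc n))) \<longlonglongrightarrow> V" by simp
    qed (use step in auto)
    \<comment> \<open>On \<open>\<Omega> \<inter> K\<close>, where \<open>u\<close> is arbitrary, both sides vanish since \<open>0 powr e = 0\<close> and \<open>x / 0 = 0\<close>.\<close>
    have eqA: "indicator \<Omega> x *\<^sub>R (\<bar>u x\<bar> powr q * W x) = \<bar>u' x\<bar> powr q * W x" for x
      using d_zero[of x] by (cases "x \<in> \<Omega>"; cases "x \<in> K") (auto simp: u'_def U_def W_def)
    have eqB: "indicator \<Omega> x *\<^sub>R (\<bar>u x\<bar> powr p / d x powr p) = \<bar>u' x\<bar> powr p / d x powr p" for x
      using d_zero[of x] by (cases "x \<in> \<Omega>"; cases "x \<in> K") (auto simp: u'_def U_def)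
    have eqV: "(LINT x:\<Omega>|lebesgue. norm (wgrad U u x) powr p) = V"
    proof -
      have ae: "AE x in lebesgue. norm (v x) powr p = indicator \<Omega> x *\<^sub>R norm (wgrad U u x) powr p"
        using AE_not_in[OF null_K] by eventually_elim (auto simp: v_def U_def indicator_def)
      have m: "(\<lambda>x. norm (v x) powr p) \<in> borel_measurable lebesgue" using vi by (rule borel_measurable_integrable)
      show ?thesis unfolding set_lebesgue_integral_def V_def
        by (rule integral_cong_AE[symmetric, OF m borel_measurable_AE[OF m ae] ae])
    qed
    show ?thesis
      unfolding set_integrable_def set_lebesgue_integral_def eqA eqB
      using fA(1) fB(1) main eqV unfolding A'_def B'_def set_lebesgue_integral_def by simp
  qed
  then show ?thesis using c unfolding U_def[symmetric] e_def[symmetric] h_def[symmetric]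
    by (intro exI[of _ c]) (simp add: W_def mult.assoc)
qed

end

theorem theorem6p4:
  fixes \<Omega> K :: "'a::euclidean_space set" and p q D :: real and k :: nat and d :: "'a \<Rightarrow> real"
  defines "d \<equiv> (\<lambda>x. infdist x K)"
  assumes p: "1 < p" "p < real DIM('a)"
    and domain: "open \<Omega>" "connected \<Omega>" "\<Omega> \<noteq> {}"
    and surface: "hardy_surface \<Omega> k K"
    and d_bdd: "bdd_above (d ` \<Omega>)"
    and D: "(SUP x\<in>\<Omega>. d x) < D"
    and p_neq_k: "p \<noteq> real k"
    and superharmonic: "\<forall>\<phi>\<in>Ck_c 1 (\<Omega> - K). (\<forall>x. 0 \<le> \<phi> x) \<longrightarrow> (p - real k) * A_fun \<Omega> k K \<phi> \<le> 0"
    and q: "p < q" "q \<le> real DIM('a) * p / (real DIM('a) - p)"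
  shows "\<exists>c>0. \<forall>u\<in>W1p0 p (\<Omega> - K).
      set_integrable lebesgue \<Omega> (\<lambda>x. \<bar>u x\<bar> powr p / d x powr p) \<and>
      set_integrable lebesgue \<Omega> (\<lambda>x. \<bar>u x\<bar> powr q
          * d x powr (- q - real DIM('a) + real DIM('a) * q / p) * X (d x / D) powr (2 * q / p)) \<and>
      (LINT x:\<Omega>|lebesgue. norm (wgrad (\<Omega> - K) u x) powr p)
        - \<bar>(real k - p) / p\<bar> powr p * (LINT x:\<Omega>|lebesgue. \<bar>u x\<bar> powr p / d x powr p)
      \<ge> c * (LINT x:\<Omega>|lebesgue. \<bar>u x\<bar> powr q
          * d x powr (- q - real DIM('a) + real DIM('a) * q / p) * X (d x / D) powr (2 * q / p)) powr (p / q)"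
proof -
  have dim: "DIM('a) \<ge> 2" using p by linarith
  note K = hardy_surface_null[OF surface dim]
  define s where "s = (SUP x\<in>\<Omega>. d x)"
  have s: "d x \<le> s" if "x \<in> \<Omega>" for x unfolding s_def using that d_bdd by (rule cSUP_upper)
  have s0: "0 \<le> s" using s domain(3) infdist_nonneg[of _ K] unfolding d_def by (meson all_not_in_conv order_trans)
  \<comment> \<open>The midpoint lies strictly below \<open>D\<close>, and it is positive even if
    the supremum is 0.\<close>
  define s1 where "s1 = (s + D) / 2"
  have s1: "0 < s1" "s1 < D" "s \<le> s1" using s0 D by (auto simp: s1_def s_def[symmetric])
  interpret h: hardy_setting \<Omega> K k p D s1
    by unfold_locales (use K domain p p_neq_k superharmonic s1 s in \<open>auto simp: d_def intro: order_trans\<close>)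
  show ?thesis
    using h.hardy_sobolev_W1p0[OF p(2) q] unfolding h.d_def h.Xd_def h.H_def d_def by simp
qed

end
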